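(* Let $n\ge 2$. For every oriented link $\Gamma$, the level $n$ Jones polynomial of $\Gamma$ is computed in $\mathbf{MOY}$ by the identity $$Z_{MOY}(\Gamma)=Jones_n(\Gamma)\,\emptyset$$ in $\mathrm{End}_{\mathbf{MOY}}(\emptyset)$.
   Context: Coefficient ring: $\mathbb Q[q,q^{-1},(q-q^{-1})^{-1}]$. Diagrams are read bottom to top, up to plane isotopy; $\circ$ is stacking (left factor on top), $\otimes$ juxtaposition. $[j]_q=\frac{q^j-q^{-j}}{q-q^{-1}}$. **Tangles.** $\mathbf{TD}$: objects are finite sequences of $\uparrow,\downarrow$; morphisms are linear combinations of oriented plane tangle diagrams modulo all oriented Reidemeister moves. $X_+$ (resp. $X_-$) is the crossing of two upward strands with over-strand running from bottom left to top right (resp. bottom right to top left). $Jones_n$ is the multiplicative (on disjoint unions) isotopy invariant of oriented links with $Jones_n(\emptyset)=1$, $Jones_n(\bigcirc)=[n]_q$ and $q^{-n}Jones_n(X_+)-q^nJones_n(X_-)=(q^{-1}-q)Jones_n(\uparrow\uparrow)$ for links differing only locally as indicated. **$\mathbf{MOY}$.** $\mathbf{TrPD}$: objects are finite sequences of $\uparrow^1,\downarrow^1$; morphisms are linear combinations of oriented plane trivalent graphs with edges labelled in $\{1,2\}$, boundary edges labelled 1, such that at each vertex the sum of incoming labels equals the sum of outgoing labels. It is rigid monoidal; morphisms are generated by identities, caps $\overrightarrow{ev}:\uparrow^1\downarrow^1\to\emptyset$, $\overleftarrow{ev}:\downarrow^1\uparrow^1\to\emptyset$, cups $\overrightarrow{coev}:\emptyset\to\uparrow^1\downarrow^1$,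 $\overleftarrow{coev}:\emptyset\to\downarrow^1\uparrow^1$, the graph $S:\uparrow^1\uparrow^1\to\uparrow^1\uparrow^1$ (two 1-edges merge into a 2-edge which splits into two 1-edges) and its dual $S^\vee$ (reversed orientations). Write $\mathrm{id}=\mathrm{id}_{\uparrow^1}$, $\mathrm{id}^\vee=\mathrm{id}_{\downarrow^1}$. $\mathbf{MOY}$ is the quotient of $\mathbf{TrPD}$ by the tensor ideal generated by the following relations and their duals (all orientations reversed): (1) the circle labelled 1 equals $[n]_q\,\emptyset$; (2) $S\circ S=(q+q^{-1})S$; (3) $(\overleftarrow{ev}\otimes\mathrm{id})\circ(\mathrm{id}^\vee\otimes S)\circ(\overleftarrow{coev}\otimes\mathrm{id})=[n-1]_q\,\mathrm{id}$; (4) $(\mathrm{id}\otimes\overrightarrow{ev}\otimes\mathrm{id}^\vee)\circ(S\otimes S^\vee)\circ(\mathrm{id}\otimes\overrightarrow{coev}\otimes\mathrm{id}^\vee)=\overrightarrow{coev}\circ\overrightarrow{ev}+[n-2]_q\,\mathrm{id}\otimes\mathrm{id}^\vee$; (5) $(S\otimes\mathrm{id})(\mathrm{id}\otimes S)(S\otimes\mathrm{id})+\mathrm{id}\otimes S=(\mathrm{id}\otimes S)(S\otimes\mathrm{id})(\mathrm{id}\otimes S)+S\otimes\mathrm{id}$. $Z_{MOY}:\mathbf{TD}\to\mathbf{MOY}$ is the rigid braided monoidal functor with $\uparrow\mapsto\uparrow^1$, cups and caps to cups and caps, $X_+\mapsto q^{n-1}\mathrm{id}_{\uparrow^1\uparrow^1}-q^nS$,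 $X_-\mapsto q^{1-n}\mathrm{id}_{\uparrow^1\uparrow^1}-q^{-n}S$. *)

theory Defs
  imports
    "HOL-Library.Poly_Mapping"
    "HOL-Computational_Algebra.Polynomial"
    "HOL-Computational_Algebra.Fraction_Field"
begin

section \<open>The coefficient ring\<close>

text \<open>The subring of the field of rational functions in one variable over the rationals
  that is generated by the rationals, \<open>q\<close>, \<open>q\<^sup>-\<^sup>1\<close> and \<open>(q - q\<^sup>-\<^sup>1)\<^sup>-\<^sup>1\<close>.\<close>

abbreviation (input) fract_X :: "rat poly fract"
  where "fract_X \<equiv> Fract [:0, 1:] 1"

inductive_set qring_set :: "rat poly fract set" where
  const: "Fract [:r:] 1 \<in> qring_set"
| var: "fract_X \<in> qring_set"
| inv_var: "inverse fract_X \<in> qring_set"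
| inv_diff: "inverse (fract_X - inverse fract_X) \<in> qring_set"
| add: "x \<in> qring_set \<Longrightarrow> y \<in> qring_set \<Longrightarrow> x + y \<in> qring_set"
| mult: "x \<in> qring_set \<Longrightarrow> y \<in> qring_set \<Longrightarrow> x * y \<in> qring_set"

lemma qring_set_0: "0 \<in> qring_set"
  using qring_set.const[of 0] by (simp add: Zero_fract_def)

lemma qring_set_1: "1 \<in> qring_set"
  using qring_set.const[of 1] by (simp add: One_fract_def flip: one_pCons)

lemma qring_set_uminus: "x \<in> qring_set \<Longrightarrow> - x \<in> qring_set"
proof -
  assume "x \<in> qring_set"
  then have "Fract [:- 1:] 1 * x \<in> qring_set"
    by (intro qring_set.mult qring_set.const)
  moreover have "Fract [:- 1:] 1 = (- 1 :: rat poly fract)"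
    by (simp add: One_fract_def one_pCons)
  ultimately show "- x \<in> qring_set" by simp
qed

lemma qring_set_diff: "x \<in> qring_set \<Longrightarrow> y \<in> qring_set \<Longrightarrow> x - y \<in> qring_set"
  using qring_set.add[OF _ qring_set_uminus] by fastforce

typedef qring = qring_set
  using qring_set_0 by blast

setup_lifting type_definition_qring

instantiation qring :: idom
begin

lift_definition zero_qring :: qring is 0 by (rule qring_set_0)
lift_definition one_qring :: qring is 1 by (rule qring_set_1)
lift_definition uminus_qring :: "qring \<Rightarrow> qring" is uminus by (rule qring_set_uminus)
lift_definition plus_qring :: "qring \<Rightarrow> qring \<Rightarrow> qring" is "(+)" by (rule qring_set.add)
lift_definition minus_qring :: "qring \<Rightarrow> qring \<Rightarrow> qring" is "(-)" by (rule qring_set_diff)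
lift_definition times_qring :: "qring \<Rightarrow> qring \<Rightarrow> qring" is "(*)" by (rule qring_set.mult)

instance
  by standard (transfer; simp add: algebra_simps)+

end

lift_definition q :: qring is fract_X by (rule qring_set.var)
lift_definition q_inv :: qring is "inverse fract_X" by (rule qring_set.inv_var)
lift_definition q_diff_inv :: qring is "inverse (fract_X - inverse fract_X)"
  by (rule qring_set.inv_diff)

lemma q_q_inv: "q * q_inv = 1"
  by transfer (simp add: One_fract_def eq_fract)

lemma q_diff_q_diff_inv: "(q - q_inv) * q_diff_inv = 1"
proof transfer
  have "fract_X \<noteq> (0 :: rat poly fract)"
    by (simp add: Zero_fract_def eq_fract)
  moreover have "fract_X * fract_X \<noteq> (1 :: rat poly fract)"
    by (simp add: One_fract_def eq_fract one_pCons)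
  ultimately have "fract_X - inverse fract_X \<noteq> (0 :: rat poly fract)"
    by (metis right_inverse eq_iff_diff_eq_0)
  then show "(fract_X - inverse fract_X) * inverse (fract_X - inverse fract_X) = (1 :: rat poly fract)"
    by (rule right_inverse)
qed

definition q_power :: "int \<Rightarrow> qring"
  where "q_power k = (if 0 \<le> k then q ^ nat k else q_inv ^ nat (- k))"

definition q_int :: "int \<Rightarrow> qring"
  where "q_int j = (q_power j - q_power (- j)) * q_diff_inv"


section \<open>Plane diagrams up to isotopy\<close>

text \<open>An oriented plane diagram is given by a term in the elementary diagrams:
  vertical strands \<open>Ident\<close>, caps, cups and the vertices of a type \<open>'v\<close> of local pictures
  (crossings, or pairs of trivalent vertices). Diagrams are read from bottom to top,
  and \<open>D \<odot> E\<close> has \<open>D\<close> on top.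
  In terms of the usual names, \<open>Cap Up\<close>, \<open>Cap Down\<close>, \<open>Cup Up\<close>, \<open>Cup Down\<close> are the
  right evaluation (defined on up-down), the left evaluation (on down-up), the right
  coevaluation (into up-down) and the left coevaluation (into down-up).\<close>

datatype orient = Up | Down

primrec opp :: "orient \<Rightarrow> orient" where
  "opp Up = Down"
| "opp Down = Up"

datatype 'v diagram =
    Ident "orient list"
  | Cap orient
  | Cup orient
  | Vertex 'v
  | Comp "'v diagram" "'v diagram"  (infixr \<open>\<odot>\<close> 70)
  | Tens "'v diagram" "'v diagram"  (infixr \<open>\<otimes>\<close> 75)

text \<open>Every vertex \<open>v\<close> is a diagram from \<open>ends v\<close> to \<open>ends v\<close>.\<close>

class vertex =
  fixes ends :: "'a \<Rightarrow> orient list"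

primrec src :: "'v::vertex diagram \<Rightarrow> orient list" where
  "src (Ident a) = a"
| "src (Cap s) = [s, opp s]"
| "src (Cup s) = []"
| "src (Vertex v) = ends v"
| "src (D \<odot> E) = src E"
| "src (D \<otimes> E) = src D @ src E"

primrec tgt :: "'v::vertex diagram \<Rightarrow> orient list" where
  "tgt (Ident a) = a"
| "tgt (Cap s) = []"
| "tgt (Cup s) = [s, opp s]"
| "tgt (Vertex v) = ends v"
| "tgt (D \<odot> E) = tgt D"
| "tgt (D \<otimes> E) = tgt D @ tgt E"

primrec wf_diagram :: "'v::vertex diagram \<Rightarrow> bool" where
  "wf_diagram (Ident a) \<longleftrightarrow> True"
| "wf_diagram (Cap s) \<longleftrightarrow> True"
| "wf_diagram (Cup s) \<longleftrightarrow> True"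
| "wf_diagram (Vertex v) \<longleftrightarrow> True"
| "wf_diagram (D \<odot> E) \<longleftrightarrow> wf_diagram D \<and> wf_diagram E \<and> src D = tgt E"
| "wf_diagram (D \<otimes> E) \<longleftrightarrow> wf_diagram D \<and> wf_diagram E"

definition in_hom :: "'v::vertex diagram \<Rightarrow> orient list \<Rightarrow> orient list \<Rightarrow> bool"
  where "in_hom D a b \<longleftrightarrow> wf_diagram D \<and> src D = a \<and> tgt D = b"

text \<open>The congruence on well-formed diagrams generated by the axioms of a strict monoidal
  category, the zigzag identities for cups and caps, and additional relations \<open>R\<close>.\<close>

inductive diagram_eq ::
  "('v::vertex diagram \<Rightarrow> 'v diagram \<Rightarrow> bool) \<Rightarrow> 'v diagram \<Rightarrow> 'v diagram \<Rightarrow> bool"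
  for R where
  base: "R D E \<Longrightarrow> diagram_eq R D E"
| refl: "wf_diagram D \<Longrightarrow> diagram_eq R D D"
| sym: "diagram_eq R D E \<Longrightarrow> diagram_eq R E D"
| trans: "diagram_eq R D E \<Longrightarrow> diagram_eq R E F \<Longrightarrow> diagram_eq R D F"
| comp: "diagram_eq R D D' \<Longrightarrow> diagram_eq R E E' \<Longrightarrow> src D = tgt E
    \<Longrightarrow> diagram_eq R (D \<odot> E) (D' \<odot> E')"
| tens: "diagram_eq R D D' \<Longrightarrow> diagram_eq R E E' \<Longrightarrow> diagram_eq R (D \<otimes> E) (D' \<otimes> E')"
| comp_assoc: "wf_diagram (D \<odot> E \<odot> F) \<Longrightarrow> diagram_eq R ((D \<odot> E) \<odot> F) (D \<odot> E \<odot> F)"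
| ident_comp: "wf_diagram D \<Longrightarrow> diagram_eq R (Ident (tgt D) \<odot> D) D"
| comp_ident: "wf_diagram D \<Longrightarrow> diagram_eq R (D \<odot> Ident (src D)) D"
| tens_assoc: "wf_diagram (D \<otimes> E \<otimes> F) \<Longrightarrow> diagram_eq R ((D \<otimes> E) \<otimes> F) (D \<otimes> E \<otimes> F)"
| unit_tens: "wf_diagram D \<Longrightarrow> diagram_eq R (Ident [] \<otimes> D) D"
| tens_unit: "wf_diagram D \<Longrightarrow> diagram_eq R (D \<otimes> Ident []) D"
| ident_tens: "diagram_eq R (Ident a \<otimes> Ident b) (Ident (a @ b))"
| interchange: "wf_diagram (D \<odot> E) \<Longrightarrow> wf_diagram (D' \<odot> E')
    \<Longrightarrow> diagram_eq R ((D \<otimes> D') \<odot> (E \<otimes> E')) ((D \<odot> E) \<otimes> (D' \<odot> E'))"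
| zigzag_left: "diagram_eq R ((Cap s \<otimes> Ident [s]) \<odot> (Ident [s] \<otimes> Cup (opp s))) (Ident [s])"
| zigzag_right: "diagram_eq R ((Ident [s] \<otimes> Cap (opp s)) \<odot> (Cup s \<otimes> Ident [s])) (Ident [s])"

text \<open>The rotations by a half turn, counterclockwise (\<open>left_mate\<close>) and clockwise
  (\<open>right_mate\<close>), of a diagram from \<open>[s, s]\<close> to \<open>[s, s]\<close>.\<close>

definition left_mate :: "orient \<Rightarrow> 'v diagram \<Rightarrow> 'v diagram" where
  "left_mate s D = (let t = opp s in
     ((Cap t \<odot> (Ident [t] \<otimes> Cap t \<otimes> Ident [s])) \<otimes> Ident [t, t])
     \<odot> (Ident [t, t] \<otimes> D \<otimes> Ident [t, t])
     \<odot> (Ident [t, t] \<otimes> ((Ident [s] \<otimes> Cup s \<otimes> Ident [t]) \<odot> Cup s)))"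

definition right_mate :: "orient \<Rightarrow> 'v diagram \<Rightarrow> 'v diagram" where
  "right_mate s D = (let t = opp s in
     (Ident [t, t] \<otimes> (Cap s \<odot> (Ident [s] \<otimes> Cap s \<otimes> Ident [t])))
     \<odot> (Ident [t, t] \<otimes> D \<otimes> Ident [t, t])
     \<odot> (((Ident [t] \<otimes> Cup t \<otimes> Ident [s]) \<odot> Cup t) \<otimes> Ident [t, t]))"


section \<open>Oriented tangles\<close>

text \<open>\<open>XPos\<close> and \<open>XNeg\<close> are the crossings of two upward strands whose over-strand runs from
  bottom left to top right, respectively from bottom right to top left. Any other crossing
  is a rotation of one of these.\<close>

datatype crossing = XPos | XNeg

instantiation crossing :: vertex
begin
definition ends_crossing :: "crossing \<Rightarrow> orient list" where "ends_crossing X = [Up, Up]"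
instance ..
end

type_synonym tangle = "crossing diagram"

datatype over = Slash | Backslash

primrec other :: "over \<Rightarrow> over" where
  "other Slash = Backslash"
| "other Backslash = Slash"

primrec up_crossing :: "over \<Rightarrow> tangle" where
  "up_crossing Slash = Vertex XPos"
| "up_crossing Backslash = Vertex XNeg"

text \<open>\<open>cross d s t\<close> is the crossing from \<open>[s, t]\<close> to \<open>[t, s]\<close> whose over-strand joins bottom
  left and top right if \<open>d = Slash\<close>, and bottom right and top left if \<open>d = Backslash\<close>.
  A quarter turn interchanges the two positions of the over-strand, a half turn keeps them.\<close>

fun cross :: "over \<Rightarrow> orient \<Rightarrow> orient \<Rightarrow> tangle" where
  "cross d Up Up = up_crossing d"
| "cross d Down Down = left_mate Up (up_crossing d)"
| "cross d Up Down =
     (Ident [Down, Up] \<otimes> Cap Up) \<odot> (Ident [Down] \<otimes> up_crossing (other d) \<otimes> Ident [Down])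
     \<odot> (Cup Down \<otimes> Ident [Up, Down])"
| "cross d Down Up =
     (Cap Down \<otimes> Ident [Up, Down]) \<odot> (Ident [Down] \<otimes> up_crossing (other d) \<otimes> Ident [Down])
     \<odot> (Ident [Down, Up] \<otimes> Cup Up)"

text \<open>\<open>rotate\<close> is a plane isotopy: a full turn of a crossing is trivial. The other rules are
  the Reidemeister moves, for all orientations of the strands. In \<open>reidemeister3\<close> the
  condition excludes exactly the two cyclic patterns, in which no strand is on top.\<close>

inductive tangle_move :: "tangle \<Rightarrow> tangle \<Rightarrow> bool" where
  rotate: "tangle_move (left_mate Up (Vertex X)) (right_mate Up (Vertex X))"
| reidemeister1_right: "tangle_move
    ((Ident [s] \<otimes> Cap s) \<odot> (cross d s s \<otimes> Ident [opp s]) \<odot> (Ident [s] \<otimes> Cup s)) (Ident [s])"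
| reidemeister1_left: "tangle_move
    ((Cap (opp s) \<otimes> Ident [s]) \<odot> (Ident [opp s] \<otimes> cross d s s) \<odot> (Cup (opp s) \<otimes> Ident [s]))
    (Ident [s])"
| reidemeister2: "tangle_move (cross (other d) t s \<odot> cross d s t) (Ident [s, t])"
| reidemeister3: "d1 = d2 \<or> d2 = d3 \<Longrightarrow> tangle_move
    ((cross d3 s t \<otimes> Ident [r]) \<odot> (Ident [s] \<otimes> cross d2 r t) \<odot> (cross d1 r s \<otimes> Ident [t]))
    ((Ident [t] \<otimes> cross d1 r s) \<odot> (cross d2 r t \<otimes> Ident [s]) \<odot> (Ident [r] \<otimes> cross d3 s t))"

abbreviation tangle_eq :: "tangle \<Rightarrow> tangle \<Rightarrow> bool"
  where "tangle_eq \<equiv> diagram_eq tangle_move"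

definition oriented_link :: "tangle \<Rightarrow> bool"
  where "oriented_link L \<longleftrightarrow> in_hom L [] []"

text \<open>The skein relation is imposed on all triples of links that differ only in one place:
  \<open>A\<close> and \<open>B\<close> are the parts above and below it, and \<open>u\<close>, \<open>v\<close> the strands passing it on the
  left and on the right.\<close>

definition is_Jones :: "nat \<Rightarrow> (tangle \<Rightarrow> qring) \<Rightarrow> bool" where
  "is_Jones n J \<longleftrightarrow>
     (\<forall>L L'. oriented_link L \<and> oriented_link L' \<and> tangle_eq L L' \<longrightarrow> J L = J L') \<and>
     (\<forall>L L'. oriented_link L \<and> oriented_link L' \<longrightarrow> J (L \<otimes> L') = J L * J L') \<and>
     J (Ident []) = 1 \<and>
     (\<forall>s. J (Cap s \<odot> Cup s) = q_int (int n)) \<and>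
     (\<forall>A B u v. in_hom A (u @ [Up, Up] @ v) [] \<and> in_hom B [] (u @ [Up, Up] @ v) \<longrightarrow>
        q_power (- int n) * J (A \<odot> (Ident u \<otimes> Vertex XPos \<otimes> Ident v) \<odot> B)
        - q_power (int n) * J (A \<odot> (Ident u \<otimes> Vertex XNeg \<otimes> Ident v) \<odot> B)
        = (q_inv - q) * J (A \<odot> (Ident u \<otimes> Ident [Up, Up] \<otimes> Ident v) \<odot> B))"


section \<open>The category MOY\<close>

text \<open>Each 2-labelled edge joins a merging vertex to a splitting vertex, so trivalent graphs
  with 1-labelled ends are composed of cups, caps and the diagrams \<open>Web s\<close>, in which two
  1-labelled strands of orientation \<open>s\<close> merge and split again; \<open>Web Down\<close> is the dual of
  \<open>Web Up\<close>, and equals its rotation by a half turn.\<close>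

datatype web = Web orient

instantiation web :: vertex
begin
primrec ends_web :: "web \<Rightarrow> orient list" where "ends_web (Web s) = [s, s]"
instance ..
end

type_synonym graph = "web diagram"

inductive web_rotation :: "graph \<Rightarrow> graph \<Rightarrow> bool" where
  left: "web_rotation (left_mate s (Vertex (Web s))) (Vertex (Web (opp s)))"
| right: "web_rotation (right_mate s (Vertex (Web s))) (Vertex (Web (opp s)))"

abbreviation graph_isotopic :: "graph \<Rightarrow> graph \<Rightarrow> bool"
  where "graph_isotopic \<equiv> diagram_eq web_rotation"

text \<open>Linear combinations of diagrams, and composition and tensor product extended
  bilinearly.\<close>

type_synonym lin = "graph \<Rightarrow>\<^sub>0 qring"

definition gr :: "graph \<Rightarrow> lin"
  where "gr D = Poly_Mapping.single D 1"

definition scale :: "qring \<Rightarrow> lin \<Rightarrow> lin"  (infixr \<open>*\<^sub>l\<close> 80)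
  where "c *\<^sub>l f = Poly_Mapping.map ((*) c) f"

definition lin_comp :: "lin \<Rightarrow> lin \<Rightarrow> lin"  (infixr \<open>\<odot>\<^sub>l\<close> 70) where
  "f \<odot>\<^sub>l g = (\<Sum>D\<in>Poly_Mapping.keys f. \<Sum>E\<in>Poly_Mapping.keys g.
     (Poly_Mapping.lookup f D * Poly_Mapping.lookup g E) *\<^sub>l gr (D \<odot> E))"

definition lin_tens :: "lin \<Rightarrow> lin \<Rightarrow> lin"  (infixr \<open>\<otimes>\<^sub>l\<close> 75) where
  "f \<otimes>\<^sub>l g = (\<Sum>D\<in>Poly_Mapping.keys f. \<Sum>E\<in>Poly_Mapping.keys g.
     (Poly_Mapping.lookup f D * Poly_Mapping.lookup g E) *\<^sub>l gr (D \<otimes> E))"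

text \<open>\<open>MOY_relation n a b f g\<close> is a defining relation \<open>f = g\<close> between morphisms from \<open>a\<close> to \<open>b\<close>;
  its instances with \<open>s = Down\<close> are the duals of those with \<open>s = Up\<close>.\<close>

inductive MOY_relation :: "nat \<Rightarrow> orient list \<Rightarrow> orient list \<Rightarrow> lin \<Rightarrow> lin \<Rightarrow> bool" for n where
  circle: "MOY_relation n [] []
    (gr (Cap s \<odot> Cup s))
    (q_int (int n) *\<^sub>l gr (Ident []))"
| digon: "MOY_relation n [s, s] [s, s]
    (gr (Vertex (Web s) \<odot> Vertex (Web s)))
    ((q + q_inv) *\<^sub>l gr (Vertex (Web s)))"
| curl: "MOY_relation n [s] [s]
    (gr ((Cap (opp s) \<otimes> Ident [s]) \<odot> (Ident [opp s] \<otimes> Vertex (Web s))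
         \<odot> (Cup (opp s) \<otimes> Ident [s])))
    (q_int (int n - 1) *\<^sub>l gr (Ident [s]))"
| square: "MOY_relation n [s, opp s] [s, opp s]
    (gr ((Ident [s] \<otimes> Cap s \<otimes> Ident [opp s]) \<odot> (Vertex (Web s) \<otimes> Vertex (Web (opp s)))
         \<odot> (Ident [s] \<otimes> Cup s \<otimes> Ident [opp s])))
    (gr (Cup s \<odot> Cap s) + q_int (int n - 2) *\<^sub>l gr (Ident [s] \<otimes> Ident [opp s]))"
| hexagon: "MOY_relation n [s, s, s] [s, s, s]
    (gr ((Vertex (Web s) \<otimes> Ident [s]) \<odot> (Ident [s] \<otimes> Vertex (Web s))
         \<odot> (Vertex (Web s) \<otimes> Ident [s]))
     + gr (Ident [s] \<otimes> Vertex (Web s)))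
    (gr ((Ident [s] \<otimes> Vertex (Web s)) \<odot> (Vertex (Web s) \<otimes> Ident [s])
         \<odot> (Ident [s] \<otimes> Vertex (Web s)))
     + gr (Vertex (Web s) \<otimes> Ident [s]))"

text \<open>The tensor ideal of the defining relations. The rule \<open>isotopy\<close> passes from terms to
  graphs up to plane isotopy.\<close>

inductive MOY_ideal :: "nat \<Rightarrow> orient list \<Rightarrow> orient list \<Rightarrow> lin \<Rightarrow> bool" for n where
  isotopy: "graph_isotopic D E \<Longrightarrow> in_hom D a b \<Longrightarrow> in_hom E a b
    \<Longrightarrow> MOY_ideal n a b (gr D - gr E)"
| relation: "MOY_relation n a b f g \<Longrightarrow> MOY_ideal n a b (f - g)"
| zero: "MOY_ideal n a b 0"
| add: "MOY_ideal n a b f \<Longrightarrow> MOY_ideal n a b g \<Longrightarrow> MOY_ideal n a b (f + g)"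
| scale: "MOY_ideal n a b f \<Longrightarrow> MOY_ideal n a b (c *\<^sub>l f)"
| comp_left: "MOY_ideal n a b f \<Longrightarrow> in_hom D b c \<Longrightarrow> MOY_ideal n a c (gr D \<odot>\<^sub>l f)"
| comp_right: "MOY_ideal n b c f \<Longrightarrow> in_hom D a b \<Longrightarrow> MOY_ideal n a c (f \<odot>\<^sub>l gr D)"
| tens_left: "MOY_ideal n a b f \<Longrightarrow> in_hom D c d \<Longrightarrow> MOY_ideal n (c @ a) (d @ b) (gr D \<otimes>\<^sub>l f)"
| tens_right: "MOY_ideal n a b f \<Longrightarrow> in_hom D c d \<Longrightarrow> MOY_ideal n (a @ c) (b @ d) (f \<otimes>\<^sub>l gr D)"

definition MOY_eq :: "nat \<Rightarrow> orient list \<Rightarrow> orient list \<Rightarrow> lin \<Rightarrow> lin \<Rightarrow> bool"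
  where "MOY_eq n a b f g \<longleftrightarrow> MOY_ideal n a b (f - g)"

primrec Z_crossing :: "nat \<Rightarrow> crossing \<Rightarrow> lin" where
  "Z_crossing n XPos =
     q_power (int n - 1) *\<^sub>l gr (Ident [Up, Up]) - q_power (int n) *\<^sub>l gr (Vertex (Web Up))"
| "Z_crossing n XNeg =
     q_power (1 - int n) *\<^sub>l gr (Ident [Up, Up]) - q_power (- int n) *\<^sub>l gr (Vertex (Web Up))"

primrec Z_MOY :: "nat \<Rightarrow> tangle \<Rightarrow> lin" where
  "Z_MOY n (Ident a) = gr (Ident a)"
| "Z_MOY n (Cap s) = gr (Cap s)"
| "Z_MOY n (Cup s) = gr (Cup s)"
| "Z_MOY n (Vertex X) = Z_crossing n X"
| "Z_MOY n (D \<odot> E) = Z_MOY n D \<odot>\<^sub>l Z_MOY n E"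
| "Z_MOY n (D \<otimes> E) = Z_MOY n D \<otimes>\<^sub>l Z_MOY n E"

end

theory Submission
  imports Defs
begin

text \<open>Both \<open>Z_MOY\<close> and the Jones polynomial are invariant under a few of the tangle moves, satisfy
  the same skein relation and multiply by \<open>[n]\<close> when a circle is added. Hence the links
  on which they agree form a class that contains the empty link and is closed under adding circles
  and, by the skein relation, under changing a crossing whose smoothing belongs to the class.

  Such a class contains every link: by induction over the diagram, modulo the class every tangle
  without inputs can be replaced by layered systems of arcs, in which each arc passes above all
  earlier ones. A new cap that joins two ends of such a system only pulls one end over other
  strands, and a new crossing either fits the layering or is changed, up to its smoothing, into
  one that does.\<close>

section \<open>Diagrams up to isotopy\<close>

text \<open>Diagrams are terms, so there is no curve to walk along and no crossing count that
  survives isotopy. Induction over the term takes the place of the usual induction on crossings, and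
  this forces tangles with ends into the argument. Agreement of two link invariants makes sense for
  links only, hence \<open>gen\<close> tests a tangle against all its closures. Crossings and caps
  on layered arcs are settled together by induction on the number of ends: smoothing a crossing of
  antiparallel strands produces a cap on equally many ends, while a cap leads to crossings on the
  system without its last arc, which has two ends fewer.

  Isotopies are computed as equations in a quotient type \<open>dgm\<close>, used for tangles and
  for webs. For tangles it imposes the moves of \<open>basic_move\<close>; these are verified for
  \<open>Z_MOY\<close>, and whatever the layering argument uses is derived from them inside the
  quotient. The skein relation holds for \<open>Z_MOY\<close> already as an identity of linear
  combinations: in q^(-n) X_+ - q^n X_- the web terms cancel and (q^(-1) - q) times the identity
  remains.\<close>

lemma opp_opp [simp]: "opp (opp s) = s"
  by (cases s) auto

lemma diagram_eq_in_hom: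
  assumes "diagram_eq R D E"
    and "\<And>D E. R D E \<Longrightarrow> wf_diagram D \<and> in_hom E (src D) (tgt D)"
  shows "wf_diagram D \<and> in_hom E (src D) (tgt D)"
  using assms(1)
  by (induction rule: diagram_eq.induct) (auto simp: in_hom_def opp_opp dest: assms(2))

text \<open>Attaching the moves to the type of vertices lets one quotient type, with one set of
  lemmas, serve both tangles and webs.\<close>

class move_vertex = vertex +
  fixes moves :: "'a diagram \<Rightarrow> 'a diagram \<Rightarrow> bool"

text \<open>A type class cannot require that moves relate well-formed diagrams with the same ends,
  hence the restriction. All ill-formed diagrams are identified, so that composition and tensor
  product are total and associative on the quotient.\<close>

definition wf_moves :: "'v::move_vertex diagram \<Rightarrow> 'v diagram \<Rightarrow> bool"
  where "wf_moves D E \<longleftrightarrow> moves D E \<and> wf_diagram D \<and> in_hom E (src D) (tgt D)"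

definition isotopic :: "'v::move_vertex diagram \<Rightarrow> 'v diagram \<Rightarrow> bool"
  where "isotopic D E \<longleftrightarrow> diagram_eq wf_moves D E \<or> \<not> wf_diagram D \<and> \<not> wf_diagram E"

lemma moves_eq_in_hom:
  "diagram_eq wf_moves D E \<Longrightarrow> wf_diagram D \<and> in_hom E (src D) (tgt D)"
  by (erule diagram_eq_in_hom) (simp add: wf_moves_def)

lemma isotopic_iff:
  "isotopic D E \<longleftrightarrow>
    diagram_eq wf_moves D E \<and> wf_diagram D \<and> wf_diagram E \<and> src E = src D \<and> tgt E = tgt D \<or>
    \<not> wf_diagram D \<and> \<not> wf_diagram E"
  using moves_eq_in_hom[of D E] by (auto simp: isotopic_def in_hom_def)

quotient_type (overloaded) 'v dgm = "'v::move_vertex diagram" / isotopic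
proof (rule equivpI)
  show "reflp (isotopic :: 'v diagram \<Rightarrow> _)"
    by (auto simp: reflp_def isotopic_def intro: diagram_eq.refl)
  show "symp (isotopic :: 'v diagram \<Rightarrow> _)"
    by (auto simp: symp_def isotopic_def intro: diagram_eq.sym)
  show "transp (isotopic :: 'v diagram \<Rightarrow> _)"
    unfolding transp_def isotopic_def
    by (meson diagram_eq.trans in_hom_def moves_eq_in_hom)
qed

lift_definition cmp :: "'v::move_vertex dgm \<Rightarrow> 'v dgm \<Rightarrow> 'v dgm" (infixr \<open>\<bullet>\<close> 70) is Comp
  by (auto simp: isotopic_iff intro: diagram_eq.comp)

lift_definition tns :: "'v::move_vertex dgm \<Rightarrow> 'v dgm \<Rightarrow> 'v dgm" (infixr \<open>\<star>\<close> 75) is Tens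
  by (auto simp: isotopic_iff intro: diagram_eq.tens)

lift_definition idn :: "orient list \<Rightarrow> 'v::move_vertex dgm" is Ident .
lift_definition cap :: "orient \<Rightarrow> 'v::move_vertex dgm" is Cap .
lift_definition cup :: "orient \<Rightarrow> 'v::move_vertex dgm" is Cup .
lift_definition vert :: "'v::move_vertex \<Rightarrow> 'v dgm" is Vertex .

lift_definition ok :: "'v::move_vertex dgm \<Rightarrow> bool" is wf_diagram
  by (auto simp: isotopic_iff)
text \<open>A constant value on ill-formed diagrams is forced by their identification in the
  quotient.\<close>

lift_definition dom :: "'v::move_vertex dgm \<Rightarrow> orient list"
  is "\<lambda>D. if wf_diagram D then src D else []"
  by (auto simp: isotopic_iff)
lift_definition cod :: "'v::move_vertex dgm \<Rightarrow> orient list"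
  is "\<lambda>D. if wf_diagram D then tgt D else []"
  by (auto simp: isotopic_iff)

lemma ok_simps [simp]:
  "ok (idn a)" "ok (cap s)" "ok (cup s)" "ok (vert v)"
  "ok (x \<bullet> y) \<longleftrightarrow> ok x \<and> ok y \<and> dom x = cod y"
  "ok (x \<star> y) \<longleftrightarrow> ok x \<and> ok y"
  by (transfer; auto)+

lemma dom_simps [simp]:
  "dom (idn a) = a" "dom (cap s) = [s, opp s]" "dom (cup s) = []" "dom (vert v) = ends v"
  "ok x \<Longrightarrow> ok y \<Longrightarrow> dom x = cod y \<Longrightarrow> dom (x \<bullet> y) = dom y"
  "ok x \<Longrightarrow> ok y \<Longrightarrow> dom (x \<star> y) = dom x @ dom y"
  by (transfer; auto)+

lemma cod_simps [simp]:
  "cod (idn a) = a" "cod (cap s) = []" "cod (cup s) = [s, opp s]" "cod (vert v) = ends v"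
  "ok x \<Longrightarrow> ok y \<Longrightarrow> dom x = cod y \<Longrightarrow> cod (x \<bullet> y) = cod x"
  "ok x \<Longrightarrow> ok y \<Longrightarrow> cod (x \<star> y) = cod x @ cod y"
  by (transfer; auto)+

lemma cmp_assoc [simp]: "(x \<bullet> y) \<bullet> z = x \<bullet> y \<bullet> z"
  by transfer (auto simp: isotopic_def intro: diagram_eq.comp_assoc)

lemma tns_assoc [simp]: "(x \<star> y) \<star> z = x \<star> y \<star> z"
  by transfer (auto simp: isotopic_def intro: diagram_eq.tens_assoc)

lemma idn_cmp: "ok x \<Longrightarrow> cod x = a \<Longrightarrow> idn a \<bullet> x = x"
  by transfer (auto simp: isotopic_def intro: diagram_eq.ident_comp)

lemma cmp_idn: "ok x \<Longrightarrow> dom x = a \<Longrightarrow> x \<bullet> idn a = x"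
  by transfer (auto simp: isotopic_def intro: diagram_eq.comp_ident)

lemma idn_tns [simp]: "idn [] \<star> x = x"
  by transfer (auto simp: isotopic_def intro: diagram_eq.unit_tens)

lemma tns_idn [simp]: "x \<star> idn [] = x"
  by transfer (auto simp: isotopic_def intro: diagram_eq.tens_unit)

lemma idn_tns_idn: "idn a \<star> idn b = idn (a @ b)"
  by transfer (auto simp: isotopic_def intro: diagram_eq.ident_tens)

lemma interchange:
  "ok x \<Longrightarrow> ok y \<Longrightarrow> ok z \<Longrightarrow> ok w \<Longrightarrow> dom x = cod z \<Longrightarrow> dom y = cod w \<Longrightarrow>
    (x \<star> y) \<bullet> (z \<star> w) = (x \<bullet> z) \<star> (y \<bullet> w)"
  by transfer (auto simp: isotopic_def intro: diagram_eq.interchange)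

lemma zigzag_left: "(cap s \<star> idn [s]) \<bullet> (idn [s] \<star> cup (opp s)) = idn [s]"
  by transfer (auto simp: isotopic_def intro: diagram_eq.zigzag_left)

lemma zigzag_right: "(idn [s] \<star> cap (opp s)) \<bullet> (cup s \<star> idn [s]) = idn [s]"
  by transfer (auto simp: isotopic_def intro: diagram_eq.zigzag_right)

lemma whisker_left:
  "ok x \<Longrightarrow> ok y \<Longrightarrow> dom x = cod y \<Longrightarrow> idn a \<star> (x \<bullet> y) = (idn a \<star> x) \<bullet> (idn a \<star> y)"
  by (simp add: interchange idn_cmp)

lemma whisker_right:
  "ok x \<Longrightarrow> ok y \<Longrightarrow> dom x = cod y \<Longrightarrow> (x \<bullet> y) \<star> idn a = (x \<star> idn a) \<bullet> (y \<star> idn a)"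
  by (simp add: interchange idn_cmp)

text \<open>By interchange both sides equal \<open>x \<star> y\<close>: the relative height of two
  parts standing side by side is immaterial.\<close>

lemma slide:
  assumes "ok x" "ok y" "dom x = a" "cod x = b" "dom y = c" "cod y = d"
  shows "(x \<star> idn d) \<bullet> (idn a \<star> y) = (idn b \<star> y) \<bullet> (x \<star> idn c)"
  using assms by (simp add: interchange idn_cmp cmp_idn)

lemma slide_cap:
  assumes "ok x" "ok y" "dom x = a" "cod x = []" "dom y = c" "cod y = d"
  shows "(x \<star> idn d) \<bullet> (idn a \<star> y) = y \<bullet> (x \<star> idn c)"
    and "(idn d \<star> x) \<bullet> (y \<star> idn a) = y \<bullet> (idn c \<star> x)"
  using slide[of x y a "[]" c d] slide[of y x c d a "[]"] assms by simp_all

lemma slide_cup: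
  assumes "ok x" "ok y" "cod x = a" "dom x = []" "dom y = c" "cod y = d"
  shows "(idn a \<star> y) \<bullet> (x \<star> idn c) = (x \<star> idn d) \<bullet> y"
    and "(y \<star> idn a) \<bullet> (idn c \<star> x) = (idn d \<star> x) \<bullet> y"
  using slide[of x y "[]" a c d] slide[of y x c d "[]" a] assms by simp_all

text \<open>Since \<open>tns_assoc\<close> associates to the right, two adjacent identities may be
  followed by a further factor; this form collects them there.\<close>

lemma idn_idn_tns: "idn a \<star> idn b \<star> x = idn (a @ b) \<star> x"
  by (simp add: idn_tns_idn flip: tns_assoc)

text \<open>The zigzags at \<open>opp s\<close> in the shape they have after the simplifier has
  removed double \<open>opp\<close>.\<close>

lemma zigzag_opp:
  "(cap (opp s) \<star> idn [opp s]) \<bullet> (idn [opp s] \<star> cup s) = idn [opp s]"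
  "(idn [opp s] \<star> cap s) \<bullet> (cup (opp s) \<star> idn [opp s]) = idn [opp s]"
  using zigzag_left[of "opp s"] zigzag_right[of "opp s"] by simp_all

lemmas zigzags = zigzag_left zigzag_right zigzag_opp

lemmas idn_collect = idn_tns_idn idn_idn_tns

section \<open>Bending and turning\<close>

text \<open>The rightmost input is bent up to an output by a cup and back down by a cap; the
  resulting zigzag straightens. With \<open>unbend_bend_right\<close> this makes the two bends
  inverse bijections, the adjunction given by duals.\<close>

lemma bend_right_unbend:
  assumes "ok w" "dom w = c @ [opp s]" "cod w = a"
  shows "(idn a \<star> cap s) \<bullet> (((w \<star> idn [s]) \<bullet> (idn c \<star> cup (opp s))) \<star> idn [opp s]) = w"
proof -
  have "(idn a \<star> cap s) \<bullet> (((w \<star> idn [s]) \<bullet> (idn c \<star> cup (opp s))) \<star> idn [opp s])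
    = (idn a \<star> cap s) \<bullet> (w \<star> idn [s, opp s]) \<bullet> (idn c \<star> cup (opp s) \<star> idn [opp s])"
    using assms by (simp add: whisker_right idn_collect)
  also have "\<dots> = ((idn a \<star> cap s) \<bullet> (w \<star> idn [s, opp s])) \<bullet> (idn c \<star> cup (opp s) \<star> idn [opp s])"
    by simp
  also have "(idn a \<star> cap s) \<bullet> (w \<star> idn [s, opp s]) = w \<bullet> (idn (c @ [opp s]) \<star> cap s)"
    using assms by (intro slide_cap) simp_all
  also have "(w \<bullet> (idn (c @ [opp s]) \<star> cap s)) \<bullet> (idn c \<star> cup (opp s) \<star> idn [opp s])
    = w \<bullet> (idn c \<star> ((idn [opp s] \<star> cap s) \<bullet> (cup (opp s) \<star> idn [opp s])))"
    using assms by (simp add: whisker_left idn_collect)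
  also have "\<dots> = w"
    using assms by (simp add: zigzags idn_collect cmp_idn)
  finally show ?thesis .
qed

lemma unbend_bend_right:
  assumes "ok x" "dom x = c" "cod x = a @ [s]"
  shows "(((idn a \<star> cap s) \<bullet> (x \<star> idn [opp s])) \<star> idn [s]) \<bullet> (idn c \<star> cup (opp s)) = x"
proof -
  have "(((idn a \<star> cap s) \<bullet> (x \<star> idn [opp s])) \<star> idn [s]) \<bullet> (idn c \<star> cup (opp s))
    = (idn a \<star> cap s \<star> idn [s]) \<bullet> ((x \<star> idn [opp s, s]) \<bullet> (idn c \<star> cup (opp s)))"
    using assms by (simp add: whisker_right idn_collect)
  also have "(x \<star> idn [opp s, s]) \<bullet> (idn c \<star> cup (opp s)) = (idn (a @ [s]) \<star> cup (opp s)) \<bullet> x"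
    using assms by (intro slide_cup) simp_all
  also have "(idn a \<star> cap s \<star> idn [s]) \<bullet> ((idn (a @ [s]) \<star> cup (opp s)) \<bullet> x)
    = (idn a \<star> ((cap s \<star> idn [s]) \<bullet> (idn [s] \<star> cup (opp s)))) \<bullet> x"
    using assms by (simp add: whisker_left idn_collect)
  also have "\<dots> = x"
    using assms by (simp add: zigzags idn_collect idn_cmp)
  finally show ?thesis .
qed

text \<open>Bending an output down has an inverse, so it may be applied to both sides of an equation
  that is to be proved. Equations between rotated diagrams are obtained in this way.\<close>

lemma bend_right_inject:
  assumes "ok x" "ok y" "dom x = dom y" "cod x = a @ [s]" "cod y = a @ [s]"
    and "(idn a \<star> cap s) \<bullet> (x \<star> idn [opp s]) = (idn a \<star> cap s) \<bullet> (y \<star> idn [opp s])"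
  shows "x = y"
  using unbend_bend_right[of x _ a s] unbend_bend_right[of y _ a s] assms by metis

lemma bend_left_unbend:
  assumes "ok z" "dom z = s # c" "cod z = b"
  shows "(cap s \<star> idn b) \<bullet> (idn [s] \<star> ((idn [opp s] \<star> z) \<bullet> (cup (opp s) \<star> idn c))) = z"
proof -
  have "(cap s \<star> idn b) \<bullet> (idn [s] \<star> ((idn [opp s] \<star> z) \<bullet> (cup (opp s) \<star> idn c)))
    = ((cap s \<star> idn b) \<bullet> (idn [s, opp s] \<star> z)) \<bullet> (idn [s] \<star> cup (opp s) \<star> idn c)"
    using assms by (simp add: whisker_left idn_collect)
  also have "(cap s \<star> idn b) \<bullet> (idn [s, opp s] \<star> z) = z \<bullet> (cap s \<star> idn (s # c))"
    using assms by (intro slide_cap) simp_all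
  also have "(z \<bullet> (cap s \<star> idn (s # c))) \<bullet> (idn [s] \<star> cup (opp s) \<star> idn c)
    = z \<bullet> (((cap s \<star> idn [s]) \<bullet> (idn [s] \<star> cup (opp s))) \<star> idn c)"
    using assms by (simp add: whisker_right idn_collect)
  also have "\<dots> = z"
    using assms by (simp add: zigzags idn_collect cmp_idn)
  finally show ?thesis .
qed

lemma unbend_bend_left:
  assumes "ok x" "dom x = c" "cod x = opp s # b"
  shows "(idn [opp s] \<star> ((cap s \<star> idn b) \<bullet> (idn [s] \<star> x))) \<bullet> (cup (opp s) \<star> idn c) = x"
proof -
  have "(idn [opp s] \<star> ((cap s \<star> idn b) \<bullet> (idn [s] \<star> x))) \<bullet> (cup (opp s) \<star> idn c)
    = (idn [opp s] \<star> cap s \<star> idn b) \<bullet> ((idn [opp s, s] \<star> x) \<bullet> (cup (opp s) \<star> idn c))"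
    using assms by (simp add: whisker_left idn_collect)
  also have "(idn [opp s, s] \<star> x) \<bullet> (cup (opp s) \<star> idn c) = (cup (opp s) \<star> idn (opp s # b)) \<bullet> x"
    using assms by (intro slide_cup) simp_all
  also have "(idn [opp s] \<star> cap s \<star> idn b) \<bullet> ((cup (opp s) \<star> idn (opp s # b)) \<bullet> x)
    = (((idn [opp s] \<star> cap s) \<bullet> (cup (opp s) \<star> idn [opp s])) \<star> idn b) \<bullet> x"
    using assms by (simp add: whisker_right idn_collect)
  also have "\<dots> = x"
    using assms by (simp add: zigzags idn_collect idn_cmp)
  finally show ?thesis .
qed

lemma bend_left_inject:
  assumes "ok x" "ok y" "dom x = dom y" "cod x = opp s # b" "cod y = opp s # b"
    and "(cap s \<star> idn b) \<bullet> (idn [s] \<star> x) = (cap s \<star> idn b) \<bullet> (idn [s] \<star> y)"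
  shows "x = y"
  using unbend_bend_left[of x _ s b] unbend_bend_left[of y _ s b] assms by metis

text \<open>Quarter turns: clockwise, the bottom left end moves to the top left and the top right
  end to the bottom right. Applied to upward crossings they give the crossings of antiparallel
  strands.\<close>

definition turn_cw :: "orient \<Rightarrow> 'v::move_vertex dgm \<Rightarrow> 'v dgm"
  where "turn_cw s f = (idn [opp s, s] \<star> cap s) \<bullet> (idn [opp s] \<star> f \<star> idn [opp s])
    \<bullet> (cup (opp s) \<star> idn [s, opp s])"

definition turn_ccw :: "orient \<Rightarrow> 'v::move_vertex dgm \<Rightarrow> 'v dgm"
  where "turn_ccw s f = (cap (opp s) \<star> idn [s, opp s]) \<bullet> (idn [opp s] \<star> f \<star> idn [opp s])
    \<bullet> (idn [opp s, s] \<star> cup s)"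

text \<open>The counterparts of \<open>left_mate\<close> and \<open>right_mate\<close> on the
  quotient.\<close>

definition half_ccw :: "orient \<Rightarrow> 'v::move_vertex dgm \<Rightarrow> 'v dgm" where
  "half_ccw s f = (let t = opp s in
     ((cap t \<bullet> (idn [t] \<star> cap t \<star> idn [s])) \<star> idn [t, t])
     \<bullet> (idn [t, t] \<star> f \<star> idn [t, t])
     \<bullet> (idn [t, t] \<star> ((idn [s] \<star> cup s \<star> idn [t]) \<bullet> cup s)))"

definition half_cw :: "orient \<Rightarrow> 'v::move_vertex dgm \<Rightarrow> 'v dgm" where
  "half_cw s f = (let t = opp s in
     (idn [t, t] \<star> (cap s \<bullet> (idn [s] \<star> cap s \<star> idn [t])))
     \<bullet> (idn [t, t] \<star> f \<star> idn [t, t])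
     \<bullet> (((idn [t] \<star> cup t \<star> idn [s]) \<bullet> cup t) \<star> idn [t, t]))"

definition endo2 :: "orient \<Rightarrow> 'v::move_vertex dgm \<Rightarrow> bool"
  where "endo2 s f \<longleftrightarrow> ok f \<and> dom f = [s, s] \<and> cod f = [s, s]"

lemma turn_simps [simp]:
  assumes "endo2 s f"
  shows "ok (turn_cw s f)" "dom (turn_cw s f) = [s, opp s]" "cod (turn_cw s f) = [opp s, s]"
    and "ok (turn_ccw s f)" "dom (turn_ccw s f) = [opp s, s]" "cod (turn_ccw s f) = [s, opp s]"
    and "ok (half_cw s f)" "dom (half_cw s f) = [opp s, opp s]" "cod (half_cw s f) = [opp s, opp s]"
    and "ok (half_ccw s f)" "dom (half_ccw s f) = [opp s, opp s]" "cod (half_ccw s f) = [opp s, opp s]"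
  using assms by (simp_all add: turn_cw_def turn_ccw_def half_cw_def half_ccw_def Let_def endo2_def)

text \<open>A clockwise quarter turn is the right side with its left input bent up, and the cap
  bends that strand back. By \<open>bend_left_inject\<close> the equation characterises the quarter
  turn.\<close>

lemma bend_left_turn_cw:
  assumes "endo2 s f"
  shows "(cap s \<star> idn [s]) \<bullet> (idn [s] \<star> turn_cw s f) = (idn [s] \<star> cap s) \<bullet> (f \<star> idn [opp s])"
proof -
  have "turn_cw s f = (idn [opp s] \<star> ((idn [s] \<star> cap s) \<bullet> (f \<star> idn [opp s])))
      \<bullet> (cup (opp s) \<star> idn [s, opp s])"
    using assms by (simp add: turn_cw_def endo2_def whisker_left idn_collect)
  with assms show ?thesis by (simp add: bend_left_unbend endo2_def)
qed

lemma bend_right_turn_ccw: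
  assumes "endo2 s f"
  shows "(idn [s] \<star> cap (opp s)) \<bullet> (turn_ccw s f \<star> idn [s])
    = (cap (opp s) \<star> idn [s]) \<bullet> (idn [opp s] \<star> f)"
proof -
  have "turn_ccw s f = (((cap (opp s) \<star> idn [s]) \<bullet> (idn [opp s] \<star> f)) \<star> idn [opp s])
      \<bullet> (idn [opp s, s] \<star> cup s)"
    using assms by (simp add: turn_ccw_def endo2_def whisker_right idn_collect)
  with assms bend_right_unbend[of "(cap (opp s) \<star> idn [s]) \<bullet> (idn [opp s] \<star> f)" "[opp s, s]" "opp s" "[s]"]
  show ?thesis by (simp add: endo2_def)
qed

text \<open>A half turn consists of two quarter turns. Grouping the bends of \<open>f\<close> into
  an inner quarter turn, called \<open>z\<close> once it is bent on the right, leaves a single outer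
  bend, which the cap undoes.\<close>

lemma bend_left_half_cw:
  assumes "endo2 s f"
  shows "(cap s \<star> idn [opp s]) \<bullet> (idn [s] \<star> half_cw s f)
    = (idn [opp s] \<star> cap s) \<bullet> (turn_cw s f \<star> idn [opp s])"
proof -
  define z where "z = (idn [opp s] \<star> (cap s \<bullet> (idn [s] \<star> cap s \<star> idn [opp s])))
    \<bullet> (idn [opp s] \<star> f \<star> idn [opp s, opp s]) \<bullet> (cup (opp s) \<star> idn [s, opp s, opp s])"
  have "half_cw s f = (idn [opp s] \<star> z) \<bullet> (cup (opp s) \<star> idn [opp s, opp s])"
    using assms
    by (simp add: half_cw_def Let_def z_def endo2_def whisker_left whisker_right idn_collect)
  moreover have "z = (idn [opp s] \<star> cap s) \<bullet> (turn_cw s f \<star> idn [opp s])"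
    using assms
    by (simp add: turn_cw_def z_def endo2_def whisker_left whisker_right idn_collect)
  ultimately show ?thesis using assms
    by (simp add: bend_left_unbend z_def endo2_def)
qed

lemma bend_right_half_ccw:
  assumes "endo2 s f"
  shows "(idn [opp s] \<star> cap (opp s)) \<bullet> (half_ccw s f \<star> idn [s])
    = (cap (opp s) \<star> idn [opp s]) \<bullet> (idn [opp s] \<star> turn_ccw s f)"
proof -
  define w where "w = ((cap (opp s) \<bullet> (idn [opp s] \<star> cap (opp s) \<star> idn [s])) \<star> idn [opp s])
    \<bullet> (idn [opp s, opp s] \<star> f \<star> idn [opp s]) \<bullet> (idn [opp s, opp s, s] \<star> cup s)"
  have "half_ccw s f = (w \<star> idn [opp s]) \<bullet> (idn [opp s, opp s] \<star> cup s)"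
    using assms
    by (simp add: half_ccw_def Let_def w_def endo2_def whisker_left whisker_right idn_collect)
  moreover have "w = (cap (opp s) \<star> idn [opp s]) \<bullet> (idn [opp s] \<star> turn_ccw s f)"
    using assms
    by (simp add: turn_ccw_def w_def endo2_def whisker_left whisker_right idn_collect)
  ultimately show ?thesis
    using assms bend_right_unbend[of w "[opp s, opp s]" "opp s" "[opp s]"]
    by (simp add: w_def endo2_def)
qed

text \<open>A half turn one way and a quarter turn back leave a quarter turn. With the right output
  bent down, both sides become the diagram of \<open>bend_left_half_cw\<close>.\<close>

lemma turn_ccw_half_cw:
  assumes "endo2 s f"
  shows "turn_ccw (opp s) (half_cw s f) = turn_cw s f"
proof (rule bend_right_inject[of _ _ "[opp s]" s])
  show "(idn [opp s] \<star> cap s) \<bullet> (turn_ccw (opp s) (half_cw s f) \<star> idn [opp s])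
      = (idn [opp s] \<star> cap s) \<bullet> (turn_cw s f \<star> idn [opp s])"
    using bend_right_turn_ccw[of "opp s" "half_cw s f"] bend_left_half_cw[OF assms] assms
    by (simp add: endo2_def)
qed (use assms turn_simps(4-6)[of "opp s" "half_cw s f"] in \<open>simp_all add: endo2_def\<close>)

text \<open>Once an output is bent down, the inner quarter turn is a cup above a cap, and a zigzag
  is left to straighten. Identity summands of rotated crossings are evaluated with this and the next
  three lemmas.\<close>

lemma half_ccw_idn: "half_ccw s (idn [s, s]) = (idn [opp s, opp s] :: 'v::move_vertex dgm)"
proof (rule bend_right_inject[of _ _ "[opp s]" "opp s"])
  have e: "endo2 s (idn [s, s] :: 'v dgm)" by (simp add: endo2_def)
  have "(idn [opp s] \<star> cap (opp s)) \<bullet> (half_ccw s (idn [s, s]) \<star> idn [s])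
    = (cap (opp s) \<star> idn [opp s]) \<bullet> (idn [opp s] \<star> ((cap (opp s) \<star> idn [s, opp s])
      \<bullet> (idn [opp s, s] \<star> cup s)) :: 'v dgm)"
    by (simp add: bend_right_half_ccw[OF e] turn_ccw_def idn_collect idn_cmp)
  also have "(cap (opp s) \<star> idn [s, opp s]) \<bullet> (idn [opp s, s] \<star> cup s) = cup s \<bullet> (cap (opp s) :: 'v dgm)"
    using slide_cap(1)[of "cap (opp s) :: 'v dgm" "cup s" "[opp s, s]" "[]" "[s, opp s]"] by simp
  also have "(cap (opp s) \<star> idn [opp s]) \<bullet> (idn [opp s] \<star> (cup s \<bullet> cap (opp s)))
    = ((cap (opp s) \<star> idn [opp s]) \<bullet> (idn [opp s] \<star> cup s)) \<bullet> (idn [opp s] \<star> cap (opp s) :: 'v dgm)"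
    by (simp add: whisker_left)
  finally show "(idn [opp s] \<star> cap (opp s)) \<bullet> (half_ccw s (idn [s, s]) \<star> idn [opp (opp s)])
    = (idn [opp s] \<star> cap (opp s)) \<bullet> (idn [opp s, opp s] \<star> idn [opp (opp s)] :: 'v dgm)"
    by (simp add: zigzags idn_collect idn_cmp cmp_idn)
qed (simp_all add: endo2_def)

lemma half_cw_idn: "half_cw s (idn [s, s]) = (idn [opp s, opp s] :: 'v::move_vertex dgm)"
proof (rule bend_left_inject[of _ _ s "[opp s]"])
  have e: "endo2 s (idn [s, s] :: 'v dgm)" by (simp add: endo2_def)
  have "(cap s \<star> idn [opp s]) \<bullet> (idn [s] \<star> half_cw s (idn [s, s]))
    = (idn [opp s] \<star> cap s) \<bullet> (((idn [opp s, s] \<star> cap s)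
      \<bullet> (cup (opp s) \<star> idn [s, opp s])) \<star> idn [opp s] :: 'v dgm)"
    by (simp add: bend_left_half_cw[OF e] turn_cw_def idn_collect idn_cmp)
  also have "(idn [opp s, s] \<star> cap s) \<bullet> (cup (opp s) \<star> idn [s, opp s]) = cup (opp s) \<bullet> (cap s :: 'v dgm)"
    using slide_cup(1)[of "cup (opp s) :: 'v dgm" "cap s" "[opp s, s]" "[s, opp s]" "[]"] by simp
  also have "(idn [opp s] \<star> cap s) \<bullet> ((cup (opp s) \<bullet> cap s) \<star> idn [opp s])
    = ((idn [opp s] \<star> cap s) \<bullet> (cup (opp s) \<star> idn [opp s])) \<bullet> (cap s \<star> idn [opp s] :: 'v dgm)"
    by (simp add: whisker_right)
  finally show "(cap s \<star> idn [opp s]) \<bullet> (idn [s] \<star> half_cw s (idn [s, s]))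
    = (cap s \<star> idn [opp s]) \<bullet> (idn [s] \<star> idn [opp s, opp s] :: 'v dgm)"
    by (simp add: zigzags idn_collect idn_cmp cmp_idn)
qed (simp_all add: endo2_def)

text \<open>Each of the two parallel strands is bent at one end only: the left one becomes a cup,
  the right one a cap.\<close>

lemma turn_cw_idn: "turn_cw s (idn [s, s]) = (cup (opp s) \<bullet> cap s :: 'v::move_vertex dgm)"
  using slide_cup(1)[of "cup (opp s) :: 'v dgm" "cap s" "[opp s, s]" "[s, opp s]" "[]"]
  by (simp add: turn_cw_def idn_collect idn_cmp)

lemma turn_ccw_idn: "turn_ccw s (idn [s, s]) = (cup s \<bullet> cap (opp s) :: 'v::move_vertex dgm)"
  using slide_cap(1)[of "cap (opp s) :: 'v dgm" "cup s" "[opp s, s]" "[]" "[s, opp s]"]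
  by (simp add: turn_ccw_def idn_collect idn_cmp)

text \<open>Turning the square, in which two vertices stand side by side, by a right angle
  puts one vertex above the other.\<close>

lemma turn_cw_turn_cw:
  fixes f g :: "'v::move_vertex dgm"
  assumes f: "endo2 s f" and g: "endo2 (opp s) g"
  shows "turn_cw (opp s) g \<bullet> turn_cw s f
    = (idn [s, opp s] \<star> cap s)
      \<bullet> (idn [s] \<star> ((idn [opp s] \<star> cap (opp s) \<star> idn [s]) \<bullet> (g \<star> f)
          \<bullet> (idn [opp s] \<star> cup (opp s) \<star> idn [s])) \<star> idn [opp s])
      \<bullet> (cup s \<star> idn [s, opp s])"
proof -
  let ?t = "opp s"
  define X where "X = turn_cw s f"
  define z where "z = (idn [s] \<star> cap s) \<bullet> (f \<star> idn [?t])"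
  have X: "ok X" "dom X = [s, ?t]" "cod X = [?t, s]"
    using turn_simps[OF f] by (simp_all add: X_def)
  have z: "ok z" "dom z = [s, s, ?t]" "cod z = [s]"
    using f by (simp_all add: z_def endo2_def)
  have Xz: "X = (idn [?t] \<star> z) \<bullet> (cup ?t \<star> idn [s, ?t])"
    using f by (simp add: X_def turn_cw_def z_def endo2_def whisker_left idn_collect)
  have "turn_cw ?t g \<bullet> X = (idn [s, ?t] \<star> cap ?t) \<bullet> (idn [s] \<star> g \<star> idn [s]) \<bullet> ((cup s \<star> idn [?t, s]) \<bullet> X)"
    using g X by (simp add: turn_cw_def endo2_def)
  \<comment> \<open>The cup that opens the upper turn is pulled below the lower turn, which brings
    \<open>g\<close> and \<open>f\<close> into one picture.\<close>
  also have "(cup s \<star> idn [?t, s]) \<bullet> X = (idn [s, ?t] \<star> X) \<bullet> (cup s \<star> idn [s, ?t])"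
    using X by (intro slide_cup(1)[symmetric]) simp_all
  also have "(idn [s, ?t] \<star> cap ?t) \<bullet> (idn [s] \<star> g \<star> idn [s]) \<bullet> (idn [s, ?t] \<star> X) \<bullet> (cup s \<star> idn [s, ?t])
    = (idn [s] \<star> ((idn [?t] \<star> cap ?t) \<bullet> ((g \<star> idn [s]) \<bullet> (idn [?t, ?t] \<star> z)) \<bullet> (idn [?t] \<star> cup ?t \<star> idn [s, ?t])))
      \<bullet> (cup s \<star> idn [s, ?t])"
    using g X z by (simp add: endo2_def whisker_left idn_collect Xz)
  also have "(g \<star> idn [s]) \<bullet> (idn [?t, ?t] \<star> z) = (idn [?t, ?t] \<star> z) \<bullet> (g \<star> idn [s, s, ?t])"
    using g z by (intro slide) (simp_all add: endo2_def)
  also have "(idn [?t] \<star> cap ?t) \<bullet> ((idn [?t, ?t] \<star> z) \<bullet> (g \<star> idn [s, s, ?t])) \<bullet> (idn [?t] \<star> cup ?t \<star> idn [s, ?t])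
    = (idn [?t] \<star> cap ?t) \<bullet> (idn [?t, ?t, s] \<star> cap s) \<bullet> (idn [?t, ?t] \<star> f \<star> idn [?t])
      \<bullet> (g \<star> idn [s, s, ?t]) \<bullet> (idn [?t] \<star> cup ?t \<star> idn [s, ?t])"
    using f by (simp add: z_def endo2_def whisker_left idn_collect)
  also have "\<dots> = ((idn [?t] \<star> cap ?t) \<bullet> (idn [?t, ?t, s] \<star> cap s)) \<bullet> ((idn [?t, ?t] \<star> f \<star> idn [?t])
      \<bullet> (g \<star> idn [s, s, ?t])) \<bullet> (idn [?t] \<star> cup ?t \<star> idn [s, ?t])"
    by simp
  also have "(idn [?t] \<star> cap ?t) \<bullet> (idn [?t, ?t, s] \<star> cap s) = (idn [?t] \<star> cap s) \<bullet> (idn [?t] \<star> cap ?t \<star> idn [s, ?t] :: 'v dgm)"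
    using slide[of "idn [?t] \<star> cap ?t :: 'v dgm" "cap s" "[?t, ?t, s]" "[?t]" "[s, ?t]" "[]"]
    by (simp add: idn_collect)
  \<comment> \<open>Now \<open>g\<close> and \<open>f\<close> act on disjoint strands, so they can
    be put at the same height: this is the square.\<close>
  also have "(idn [?t, ?t] \<star> f \<star> idn [?t]) \<bullet> (g \<star> idn [s, s, ?t]) = g \<star> f \<star> idn [?t]"
    using f g by (simp add: interchange idn_cmp cmp_idn endo2_def)
  also have "idn [s] \<star> (((idn [?t] \<star> cap s) \<bullet> (idn [?t] \<star> cap ?t \<star> idn [s, ?t])) \<bullet> (g \<star> f \<star> idn [?t])
        \<bullet> (idn [?t] \<star> cup ?t \<star> idn [s, ?t]))
    = (idn [s, ?t] \<star> cap s)
      \<bullet> (idn [s] \<star> ((idn [?t] \<star> cap ?t \<star> idn [s]) \<bullet> (g \<star> f) \<bullet> (idn [?t] \<star> cup ?t \<star> idn [s])) \<star> idn [?t])"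
    using f g by (simp add: endo2_def whisker_left whisker_right idn_collect)
  finally show ?thesis by (simp add: X_def)
qed

text \<open>\<open>swing s r f g\<close> says that a strand \<open>r\<close> crosses the ascending or the descending side of
  a cap in the ways \<open>g\<close> and \<open>f\<close> that differ by sliding the crossing along the cap.\<close>

definition swing :: "orient \<Rightarrow> orient \<Rightarrow> 'v::move_vertex dgm \<Rightarrow> 'v dgm \<Rightarrow> bool"
  where "swing s r f g \<longleftrightarrow> ok f \<and> dom f = [r, opp s] \<and> cod f = [opp s, r]
    \<and> ok g \<and> dom g = [s, r] \<and> cod g = [r, s]
    \<and> (cap s \<star> idn [r]) \<bullet> (idn [s] \<star> f) = (idn [r] \<star> cap s) \<bullet> (g \<star> idn [opp s])"

text \<open>Undoing the bend determines \<open>f\<close> from \<open>g\<close>, by the formula of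
  \<open>turn_cw\<close> with a second strand \<open>r\<close> of arbitrary orientation.\<close>

lemma swing_unbend:
  fixes f g :: "'v::move_vertex dgm"
  assumes "swing s r f g"
  shows "f = (idn [opp s, r] \<star> cap s) \<bullet> (idn [opp s] \<star> g \<star> idn [opp s]) \<bullet> (cup (opp s) \<star> idn [r, opp s])"
proof -
  have g: "ok g" "dom g = [s, r]" "cod g = [r, s]" using assms by (auto simp: swing_def)
  have "f = (idn [opp s] \<star> ((idn [r] \<star> cap s) \<bullet> (g \<star> idn [opp s]))) \<bullet> (cup (opp s) \<star> idn [r, opp s])"
    using unbend_bend_left[of f "[r, opp s]" s "[r]"] assms by (simp add: swing_def)
  also have "\<dots> = (idn [opp s, r] \<star> cap s) \<bullet> (idn [opp s] \<star> g \<star> idn [opp s]) \<bullet> (cup (opp s) \<star> idn [r, opp s])"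
    using g by (simp add: whisker_left idn_collect)
  finally show ?thesis .
qed

text \<open>Sliding along a cap implies sliding along a cup: \<open>f\<close> is \<open>g\<close>
  with one bend on each side, and the bend on the right cancels against the cup in a zigzag.\<close>

lemma swing_cup:
  fixes f g :: "'v::move_vertex dgm"
  assumes "swing s r f g"
  shows "(f \<star> idn [s]) \<bullet> (idn [r] \<star> cup (opp s)) = (idn [opp s] \<star> g) \<bullet> (cup (opp s) \<star> idn [r])"
proof -
  let ?t = "opp s"
  have g: "ok g" "dom g = [s, r]" "cod g = [r, s]" using assms by (auto simp: swing_def)
  have "(f \<star> idn [s]) \<bullet> (idn [r] \<star> cup ?t)
    = (idn [?t, r] \<star> cap s \<star> idn [s]) \<bullet> (idn [?t] \<star> g \<star> idn [?t, s])
      \<bullet> ((cup ?t \<star> idn [r, ?t, s]) \<bullet> (idn [r] \<star> cup ?t))"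
    using g by (subst swing_unbend[OF assms]) (simp add: whisker_right idn_collect)
  also have "(cup ?t \<star> idn [r, ?t, s]) \<bullet> (idn [r] \<star> cup ?t) = (idn [?t, s, r] \<star> cup ?t) \<bullet> (cup ?t \<star> idn [r] :: 'v dgm)"
    using slide_cup(1)[of "cup ?t :: 'v dgm" "idn [r] \<star> cup ?t" "[?t, s]" "[r]" "[r, ?t, s]"]
    by (simp add: idn_collect)
  also have "(idn [?t, r] \<star> cap s \<star> idn [s]) \<bullet> (idn [?t] \<star> g \<star> idn [?t, s])
      \<bullet> ((idn [?t, s, r] \<star> cup ?t) \<bullet> (cup ?t \<star> idn [r]))
    = (idn [?t, r] \<star> cap s \<star> idn [s]) \<bullet> ((idn [?t] \<star> g \<star> idn [?t, s])
      \<bullet> (idn [?t, s, r] \<star> cup ?t)) \<bullet> (cup ?t \<star> idn [r])"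
    by simp
  also have "(idn [?t] \<star> g \<star> idn [?t, s]) \<bullet> (idn [?t, s, r] \<star> cup ?t)
    = (idn [?t, r, s] \<star> cup ?t) \<bullet> (idn [?t] \<star> g)"
    using slide_cup(2)[of "cup ?t" "idn [?t] \<star> g" "[?t, s]" "[?t, s, r]" "[?t, r, s]"] g
    by simp
  also have "(idn [?t, r] \<star> cap s \<star> idn [s]) \<bullet> ((idn [?t, r, s] \<star> cup ?t) \<bullet> (idn [?t] \<star> g)) \<bullet> (cup ?t \<star> idn [r])
    = (idn [?t, r] \<star> ((cap s \<star> idn [s]) \<bullet> (idn [s] \<star> cup ?t))) \<bullet> (idn [?t] \<star> g) \<bullet> (cup ?t \<star> idn [r])"
    using g by (simp add: whisker_left idn_collect)
  also have "\<dots> = (idn [?t] \<star> g) \<bullet> (cup ?t \<star> idn [r])"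
    using g by (simp add: zigzags idn_collect idn_cmp)
  finally show ?thesis .
qed

section \<open>Tangles\<close>

text \<open>The moves that define the quotient. In \<open>triangle\<close> one upward strand passes
  over both strands of a crossing \<open>d\<close>; the passage of strands of either orientation
  over arbitrary tangles is derived from it in \<open>natural\<close>, and the right-hand curl in
  \<open>crs_curl_right\<close>.\<close>

inductive basic_move :: "tangle \<Rightarrow> tangle \<Rightarrow> bool" where
  rotate: "basic_move (left_mate Up (Vertex X)) (right_mate Up (Vertex X))"
| curl: "basic_move
    ((Cap (opp s) \<otimes> Ident [s]) \<odot> (Ident [opp s] \<otimes> cross d s s) \<odot> (Cup (opp s) \<otimes> Ident [s]))
    (Ident [s])"
| cancel: "basic_move (cross (other d) t s \<odot> cross d s t) (Ident [s, t])"
| triangle: "basic_move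
    ((cross d Up Up \<otimes> Ident [Up]) \<odot> (Ident [Up] \<otimes> cross Slash Up Up)
      \<odot> (cross Slash Up Up \<otimes> Ident [Up]))
    ((Ident [Up] \<otimes> cross Slash Up Up) \<odot> (cross Slash Up Up \<otimes> Ident [Up])
      \<odot> (Ident [Up] \<otimes> cross d Up Up))"

lemma basic_move_tangle_move: "basic_move D E \<Longrightarrow> tangle_move D E"
  by (auto elim!: basic_move.cases intro: tangle_move.intros)

instantiation crossing :: move_vertex
begin
definition moves_crossing :: "tangle \<Rightarrow> tangle \<Rightarrow> bool" where "moves_crossing = basic_move"
instance ..
end

lemma in_hom_up_crossing: "in_hom (up_crossing d) [Up, Up] [Up, Up]"
  by (cases d) (auto simp: in_hom_def ends_crossing_def)

lemma cross_in_hom: "in_hom (cross d s t) [s, t] [t, s]"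
  using in_hom_up_crossing[of d] in_hom_up_crossing[of "other d"]
  by (cases s; cases t) (auto simp: in_hom_def left_mate_def Let_def)

lemma wf_cross [simp]:
  "wf_diagram (cross d s t)" "src (cross d s t) = [s, t]" "tgt (cross d s t) = [t, s]"
  using cross_in_hom[of d s t] by (auto simp: in_hom_def)

lemma basic_move_in_hom: "basic_move D E \<Longrightarrow> wf_diagram D \<and> in_hom E (src D) (tgt D)"
proof (induction rule: basic_move.induct)
  case (rotate X)
  show ?case by (auto simp: in_hom_def left_mate_def right_mate_def Let_def ends_crossing_def)
qed (simp_all add: in_hom_def del: cross.simps)

lemma abs_dgm_basic_move: "basic_move D E \<Longrightarrow> abs_dgm D = abs_dgm E"
  using basic_move_in_hom[of D E]
  by (auto simp: dgm.abs_eq_iff isotopic_def wf_moves_def moves_crossing_def intro: diagram_eq.base)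

lemmas abs_dgm_simps =
  cmp.abs_eq [symmetric] tns.abs_eq [symmetric] idn.abs_eq [symmetric]
  cap.abs_eq [symmetric] cup.abs_eq [symmetric] vert.abs_eq [symmetric]

definition crs :: "over \<Rightarrow> orient \<Rightarrow> orient \<Rightarrow> crossing dgm"
  where "crs d s t = abs_dgm (cross d s t)"

lemma crs_simps [simp]:
  "ok (crs d s t)" "dom (crs d s t) = [s, t]" "cod (crs d s t) = [t, s]"
  by (simp_all add: crs_def ok.abs_eq dom.abs_eq cod.abs_eq)

lemma other_other [simp]: "other (other d) = d"
  by (cases d) auto

lemma endo2_crs: "endo2 Up (crs d Up Up)"
  by (simp add: endo2_def)

lemma crs_Down_Down: "crs d Down Down = half_ccw Up (crs d Up Up)"
  by (simp add: crs_def half_ccw_def left_mate_def Let_def abs_dgm_simps)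

text \<open>The move \<open>rotate\<close> identifies the two half turns. Both forms are used in
  \<open>swing_crs\<close>.\<close>

lemma crs_Down_Down': "crs d Down Down = half_cw Up (crs d Up Up)"
proof -
  have "abs_dgm (left_mate Up (up_crossing d)) = abs_dgm (right_mate Up (up_crossing d))"
    by (cases d) (auto intro: abs_dgm_basic_move basic_move.intros)
  then show ?thesis
    by (simp add: crs_def half_cw_def right_mate_def Let_def abs_dgm_simps)
qed

lemma crs_Up_Down: "crs d Up Down = turn_cw Up (crs (other d) Up Up)"
  by (simp add: crs_def turn_cw_def abs_dgm_simps)

lemma crs_Down_Up: "crs d Down Up = turn_ccw Up (crs (other d) Up Up)"
  by (simp add: crs_def turn_ccw_def abs_dgm_simps)

lemma crs_cancel: "crs (other d) t s \<bullet> crs d s t = idn [s, t]"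
  unfolding crs_def using abs_dgm_basic_move[OF basic_move.cancel[of d t s]]
  by (simp only: abs_dgm_simps)

lemma crs_curl:
  "(cap (opp s) \<star> idn [s]) \<bullet> (idn [opp s] \<star> crs d s s) \<bullet> (cup (opp s) \<star> idn [s]) = idn [s]"
  unfolding crs_def using abs_dgm_basic_move[OF basic_move.curl[of s d]]
  by (simp only: abs_dgm_simps)

lemma crs_triangle:
  "(crs d Up Up \<star> idn [Up]) \<bullet> (idn [Up] \<star> crs Slash Up Up) \<bullet> (crs Slash Up Up \<star> idn [Up])
    = (idn [Up] \<star> crs Slash Up Up) \<bullet> (crs Slash Up Up \<star> idn [Up]) \<bullet> (idn [Up] \<star> crs d Up Up)"
  unfolding crs_def using abs_dgm_basic_move[OF basic_move.triangle[of d]]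
  by (simp only: abs_dgm_simps)

text \<open>Every crossing is an upward crossing or a turn of one, and the four orientations
  correspond to the four lemmas on bending a turned diagram. A quarter turn interchanges the
  positions of the over-strand, hence \<open>d\<close> and \<open>other d\<close>.\<close>

lemma swing_crs: "swing s r (crs d r (opp s)) (crs (other d) s r)"
proof -
  have "(cap s \<star> idn [r]) \<bullet> (idn [s] \<star> crs d r (opp s))
    = (idn [r] \<star> cap s) \<bullet> (crs (other d) s r \<star> idn [opp s])"
  proof (cases s; cases r)
    assume "s = Up" "r = Up"
    then show ?thesis
      using bend_left_turn_cw[OF endo2_crs[of "other d"]] by (simp add: crs_Up_Down)
  next
    assume "s = Up" "r = Down"
    then show ?thesis
      using bend_left_half_cw[OF endo2_crs[of d]] by (simp add: crs_Up_Down crs_Down_Down')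
  next
    assume "s = Down" "r = Up"
    then show ?thesis
      using bend_right_turn_ccw[OF endo2_crs[of d]] by (simp add: crs_Down_Up)
  next
    assume "s = Down" "r = Down"
    then show ?thesis
      using bend_right_half_ccw[OF endo2_crs[of "other d"]]
      by (simp add: crs_Down_Up crs_Down_Down)
  qed
  then show ?thesis by (simp add: swing_def)
qed

lemma swing_crs_cap:
  "(cap s \<star> idn [r]) \<bullet> (idn [s] \<star> crs d r (opp s))
    = (idn [r] \<star> cap s) \<bullet> (crs (other d) s r \<star> idn [opp s])"
  using swing_crs[of s r d] by (simp add: swing_def)

lemma swing_crs_cup:
  "(crs d r s \<star> idn [opp s]) \<bullet> (idn [r] \<star> cup s) = (idn [s] \<star> crs (other d) (opp s) r) \<bullet> (cup s \<star> idn [r])"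
  using swing_cup[OF swing_crs[of "opp s" r d]] by simp

text \<open>A kink at the top of an arc. Written as a turned crossing and with the two caps
  exchanged in height, it contains the left-hand curl, which the first Reidemeister move
  removes.\<close>

lemma cap_crs: "cap s \<bullet> crs d (opp s) s = cap (opp s)"
proof -
  let ?t = "opp s"
  have "crs d ?t s = (idn [s, ?t] \<star> cap ?t) \<bullet> (idn [s] \<star> crs (other d) ?t ?t \<star> idn [s])
      \<bullet> (cup s \<star> idn [?t, s])"
    using swing_unbend[OF swing_crs[of ?t ?t d]] by simp
  then have "cap s \<bullet> crs d ?t s
    = (cap s \<bullet> (idn [s, ?t] \<star> cap ?t)) \<bullet> (idn [s] \<star> crs (other d) ?t ?t \<star> idn [s]) \<bullet> (cup s \<star> idn [?t, s])"
    by simp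
  also have "cap s \<bullet> (idn [s, ?t] \<star> cap ?t) = cap ?t \<bullet> (cap s \<star> idn [?t, s] :: crossing dgm)"
    using slide_cap(1)[of "cap s :: crossing dgm" "cap ?t" "[s, ?t]" "[?t, s]" "[]"] by simp
  also have "(cap ?t \<bullet> (cap s \<star> idn [?t, s])) \<bullet> (idn [s] \<star> crs (other d) ?t ?t \<star> idn [s]) \<bullet> (cup s \<star> idn [?t, s])
    = cap ?t \<bullet> (((cap s \<star> idn [?t]) \<bullet> (idn [s] \<star> crs (other d) ?t ?t) \<bullet> (cup s \<star> idn [?t])) \<star> idn [s])"
    by (simp add: whisker_right idn_collect)
  also have "(cap s \<star> idn [?t]) \<bullet> (idn [s] \<star> crs (other d) ?t ?t) \<bullet> (cup s \<star> idn [?t]) = idn [?t]"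
    using crs_curl[of ?t "other d"] by simp
  finally show ?thesis by (simp add: idn_collect cmp_idn)
qed

text \<open>Sliding the crossing along the cup carries it under the cap, where it is a kink of the
  kind removed by \<open>cap_crs\<close>; a zigzag remains.\<close>

lemma crs_curl_right:
  "(idn [s] \<star> cap s) \<bullet> (crs d s s \<star> idn [opp s]) \<bullet> (idn [s] \<star> cup s) = idn [s]"
proof -
  have "(idn [s] \<star> cap s) \<bullet> (crs d s s \<star> idn [opp s]) \<bullet> (idn [s] \<star> cup s)
    = (idn [s] \<star> (cap s \<bullet> crs (other d) (opp s) s)) \<bullet> (cup s \<star> idn [s])"
    by (simp add: swing_crs_cup whisker_left)
  then show ?thesis by (simp add: cap_crs zigzag_right)
qed

lemma crs_cup: "crs d s (opp s) \<bullet> cup s = cup (opp s)"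
proof -
  let ?t = "opp s"
  have "crs d s ?t = (idn [?t, s] \<star> cap s) \<bullet> (idn [?t] \<star> crs (other d) s s \<star> idn [?t])
      \<bullet> (cup ?t \<star> idn [s, ?t])"
    using swing_unbend[OF swing_crs[of s s d]] by simp
  then have "crs d s ?t \<bullet> cup s
    = (idn [?t, s] \<star> cap s) \<bullet> (idn [?t] \<star> crs (other d) s s \<star> idn [?t]) \<bullet> ((cup ?t \<star> idn [s, ?t]) \<bullet> cup s)"
    by simp
  also have "(cup ?t \<star> idn [s, ?t]) \<bullet> cup s = (idn [?t, s] \<star> cup s) \<bullet> (cup ?t :: crossing dgm)"
    using slide_cup(1)[of "cup ?t :: crossing dgm" "cup s" "[?t, s]" "[]" "[s, ?t]"] by simp
  also have "(idn [?t, s] \<star> cap s) \<bullet> (idn [?t] \<star> crs (other d) s s \<star> idn [?t]) \<bullet> (idn [?t, s] \<star> cup s) \<bullet> cup ?t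
    = (idn [?t] \<star> ((idn [s] \<star> cap s) \<bullet> (crs (other d) s s \<star> idn [?t]) \<bullet> (idn [s] \<star> cup s))) \<bullet> cup ?t"
    by (simp add: whisker_left idn_collect)
  finally show ?thesis by (simp add: crs_curl_right idn_collect idn_cmp)
qed

section \<open>Strands passing over a tangle\<close>

text \<open>In \<open>crs Slash r s\<close> the over-strand starts at the bottom left, where
  \<open>r\<close> is; so \<open>r\<close> runs above all strands of \<open>a\<close>.\<close>

primrec over_pass :: "orient \<Rightarrow> orient list \<Rightarrow> crossing dgm" where
  "over_pass r [] = idn [r]"
| "over_pass r (s # a) = (idn [s] \<star> over_pass r a) \<bullet> (crs Slash r s \<star> idn a)"

lemma over_pass_simps [simp]:
  "ok (over_pass r a) \<and> dom (over_pass r a) = r # a \<and> cod (over_pass r a) = a @ [r]"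
  by (induction a) simp_all

lemma over_pass_append:
  "over_pass r (a @ b) = (idn a \<star> over_pass r b) \<bullet> (over_pass r a \<star> idn b)"
proof (induction a)
  case Nil
  then show ?case by (simp add: idn_collect cmp_idn)
next
  case (Cons s a)
  then show ?case by (simp add: whisker_left whisker_right idn_collect)
qed

text \<open>Naturality of \<open>over_pass r\<close> in \<open>f\<close>: the strand may be pulled
  over \<open>f\<close>.\<close>

definition natural :: "orient \<Rightarrow> crossing dgm \<Rightarrow> bool"
  where "natural r f \<longleftrightarrow> over_pass r (cod f) \<bullet> (idn [r] \<star> f) = (f \<star> idn [r]) \<bullet> over_pass r (dom f)"

lemma natural_idn: "natural r (idn a)"
  by (simp add: natural_def idn_collect idn_cmp cmp_idn)

lemma natural_cmp:
  assumes "natural r f" "natural r g" "ok f" "ok g" "dom f = cod g"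
  shows "natural r (f \<bullet> g)"
proof -
  have "over_pass r (cod f) \<bullet> (idn [r] \<star> (f \<bullet> g))
    = (over_pass r (cod f) \<bullet> (idn [r] \<star> f)) \<bullet> (idn [r] \<star> g)"
    using assms by (simp add: whisker_left)
  also have "\<dots> = (f \<star> idn [r]) \<bullet> (over_pass r (cod g) \<bullet> (idn [r] \<star> g))"
    using assms by (simp add: natural_def)
  also have "\<dots> = ((f \<bullet> g) \<star> idn [r]) \<bullet> over_pass r (dom g)"
    using assms by (simp add: natural_def whisker_right)
  finally show ?thesis using assms by (simp add: natural_def)
qed

lemma natural_tns:
  assumes "natural r f" "natural r g" "ok f" "ok g"
  shows "natural r (f \<star> g)"
proof -
  \<comment> \<open>At different heights the two factors are passed one after the other, and
    \<open>natural_cmp\<close> combines the results.\<close>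
  have fg: "f \<star> g = (idn (cod f) \<star> g) \<bullet> (f \<star> idn (dom g))"
    using assms by (simp add: interchange idn_cmp cmp_idn)
  have "natural r (idn (cod f) \<star> g)"
  proof -
    have "over_pass r (cod f @ cod g) \<bullet> (idn (r # cod f) \<star> g)
      = (idn (cod f) \<star> over_pass r (cod g)) \<bullet> ((over_pass r (cod f) \<star> idn (cod g)) \<bullet> (idn (r # cod f) \<star> g))"
      by (simp add: over_pass_append)
    also have "(over_pass r (cod f) \<star> idn (cod g)) \<bullet> (idn (r # cod f) \<star> g)
      = (idn (cod f @ [r]) \<star> g) \<bullet> (over_pass r (cod f) \<star> idn (dom g))"
      using assms by (intro slide) simp_all
    also have "(idn (cod f) \<star> over_pass r (cod g)) \<bullet> (idn (cod f @ [r]) \<star> g) \<bullet> (over_pass r (cod f) \<star> idn (dom g))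
      = (idn (cod f) \<star> (over_pass r (cod g) \<bullet> (idn [r] \<star> g))) \<bullet> (over_pass r (cod f) \<star> idn (dom g))"
      using assms by (simp add: whisker_left idn_collect)
    also have "over_pass r (cod g) \<bullet> (idn [r] \<star> g) = (g \<star> idn [r]) \<bullet> over_pass r (dom g)"
      using assms by (simp add: natural_def)
    finally show ?thesis
      using assms by (simp add: natural_def over_pass_append whisker_left idn_collect)
  qed
  moreover have "natural r (f \<star> idn (dom g))"
  proof -
    have "over_pass r (cod f @ dom g) \<bullet> (idn [r] \<star> f \<star> idn (dom g))
      = (idn (cod f) \<star> over_pass r (dom g)) \<bullet> ((over_pass r (cod f) \<bullet> (idn [r] \<star> f)) \<star> idn (dom g))"
      using assms by (simp add: over_pass_append whisker_right)
    also have "over_pass r (cod f) \<bullet> (idn [r] \<star> f) = (f \<star> idn [r]) \<bullet> over_pass r (dom f)"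
      using assms by (simp add: natural_def)
    also have "(idn (cod f) \<star> over_pass r (dom g)) \<bullet> (((f \<star> idn [r]) \<bullet> over_pass r (dom f)) \<star> idn (dom g))
      = ((idn (cod f) \<star> over_pass r (dom g)) \<bullet> (f \<star> idn (r # dom g))) \<bullet> (over_pass r (dom f) \<star> idn (dom g))"
      using assms by (simp add: whisker_right idn_collect)
    also have "(idn (cod f) \<star> over_pass r (dom g)) \<bullet> (f \<star> idn (r # dom g))
      = (f \<star> idn (dom g @ [r])) \<bullet> (idn (dom f) \<star> over_pass r (dom g))"
      using assms by (intro slide[symmetric]) simp_all
    finally show ?thesis
      using assms by (simp add: natural_def over_pass_append idn_collect)
  qed
  ultimately show ?thesis
    using assms unfolding fg by (intro natural_cmp) simp_all
qed

text \<open>Swinging the crossing with the right leg over to the left leg turns it into the inverse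
  of the crossing already there.\<close>

lemma natural_cap: "natural r (cap s)"
proof -
  have "(cap s \<star> idn [r]) \<bullet> over_pass r [s, opp s]
    = ((cap s \<star> idn [r]) \<bullet> (idn [s] \<star> crs Slash r (opp s))) \<bullet> (crs Slash r s \<star> idn [opp s])"
    by (simp add: idn_collect cmp_idn idn_cmp)
  also have "\<dots> = (idn [r] \<star> cap s) \<bullet> ((crs Backslash s r \<bullet> crs Slash r s) \<star> idn [opp s])"
    by (simp add: swing_crs_cap whisker_right)
  also have "\<dots> = idn [r] \<star> cap s"
    using crs_cancel[of Slash s r] by (simp add: idn_collect cmp_idn)
  finally show ?thesis by (simp add: natural_def idn_cmp)
qed

lemma natural_cup: "natural r (cup s)"
proof -
  have "over_pass r [s, opp s] \<bullet> (idn [r] \<star> cup s)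
    = (idn [s] \<star> crs Slash r (opp s)) \<bullet> ((crs Slash r s \<star> idn [opp s]) \<bullet> (idn [r] \<star> cup s))"
    by (simp add: idn_collect cmp_idn idn_cmp)
  also have "\<dots> = (idn [s] \<star> (crs Slash r (opp s) \<bullet> crs Backslash (opp s) r)) \<bullet> (cup s \<star> idn [r])"
    by (simp add: swing_crs_cup whisker_left)
  also have "\<dots> = cup s \<star> idn [r]"
    using crs_cancel[of Backslash r "opp s"] by (simp add: idn_collect idn_cmp)
  finally show ?thesis by (simp add: natural_def cmp_idn)
qed

text \<open>For a descending strand the relation is obtained from the one for an ascending strand
  by bending: passing a descending strand to the right is passing an ascending strand back to
  the left.\<close>

lemma natural_crs: "natural r (crs d Up Up)"
proof (cases r)
  case Up
  then show ?thesis using crs_triangle[of d]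
    by (simp add: natural_def idn_collect cmp_idn idn_cmp)
next
  case Down
  let ?c = "crs Slash Up Up" and ?c' = "crs Backslash Up Up" and ?X = "crs d Up Up"
  \<comment> \<open>\<open>P\<close> takes an ascending strand to the right above two others and
    \<open>Q\<close> takes it back. \<open>E\<close> is the passage of the descending strand, which
    will turn out to be \<open>Q\<close> after bending.\<close>
  define P where "P = (idn [Up] \<star> ?c) \<bullet> (?c \<star> idn [Up])"
  define Q where "Q = (?c' \<star> idn [Up]) \<bullet> (idn [Up] \<star> ?c')"
  define E where "E = over_pass Down [Up, Up]"
  have [simp]: "ok P" "dom P = [Up, Up, Up]" "cod P = [Up, Up, Up]"
    "ok Q" "dom Q = [Up, Up, Up]" "cod Q = [Up, Up, Up]"
    "ok E" "dom E = [Down, Up, Up]" "cod E = [Up, Up, Down]"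
    by (simp_all add: P_def Q_def E_def)
  have cc': "?c \<bullet> ?c' = idn [Up, Up]" "?c' \<bullet> ?c = idn [Up, Up]"
    using crs_cancel[of Slash Up Up] crs_cancel[of Backslash Up Up] by simp_all
  have "P \<bullet> Q = (idn [Up] \<star> ?c) \<bullet> ((?c \<bullet> ?c') \<star> idn [Up]) \<bullet> (idn [Up] \<star> ?c')"
    by (simp add: P_def Q_def whisker_right)
  then have PQ: "P \<bullet> Q = idn [Up, Up, Up]"
    by (simp add: cc' idn_collect idn_cmp flip: whisker_left)
  have "Q \<bullet> P = (?c' \<star> idn [Up]) \<bullet> (idn [Up] \<star> (?c' \<bullet> ?c)) \<bullet> (?c \<star> idn [Up])"
    by (simp add: P_def Q_def whisker_left)
  then have QP: "Q \<bullet> P = idn [Up, Up, Up]"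
    by (simp add: cc' idn_collect idn_cmp flip: whisker_right)
  have XP: "(?X \<star> idn [Up]) \<bullet> P = P \<bullet> (idn [Up] \<star> ?X)"
    using crs_triangle[of d] by (simp add: P_def)
  \<comment> \<open>The relation \<open>XP\<close> is conjugated by the inverse \<open>Q\<close> of
    \<open>P\<close>.\<close>
  have "(idn [Up] \<star> ?X) \<bullet> Q = (Q \<bullet> P) \<bullet> (idn [Up] \<star> ?X) \<bullet> Q"
    by (simp add: QP idn_cmp del: cmp_assoc)
  also have "\<dots> = Q \<bullet> (P \<bullet> (idn [Up] \<star> ?X)) \<bullet> Q" by simp
  also have "\<dots> = (Q \<bullet> (?X \<star> idn [Up])) \<bullet> P \<bullet> Q" by (simp add: XP[symmetric])
  also have "\<dots> = Q \<bullet> (?X \<star> idn [Up])" by (simp add: PQ cmp_idn del: cmp_assoc)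
  finally have XQ: "(idn [Up] \<star> ?X) \<bullet> Q = Q \<bullet> (?X \<star> idn [Up])" .
  let ?e = "crs Slash Down Up"
  have swing: "(idn [Up] \<star> cap Down) \<bullet> (?e \<star> idn [Up]) = (cap Down \<star> idn [Up]) \<bullet> (idn [Down] \<star> ?c')"
    using swing_crs_cap[of Down Up Backslash] by simp
  \<comment> \<open>The two crossings of \<open>E\<close> swing along the cap one after the other;
    together they become \<open>Q\<close>.\<close>
  have "(idn [Up, Up] \<star> cap Down) \<bullet> (E \<star> idn [Up])
    = (idn [Up] \<star> ((idn [Up] \<star> cap Down) \<bullet> (?e \<star> idn [Up]))) \<bullet> (?e \<star> idn [Up, Up])"
    by (simp add: E_def idn_collect cmp_idn idn_cmp whisker_left whisker_right)
  also have "\<dots> = (idn [Up] \<star> cap Down \<star> idn [Up]) \<bullet> ((idn [Up, Down] \<star> ?c') \<bullet> (?e \<star> idn [Up, Up]))"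
    by (simp add: swing whisker_left idn_collect)
  also have "(idn [Up, Down] \<star> ?c') \<bullet> (?e \<star> idn [Up, Up]) = (?e \<star> idn [Up, Up]) \<bullet> (idn [Down, Up] \<star> ?c')"
    by (intro slide[symmetric]) simp_all
  also have "(idn [Up] \<star> cap Down \<star> idn [Up]) \<bullet> (?e \<star> idn [Up, Up]) \<bullet> (idn [Down, Up] \<star> ?c')
    = (((idn [Up] \<star> cap Down) \<bullet> (?e \<star> idn [Up])) \<star> idn [Up]) \<bullet> (idn [Down, Up] \<star> ?c')"
    by (simp add: whisker_right idn_collect)
  also have "\<dots> = (cap Down \<star> idn [Up, Up]) \<bullet> (idn [Down] \<star> Q)"
    by (simp add: swing Q_def whisker_left whisker_right idn_collect)
  finally have mate: "(idn [Up, Up] \<star> cap Down) \<bullet> (E \<star> idn [Up]) = (cap Down \<star> idn [Up, Up]) \<bullet> (idn [Down] \<star> Q)" .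
  have "(?X \<star> idn [Down]) \<bullet> E = E \<bullet> (idn [Down] \<star> ?X)"
  proof (rule bend_right_inject[of _ _ "[Up, Up]" Down])
    have "(idn [Up, Up] \<star> cap Down) \<bullet> (((?X \<star> idn [Down]) \<bullet> E) \<star> idn [Up])
      = ((idn [Up, Up] \<star> cap Down) \<bullet> (?X \<star> idn [Down, Up])) \<bullet> (E \<star> idn [Up])"
      by (simp add: whisker_right idn_collect)
    also have "(idn [Up, Up] \<star> cap Down) \<bullet> (?X \<star> idn [Down, Up]) = ?X \<bullet> (idn [Up, Up] \<star> cap Down)"
      by (intro slide_cap) simp_all
    also have "(?X \<bullet> (idn [Up, Up] \<star> cap Down)) \<bullet> (E \<star> idn [Up])
      = (?X \<bullet> (cap Down \<star> idn [Up, Up])) \<bullet> (idn [Down] \<star> Q)"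
      by (simp add: mate)
    also have "?X \<bullet> (cap Down \<star> idn [Up, Up]) = (cap Down \<star> idn [Up, Up]) \<bullet> (idn [Down, Up] \<star> ?X)"
      by (intro slide_cap(1)[symmetric]) simp_all
    also have "((cap Down \<star> idn [Up, Up]) \<bullet> (idn [Down, Up] \<star> ?X)) \<bullet> (idn [Down] \<star> Q)
      = (cap Down \<star> idn [Up, Up]) \<bullet> (idn [Down] \<star> ((idn [Up] \<star> ?X) \<bullet> Q))"
      by (simp add: whisker_left idn_collect)
    also have "\<dots> = ((cap Down \<star> idn [Up, Up]) \<bullet> (idn [Down] \<star> Q)) \<bullet> (idn [Down] \<star> ?X \<star> idn [Up])"
      by (simp add: XQ whisker_left)
    also have "\<dots> = (idn [Up, Up] \<star> cap Down) \<bullet> ((E \<bullet> (idn [Down] \<star> ?X)) \<star> idn [Up])"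
      by (simp add: mate[symmetric] whisker_right)
    finally show "(idn [Up, Up] \<star> cap Down) \<bullet> (((?X \<star> idn [Down]) \<bullet> E) \<star> idn [opp Down])
      = (idn [Up, Up] \<star> cap Down) \<bullet> ((E \<bullet> (idn [Down] \<star> ?X)) \<star> idn [opp Down])"
      by simp
  qed simp_all
  then show ?thesis by (simp add: natural_def Down E_def)
qed

lemma dgm_cases:
  obtains D where "x = abs_dgm D"
  by (metis Quotient_abs_rep Quotient_dgm)

lemma ok_dgm_induct [consumes 1, case_names idn cap cup vert cmp tns]:
  assumes "ok x"
    and "\<And>a. P (idn a)" "\<And>s. P (cap s)" "\<And>s. P (cup s)" "\<And>v. P (vert v)"
    and "\<And>x y. ok x \<Longrightarrow> ok y \<Longrightarrow> dom x = cod y \<Longrightarrow> P x \<Longrightarrow> P y \<Longrightarrow> P (x \<bullet> y)"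
    and "\<And>x y. ok x \<Longrightarrow> ok y \<Longrightarrow> P x \<Longrightarrow> P y \<Longrightarrow> P (x \<star> y)"
  shows "P x"
proof -
  obtain D where x: "x = abs_dgm D" by (rule dgm_cases)
  with assms(1) have "wf_diagram D" by (simp add: ok.abs_eq)
  then have "P (abs_dgm D)"
  proof (induction D)
    case (Comp D E)
    then show ?case
      by (auto simp: ok.abs_eq dom.abs_eq cod.abs_eq cmp.abs_eq[symmetric] intro!: assms(6))
  next
    case (Tens D E)
    then show ?case
      by (auto simp: ok.abs_eq tns.abs_eq[symmetric] intro!: assms(7))
  qed (use assms(2-5) in \<open>simp_all add: idn_def cap_def cup_def vert_def\<close>)
  with x show ?thesis by simp
qed

lemma vert_crs:
  obtains d where "vert X = crs d Up Up"
proof (cases X)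
  case XPos
  then show ?thesis by (intro that[of Slash]) (simp add: crs_def vert.abs_eq)
next
  case XNeg
  then show ?thesis by (intro that[of Backslash]) (simp add: crs_def vert.abs_eq)
qed

text \<open>Pulling a strand over an arbitrary tangle, for all orientations at once. The layering
  argument uses the third Reidemeister move in this form only.\<close>

lemma natural: "ok f \<Longrightarrow> natural r f"
proof (induction f rule: ok_dgm_induct)
  case (vert X)
  obtain d where "vert X = crs d Up Up" by (rule vert_crs)
  then show ?case by (simp add: natural_crs)
qed (auto intro: natural_idn natural_cap natural_cup natural_cmp natural_tns)

text \<open>An arc born to the left of the strands \<open>b\<close>, whose right leg then crosses
  above all of them.\<close>

definition arch :: "orient \<Rightarrow> orient list \<Rightarrow> crossing dgm"
  where "arch s b = (idn [s] \<star> over_pass (opp s) b) \<bullet> (cup s \<star> idn b)"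

lemma arch_simps [simp]:
  "ok (arch s b)" "dom (arch s b) = b" "cod (arch s b) = s # b @ [opp s]"
  by (simp_all add: arch_def)

lemma arch_Nil: "arch s [] = cup s"
  by (simp add: arch_def idn_collect idn_cmp)

lemma natural_arch:
  assumes "ok f"
  shows "(idn [s] \<star> f \<star> idn [opp s]) \<bullet> arch s (dom f) = arch s (cod f) \<bullet> f"
proof -
  have "arch s (cod f) \<bullet> f = (idn [s] \<star> over_pass (opp s) (cod f)) \<bullet> ((cup s \<star> idn (cod f)) \<bullet> f)"
    using assms by (simp add: arch_def)
  also have "(cup s \<star> idn (cod f)) \<bullet> f = (idn [s, opp s] \<star> f) \<bullet> (cup s \<star> idn (dom f))"
    using assms by (intro slide_cup(1)[symmetric]) simp_all
  also have "(idn [s] \<star> over_pass (opp s) (cod f)) \<bullet> (idn [s, opp s] \<star> f) \<bullet> (cup s \<star> idn (dom f))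
    = (idn [s] \<star> (over_pass (opp s) (cod f) \<bullet> (idn [opp s] \<star> f))) \<bullet> (cup s \<star> idn (dom f))"
    using assms by (simp add: whisker_left idn_collect)
  also have "over_pass (opp s) (cod f) \<bullet> (idn [opp s] \<star> f) = (f \<star> idn [opp s]) \<bullet> over_pass (opp s) (dom f)"
    using natural[OF assms] by (simp add: natural_def)
  finally show ?thesis using assms by (simp add: arch_def whisker_left)
qed

text \<open>Swinging along the cup moves the crossing with \<open>t\<close> from the right leg to
  the left leg. Together with \<open>arch_snoc\<close> this allows an arc to be lengthened or
  shortened at either end.\<close>

lemma arch_Cons: "arch s (t # b) = (crs Backslash t s \<star> idn (b @ [opp s])) \<bullet> (idn [t] \<star> arch s b)"
proof -
  have "arch s (t # b) = (idn [s, t] \<star> over_pass (opp s) b)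
      \<bullet> (((idn [s] \<star> crs Slash (opp s) t) \<bullet> (cup s \<star> idn [t])) \<star> idn b)"
    by (simp add: arch_def whisker_left whisker_right idn_collect)
  also have "(idn [s] \<star> crs Slash (opp s) t) \<bullet> (cup s \<star> idn [t])
    = (crs Backslash t s \<star> idn [opp s]) \<bullet> (idn [t] \<star> cup s)"
    by (simp add: swing_crs_cup)
  also have "(idn [s, t] \<star> over_pass (opp s) b) \<bullet> (((crs Backslash t s \<star> idn [opp s]) \<bullet> (idn [t] \<star> cup s)) \<star> idn b)
    = ((idn [s, t] \<star> over_pass (opp s) b) \<bullet> (crs Backslash t s \<star> idn (opp s # b))) \<bullet> (idn [t] \<star> cup s \<star> idn b)"
    by (simp add: whisker_right idn_collect)
  also have "(idn [s, t] \<star> over_pass (opp s) b) \<bullet> (crs Backslash t s \<star> idn (opp s # b))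
    = (crs Backslash t s \<star> idn (b @ [opp s])) \<bullet> (idn [t, s] \<star> over_pass (opp s) b)"
    by (intro slide[symmetric]) simp_all
  finally show ?thesis by (simp add: arch_def whisker_left idn_collect)
qed

lemma arch_snoc: "arch s (b @ [t]) = (idn (s # b) \<star> crs Slash (opp s) t) \<bullet> (arch s b \<star> idn [t])"
  by (simp add: arch_def over_pass_append whisker_left whisker_right idn_collect idn_cmp cmp_idn)

lemma crs_arch_Cons:
  "(crs Slash s t \<star> idn (b @ [opp s])) \<bullet> arch s (t # b) = idn [t] \<star> arch s b"
proof -
  have "(crs Slash s t \<star> idn (b @ [opp s])) \<bullet> arch s (t # b)
    = ((crs Slash s t \<bullet> crs Backslash t s) \<star> idn (b @ [opp s])) \<bullet> (idn [t] \<star> arch s b)"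
    by (simp add: arch_Cons whisker_right)
  then show ?thesis using crs_cancel[of Backslash s t] by (simp add: idn_collect idn_cmp)
qed

lemma crs_arch_snoc:
  "(idn (s # b) \<star> crs Backslash t (opp s)) \<bullet> arch s (b @ [t]) = arch s b \<star> idn [t]"
proof -
  have "(idn (s # b) \<star> crs Backslash t (opp s)) \<bullet> arch s (b @ [t])
    = (idn (s # b) \<star> (crs Backslash t (opp s) \<bullet> crs Slash (opp s) t)) \<bullet> (arch s b \<star> idn [t])"
    by (simp add: arch_snoc whisker_left)
  then show ?thesis using crs_cancel[of Slash t "opp s"] by (simp add: idn_collect idn_cmp)
qed

text \<open>The mirror image of \<open>over_pass\<close>: in \<open>crs Backslash s r\<close> the
  over-strand starts at the bottom right, where \<open>r\<close> is.\<close>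

primrec over_pass_left :: "orient \<Rightarrow> orient list \<Rightarrow> crossing dgm" where
  "over_pass_left r [] = idn [r]"
| "over_pass_left r (s # a) = (crs Backslash s r \<star> idn a) \<bullet> (idn [s] \<star> over_pass_left r a)"

lemma over_pass_left_simps [simp]:
  "ok (over_pass_left r a) \<and> dom (over_pass_left r a) = a @ [r] \<and> cod (over_pass_left r a) = r # a"
  by (induction a) simp_all

text \<open>The cap joins an outer strand to the left leg of the arc. Pulling this zigzag straight
  leaves the right leg, which passes above \<open>b\<close>.\<close>

lemma cap_arch_left:
  "(cap s \<star> idn (b @ [s])) \<bullet> (idn [s] \<star> arch (opp s) b) = over_pass s b"
  using bend_left_unbend[of "over_pass s b" s b "b @ [s]"] by (simp add: arch_def)

text \<open>The mirror image of \<open>cap_arch_left\<close>. As \<open>arch\<close> has its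
  crossings on the right leg, an induction with \<open>arch_Cons\<close> moves them to the left leg,
  which is the one that survives here.\<close>

lemma cap_arch_right:
  "(idn (s # b) \<star> cap (opp s)) \<bullet> (arch s b \<star> idn [s]) = over_pass_left s b"
proof (induction b)
  case Nil
  then show ?case by (simp add: arch_Nil zigzags)
next
  case (Cons t b)
  have "(idn (s # t # b) \<star> cap (opp s)) \<bullet> (arch s (t # b) \<star> idn [s])
    = ((idn (s # t # b) \<star> cap (opp s)) \<bullet> (crs Backslash t s \<star> idn (b @ [opp s, s])))
      \<bullet> (idn [t] \<star> arch s b \<star> idn [s])"
    by (simp add: arch_Cons whisker_right idn_collect)
  also have "(idn (s # t # b) \<star> cap (opp s)) \<bullet> (crs Backslash t s \<star> idn (b @ [opp s, s]))
    = (crs Backslash t s \<star> idn b) \<bullet> (idn (t # s # b) \<star> cap (opp s))"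
    using slide[of "crs Backslash t s" "idn b \<star> cap (opp s)" "[t, s]" "[s, t]" "b @ [opp s, s]" b]
    by (simp add: idn_collect)
  also have "((crs Backslash t s \<star> idn b) \<bullet> (idn (t # s # b) \<star> cap (opp s))) \<bullet> (idn [t] \<star> arch s b \<star> idn [s])
    = (crs Backslash t s \<star> idn b) \<bullet> (idn [t] \<star> ((idn (s # b) \<star> cap (opp s)) \<bullet> (arch s b \<star> idn [s])))"
    by (simp add: whisker_left idn_collect)
  finally show ?case by (simp add: Cons.IH)
qed

text \<open>The cap joins the left leg to the first enclosed strand. With the crossing of these two
  moved to the left leg, cap and crossing form a kink; without it the situation is that of
  \<open>cap_arch_left\<close>.\<close>

lemma cap_arch_Cons: "(cap s \<star> idn (b @ [opp s])) \<bullet> arch s (opp s # b) = over_pass (opp s) b"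
proof -
  have "(cap s \<star> idn (b @ [opp s])) \<bullet> arch s (opp s # b)
    = ((cap s \<bullet> crs Backslash (opp s) s) \<star> idn (b @ [opp s])) \<bullet> (idn [opp s] \<star> arch s b)"
    by (simp add: arch_Cons whisker_right)
  then show ?thesis using cap_arch_left[of "opp s" b] by (simp add: cap_crs)
qed

lemma cap_arch_snoc: "(idn (s # b) \<star> cap s) \<bullet> arch s (b @ [s]) = over_pass_left s b"
proof -
  have "(idn (s # b) \<star> cap s) \<bullet> arch s (b @ [s])
    = (idn (s # b) \<star> (cap s \<bullet> crs Slash (opp s) s)) \<bullet> (arch s b \<star> idn [s])"
    by (simp add: arch_snoc whisker_left)
  then show ?thesis using cap_arch_right[of s b] by (simp add: cap_crs)
qed

section \<open>Layered systems of arcs\<close>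

text \<open>Each arc runs above all arcs drawn before it; a later arc need not be nested or to the left.\<close>

inductive arcs :: "orient list \<Rightarrow> crossing dgm \<Rightarrow> bool" where
  nil: "arcs [] (idn [])"
| arch: "arcs (a @ b @ c) x \<Longrightarrow> arcs (a @ s # b @ opp s # c) ((idn a \<star> arch s b \<star> idn c) \<bullet> x)"

lemma arcs_hom: "arcs b x \<Longrightarrow> ok x \<and> dom x = [] \<and> cod x = b"
  by (induction rule: arcs.induct) auto

lemma arcs_cup: "arcs (u @ v) x \<Longrightarrow> arcs (u @ s # opp s # v) ((idn u \<star> cup s \<star> idn v) \<bullet> x)"
  using arcs.arch[of u "[]" v x s] by (simp add: arch_Nil)

section \<open>Smoothings, and classes of links closed under the skein relation\<close>

definition smoothing :: "orient \<Rightarrow> orient \<Rightarrow> crossing dgm"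
  where "smoothing s t = (if s = t then idn [s, s] else cup t \<bullet> cap s)"

lemma neq_opp_iff: "s \<noteq> t \<longleftrightarrow> t = opp s"
  by (cases s; cases t) auto

lemma smoothing_simps [simp]:
  "ok (smoothing s t)" "dom (smoothing s t) = [s, t]" "cod (smoothing s t) = [t, s]"
  by (auto simp: smoothing_def neq_opp_iff)

text \<open>A crossing with arbitrary orientations is an upward crossing \<open>e\<close> with bends
  \<open>P\<close> and \<open>Q\<close> around it; the same bends turn the changed crossing and the
  identity into the crossing with the other over-strand and the oriented smoothing. The sign
  \<open>e\<close> differs from \<open>d\<close> after a quarter turn.\<close>

lemma crs_smoothing_context:
  obtains P Q w w' e where "ok P" "ok Q" "cod Q = w @ [Up, Up] @ w'" "dom P = w @ [Up, Up] @ w'"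
    "cod P = [t, s]" "dom Q = [s, t]"
    "crs d s t = P \<bullet> (idn w \<star> crs e Up Up \<star> idn w') \<bullet> Q"
    "crs (other d) s t = P \<bullet> (idn w \<star> crs (other e) Up Up \<star> idn w') \<bullet> Q"
    "smoothing s t = P \<bullet> Q"
proof (cases s; cases t)
  assume "s = Up" "t = Up"
  then show thesis
    by (intro that[of "idn [Up, Up]" "idn [Up, Up]" "[]" "[]" d])
      (simp_all add: smoothing_def idn_cmp cmp_idn)
next
  assume "s = Up" "t = Down"
  then show thesis using turn_cw_idn[of Up, where 'v = crossing]
    by (intro that[of "idn [Down, Up] \<star> cap Up" "cup Down \<star> idn [Up, Down]" "[Down]" "[Down]" "other d"])
      (simp_all add: smoothing_def crs_Up_Down turn_cw_def idn_collect idn_cmp)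
next
  assume "s = Down" "t = Up"
  then show thesis using turn_ccw_idn[of Up, where 'v = crossing]
    by (intro that[of "cap Down \<star> idn [Up, Down]" "idn [Down, Up] \<star> cup Up" "[Down]" "[Down]" "other d"])
      (simp_all add: smoothing_def crs_Down_Up turn_ccw_def idn_collect idn_cmp)
next
  assume "s = Down" "t = Down"
  then show thesis using half_ccw_idn[of Up, where 'v = crossing]
    by (intro that[of "(cap Down \<bullet> (idn [Down] \<star> cap Down \<star> idn [Up])) \<star> idn [Down, Down]"
          "idn [Down, Down] \<star> ((idn [Up] \<star> cup Up \<star> idn [Down]) \<bullet> cup Up)"
          "[Down, Down]" "[Down, Down]" d])
      (simp_all add: smoothing_def crs_Down_Down half_ccw_def Let_def idn_collect idn_cmp)
qed

text \<open>\<open>N\<close> abstracts from the agreement of two invariants. The form of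
  \<open>N_skein\<close> reflects that the skein relation can be solved for either crossing, its
  coefficients q^n and q^(-n) being units.\<close>

locale skein_class =
  fixes N :: "crossing dgm \<Rightarrow> bool"
  assumes N_empty: "N (idn [])"
    and N_circle: "\<And>L s. ok L \<Longrightarrow> dom L = [] \<Longrightarrow> cod L = [] \<Longrightarrow> N L \<Longrightarrow> N ((cap s \<bullet> cup s) \<star> L)"
    and N_skein: "\<And>A B u v d. ok A \<Longrightarrow> ok B \<Longrightarrow> dom A = u @ [Up, Up] @ v \<Longrightarrow> cod A = []
      \<Longrightarrow> dom B = [] \<Longrightarrow> cod B = u @ [Up, Up] @ v \<Longrightarrow> N (A \<bullet> B)
      \<Longrightarrow> N (A \<bullet> (idn u \<star> crs (other d) Up Up \<star> idn v) \<bullet> B)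
      \<Longrightarrow> N (A \<bullet> (idn u \<star> crs d Up Up \<star> idn v) \<bullet> B)"
begin

text \<open>As far as \<open>N\<close> can detect, \<open>x\<close> is a combination of layered systems of arcs.\<close>

definition gen :: "orient list \<Rightarrow> crossing dgm \<Rightarrow> bool"
  where "gen b x \<longleftrightarrow> ok x \<and> dom x = [] \<and> cod x = b
    \<and> (\<forall>A. ok A \<and> dom A = b \<and> cod A = [] \<longrightarrow> (\<forall>y. arcs b y \<longrightarrow> N (A \<bullet> y)) \<longrightarrow> N (A \<bullet> x))"

lemma gen_hom: "gen b x \<Longrightarrow> ok x \<and> dom x = [] \<and> cod x = b"
  by (simp add: gen_def)

lemma gen_N:
  "gen b x \<Longrightarrow> ok A \<Longrightarrow> dom A = b \<Longrightarrow> cod A = [] \<Longrightarrow> (\<And>y. arcs b y \<Longrightarrow> N (A \<bullet> y)) \<Longrightarrow> N (A \<bullet> x)"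
  by (simp add: gen_def)

lemma gen_arcs: "arcs b x \<Longrightarrow> gen b x"
  using arcs_hom[of b x] by (auto simp: gen_def)

text \<open>A closure \<open>A\<close> of \<open>L \<bullet> x\<close> is the closure
  \<open>A \<bullet> L\<close> of \<open>x\<close>. Hence an operation \<open>L\<close> on generated
  tangles has to be examined on layered arcs only.\<close>

lemma gen_bind:
  assumes "gen a x" "ok L" "dom L = a" "cod L = b" "\<And>y. arcs a y \<Longrightarrow> gen b (L \<bullet> y)"
  shows "gen b (L \<bullet> x)"
proof -
  have "N (A \<bullet> L \<bullet> x)" if A: "ok A" "dom A = b" "cod A = []" "\<And>y. arcs b y \<Longrightarrow> N (A \<bullet> y)" for A
  proof -
    have "N ((A \<bullet> L) \<bullet> y)" if "arcs a y" for y
      using assms(5)[OF that] A by (simp add: gen_def)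
    moreover have "ok (A \<bullet> L)" "dom (A \<bullet> L) = a" "cod (A \<bullet> L) = []" using assms A by simp_all
    ultimately have "N ((A \<bullet> L) \<bullet> x)" using assms(1) unfolding gen_def by blast
    then show ?thesis by simp
  qed
  then show ?thesis using assms by (auto simp: gen_def)
qed

lemma gen_cup:
  assumes "gen (u @ v) x"
  shows "gen (u @ s # opp s # v) ((idn u \<star> cup s \<star> idn v) \<bullet> x)"
  using assms by (rule gen_bind) (auto intro: gen_arcs arcs_cup)

lemma gen_arch:
  assumes "gen (a @ b @ c) x"
  shows "gen (a @ s # b @ opp s # c) ((idn a \<star> arch s b \<star> idn c) \<bullet> x)"
  using assms by (rule gen_bind) (auto intro: gen_arcs arcs.arch)

text \<open>The bends of \<open>crs_smoothing_context\<close> are absorbed into the closure above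
  and the tangle below, so that \<open>N_skein\<close>, stated for upward crossings, covers all
  orientations.\<close>

lemma gen_skein:
  assumes x: "ok x" "dom x = []" "cod x = u @ s # t # v"
    and other: "gen (u @ t # s # v) ((idn u \<star> crs (other d) s t \<star> idn v) \<bullet> x)"
    and smooth: "gen (u @ t # s # v) ((idn u \<star> smoothing s t \<star> idn v) \<bullet> x)"
  shows "gen (u @ t # s # v) ((idn u \<star> crs d s t \<star> idn v) \<bullet> x)"
proof -
  obtain P Q w w' e where PQ: "ok P" "ok Q" "cod Q = w @ [Up, Up] @ w'" "dom P = w @ [Up, Up] @ w'"
    "cod P = [t, s]" "dom Q = [s, t]"
    and c: "crs d s t = P \<bullet> (idn w \<star> crs e Up Up \<star> idn w') \<bullet> Q"
    "crs (other d) s t = P \<bullet> (idn w \<star> crs (other e) Up Up \<star> idn w') \<bullet> Q"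
    "smoothing s t = P \<bullet> Q"
    by (rule crs_smoothing_context)
  have "N (A \<bullet> (idn u \<star> crs d s t \<star> idn v) \<bullet> x)"
    if A: "ok A" "dom A = u @ t # s # v" "cod A = []"
      and *: "\<And>y. arcs (u @ t # s # v) y \<Longrightarrow> N (A \<bullet> y)" for A
  proof -
    let ?A = "A \<bullet> (idn u \<star> P \<star> idn v)" and ?B = "(idn u \<star> Q \<star> idn v) \<bullet> x"
    have eq: "A \<bullet> (idn u \<star> (P \<bullet> (idn w \<star> crs k Up Up \<star> idn w') \<bullet> Q) \<star> idn v) \<bullet> x
      = ?A \<bullet> (idn (u @ w) \<star> crs k Up Up \<star> idn (w' @ v)) \<bullet> ?B" for k
      using PQ by (simp add: whisker_left whisker_right idn_collect)
    have "N (A \<bullet> (idn u \<star> smoothing s t \<star> idn v) \<bullet> x)"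
      "N (A \<bullet> (idn u \<star> crs (other d) s t \<star> idn v) \<bullet> x)"
      by (rule gen_N[OF smooth A *] gen_N[OF other A *], assumption)+
    then have "N (?A \<bullet> ?B)" "N (?A \<bullet> (idn (u @ w) \<star> crs (other e) Up Up \<star> idn (w' @ v)) \<bullet> ?B)"
      using PQ by (simp_all add: c whisker_left whisker_right idn_collect)
    with A PQ x have "N (?A \<bullet> (idn (u @ w) \<star> crs e Up Up \<star> idn (w' @ v)) \<bullet> ?B)"
      by (elim N_skein[rotated -2]) simp_all
    then show ?thesis by (simp add: c eq)
  qed
  then show ?thesis using x by (auto simp: gen_def)
qed

text \<open>A strand can be pulled over a circle, by \<open>natural\<close>; repeated, this moves
  the circle to the far left.\<close>

lemma circle_commute: "idn a \<star> (cap s \<bullet> cup s) = (cap s \<bullet> cup s) \<star> (idn a :: crossing dgm)"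
proof (induction a)
  case Nil
  then show ?case by simp
next
  case (Cons r a)
  let ?O = "cap s \<bullet> cup s :: crossing dgm"
  have "idn [r] \<star> ?O = ?O \<star> idn [r]"
    using natural[of ?O r] by (simp add: natural_def idn_cmp cmp_idn)
  moreover have "idn (r # a) = (idn [r] \<star> idn a :: crossing dgm)" by (simp add: idn_collect)
  ultimately show ?case using Cons.IH by (metis tns_assoc)
qed

text \<open>On the far left the circle stands beside any closure of \<open>x\<close>, where
  \<open>N_circle\<close> applies.\<close>

lemma gen_circle:
  assumes "gen (a @ c) x"
  shows "gen (a @ c) ((idn a \<star> (cap s \<bullet> cup s) \<star> idn c) \<bullet> x)"
proof -
  let ?O = "cap s \<bullet> cup s :: crossing dgm"
  have x: "ok x" "dom x = []" "cod x = a @ c" using gen_hom[OF assms] by auto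
  have "idn a \<star> ?O \<star> idn c = ?O \<star> idn (a @ c)"
    using circle_commute[of a s] by (metis tns_assoc idn_tns_idn)
  then have eq: "(idn a \<star> ?O \<star> idn c) \<bullet> x = ?O \<star> x"
    using x slide_cup(2)[of x "?O" "a @ c" "[]" "[]"]
      interchange[of ?O "idn (a @ c)" "idn []" x] by (simp add: idn_cmp cmp_idn)
  have "N (A \<bullet> (?O \<star> x))" if A: "ok A" "dom A = a @ c" "cod A = []" "\<And>y. arcs (a @ c) y \<Longrightarrow> N (A \<bullet> y)" for A
  proof -
    have "N (A \<bullet> x)" by (rule gen_N[OF assms A])
    then have "N (?O \<star> (A \<bullet> x))" using A x by (intro N_circle) simp_all
    moreover have "A \<bullet> (?O \<star> x) = ?O \<star> (A \<bullet> x)"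
      using A x interchange[of "idn []" A ?O x] by (simp add: idn_cmp)
    ultimately show ?thesis by simp
  qed
  then show ?thesis using x unfolding eq by (auto simp: gen_def)
qed

end

text \<open>If \<open>F\<close> touches neither end of the last arc, it can be performed before the
  arc is drawn. The arc lies to the right of \<open>F\<close>, then to its left, and finally around
  \<open>F\<close>, where \<open>natural_arch\<close> pulls the arc over \<open>F\<close>.\<close>

lemma slide_arch_right:
  assumes "ok F"
  shows "(idn u \<star> F \<star> idn (w @ p # b @ opp p # c)) \<bullet> (idn (u @ dom F @ w) \<star> arch p b \<star> idn c)
    = (idn (u @ cod F @ w) \<star> arch p b \<star> idn c) \<bullet> (idn u \<star> F \<star> idn (w @ b @ c))"
  using assms slide[of "idn u \<star> F \<star> idn w" "arch p b \<star> idn c" "u @ dom F @ w" "u @ cod F @ w"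
      "b @ c" "p # b @ opp p # c"]
  by (simp add: idn_collect)

lemma slide_arch_left:
  assumes "ok F"
  shows "(idn (a @ p # b @ opp p # w) \<star> F \<star> idn v) \<bullet> (idn a \<star> arch p b \<star> idn (w @ dom F @ v))
    = (idn a \<star> arch p b \<star> idn (w @ cod F @ v)) \<bullet> (idn (a @ b @ w) \<star> F \<star> idn v)"
  using assms slide[of "idn a \<star> arch p b" "idn w \<star> F \<star> idn v" "a @ b" "a @ p # b @ [opp p]"
      "w @ dom F @ v" "w @ cod F @ v"]
  by (simp add: idn_collect)

lemma slide_arch_inside:
  assumes "ok F"
  shows "(idn (a @ p # w) \<star> F \<star> idn (w' @ opp p # c)) \<bullet> (idn a \<star> arch p (w @ dom F @ w') \<star> idn c)
    = (idn a \<star> arch p (w @ cod F @ w') \<star> idn c) \<bullet> (idn (a @ w) \<star> F \<star> idn (w' @ c))"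
proof -
  have "(idn [p] \<star> (idn w \<star> F \<star> idn w') \<star> idn [opp p]) \<bullet> arch p (w @ dom F @ w')
    = arch p (w @ cod F @ w') \<bullet> (idn w \<star> F \<star> idn w')"
    using assms natural_arch[of "idn w \<star> F \<star> idn w'" p] by simp
  then have "idn a \<star> ((idn [p] \<star> (idn w \<star> F \<star> idn w') \<star> idn [opp p]) \<bullet> arch p (w @ dom F @ w')) \<star> idn c
    = idn a \<star> (arch p (w @ cod F @ w') \<bullet> (idn w \<star> F \<star> idn w')) \<star> idn c"
    by simp
  then show ?thesis
    using assms by (simp add: whisker_left whisker_right idn_collect)
qed

text \<open>Here \<open>p\<close> and \<open>r\<close> are the ends of the last arc and
  \<open>s\<close>, \<open>t\<close> the adjacent ends on which a cap or crossing acts. The pair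
  avoids the arc (\<open>left\<close>, \<open>inside\<close>, \<open>right\<close>), consists of its
  two ends (\<open>both\<close>), or contains one of them; in the latter cases the name tells the
  order.\<close>

lemma adjacent_pair_cases:
  assumes "u @ s # t # v = a @ p # b @ r # c"
  obtains (left) w where "a = u @ s # t # w" "v = w @ p # b @ r # c"
  | (meets_first) "a = u @ [s]" "t = p" "v = b @ r # c"
  | (both) "a = u" "s = p" "b = []" "t = r" "v = c"
  | (first_meets) b' where "a = u" "s = p" "b = t # b'" "v = b' @ r # c"
  | (inside) w w' where "u = a @ p # w" "b = w @ s # t # w'" "v = w' @ r # c"
  | (meets_second) w where "u = a @ p # w" "b = w @ [s]" "t = r" "v = c"
  | (second_meets) "u = a @ p # b" "s = r" "c = t # v"
  | (right) w where "u = a @ p # b @ r # w" "c = w @ s # t # v"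
  using assms
  by (auto simp: append_eq_append_conv2 append_eq_Cons_conv Cons_eq_append_conv)

section \<open>Caps and crossings on layered arcs, by induction on the number of ends\<close>

context skein_class
begin

text \<open>The number \<open>k\<close> counts the ends below the crossing, or below the cap in
  \<open>cap_closed\<close>; removing the last arc lowers it by two. Both properties speak of
  \<open>arcs\<close> and extend to \<open>gen\<close> by \<open>gen_bind\<close>.\<close>

definition crs_closed :: "nat \<Rightarrow> bool" where
  "crs_closed k \<longleftrightarrow> (\<forall>u s t v d x. length (u @ v) + 2 = k \<longrightarrow> arcs (u @ s # t # v) x
    \<longrightarrow> gen (u @ t # s # v) ((idn u \<star> crs d s t \<star> idn v) \<bullet> x))"

definition cap_closed :: "nat \<Rightarrow> bool" where
  "cap_closed k \<longleftrightarrow> (\<forall>u s v x. length (u @ v) + 2 = k \<longrightarrow> arcs (u @ s # opp s # v) x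
    \<longrightarrow> gen (u @ v) ((idn u \<star> cap s \<star> idn v) \<bullet> x))"

lemma gen_crs:
  assumes "crs_closed k" "gen (u @ s # t # v) x" "length (u @ v) + 2 = k"
  shows "gen (u @ t # s # v) ((idn u \<star> crs d s t \<star> idn v) \<bullet> x)"
  using assms(2) by (rule gen_bind) (use assms(1,3) in \<open>auto simp: crs_closed_def\<close>)

lemma gen_cap:
  assumes "cap_closed k" "gen (u @ s # opp s # v) x" "length (u @ v) + 2 = k"
  shows "gen (u @ v) ((idn u \<star> cap s \<star> idn v) \<bullet> x)"
  using assms(2) by (rule gen_bind) (use assms(1,3) in \<open>auto simp: cap_closed_def\<close>)

lemma gen_over_pass:
  assumes "crs_closed k" "gen (a @ r # b @ c) x" "length (a @ b @ c) + 1 = k"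
  shows "gen (a @ b @ r # c) ((idn a \<star> over_pass r b \<star> idn c) \<bullet> x)"
  using assms(2,3)
proof (induction b arbitrary: a x)
  case Nil
  then show ?case using gen_hom[OF Nil(1)] by (simp add: idn_collect idn_cmp)
next
  case (Cons t b)
  have "gen (a @ t # r # b @ c) ((idn a \<star> crs Slash r t \<star> idn (b @ c)) \<bullet> x)"
    using gen_crs[OF assms(1), of a r t "b @ c"] Cons.prems by simp
  then show ?case
    using Cons.IH[of "a @ [t]"] Cons.prems
    by (simp add: whisker_left whisker_right idn_collect)
qed

lemma gen_over_pass_left:
  assumes "crs_closed k" "gen (a @ b @ r # c) x" "length (a @ b @ c) + 1 = k"
  shows "gen (a @ r # b @ c) ((idn a \<star> over_pass_left r b \<star> idn c) \<bullet> x)"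
  using assms(2,3)
proof (induction b arbitrary: a x)
  case Nil
  then show ?case using gen_hom[OF Nil(1)] by (simp add: idn_collect idn_cmp)
next
  case (Cons t b)
  have "gen (a @ t # r # b @ c) ((idn (a @ [t]) \<star> over_pass_left r b \<star> idn c) \<bullet> x)"
    using Cons.IH[of "a @ [t]"] Cons.prems by simp
  then show ?case
    using gen_crs[OF assms(1), of a t r "b @ c"] Cons.prems
    by (simp add: whisker_left whisker_right idn_collect)
qed

text \<open>Below its last arc the system has \<open>k\<close> ends. A cap away from the arc slides
  below it; a cap on both ends closes a circle; a cap on one end straightens the arc into a strand
  passing above \<open>b\<close>, which is a product of crossings on \<open>k\<close> ends.\<close>

lemma cap_closed_step:
  assumes crs: "crs_closed k" and cap: "cap_closed k"
  shows "cap_closed (k + 2)"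
  unfolding cap_closed_def
proof (intro allI impI)
  fix u s v X
  assume k: "length (u @ v) + 2 = k + 2" and X: "arcs (u @ s # opp s # v) X"
  from X obtain a b c p x where x: "arcs (a @ b @ c) x"
    and split: "u @ s # opp s # v = a @ p # b @ opp p # c"
    and X_eq: "X = (idn a \<star> arch p b \<star> idn c) \<bullet> x"
    by (cases rule: arcs.cases) auto
  have g: "gen (a @ b @ c) x"
    by (rule gen_arcs[OF x])
  have step: "(idn u \<star> cap s \<star> idn v) \<bullet> X = z \<bullet> x"
    if "(idn u \<star> cap s \<star> idn v) \<bullet> (idn a \<star> arch p b \<star> idn c) = z" for z
    using that by (simp add: X_eq flip: cmp_assoc)
  from split show "gen (u @ v) ((idn u \<star> cap s \<star> idn v) \<bullet> X)"
  proof (cases rule: adjacent_pair_cases)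
    case (left w)
    have eq: "(idn u \<star> cap s \<star> idn v) \<bullet> (idn a \<star> arch p b \<star> idn c)
      = (idn (u @ w) \<star> arch p b \<star> idn c) \<bullet> (idn u \<star> cap s \<star> idn (w @ b @ c))"
      using slide_arch_right[of "cap s" u w p b c] left by simp
    have "gen (u @ w @ b @ c) ((idn u \<star> cap s \<star> idn (w @ b @ c)) \<bullet> x)"
      using gen_cap[OF cap, of u s "w @ b @ c"] g k left by simp
    then show ?thesis
      unfolding step[OF eq] using gen_arch[of "u @ w" b c _ p] left by simp
  next
    case meets_first
    have p: "p = opp s" using meets_first by simp
    have "(idn u \<star> cap s \<star> idn v) \<bullet> (idn a \<star> arch p b \<star> idn c)
      = idn u \<star> ((cap s \<star> idn (b @ [s])) \<bullet> (idn [s] \<star> arch (opp s) b)) \<star> idn c"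
      using meets_first(1,3) by (simp add: p whisker_left whisker_right idn_collect)
    then have eq: "(idn u \<star> cap s \<star> idn v) \<bullet> (idn a \<star> arch p b \<star> idn c) = idn u \<star> over_pass s b \<star> idn c"
      by (simp add: cap_arch_left)
    show ?thesis
      unfolding step[OF eq] using gen_over_pass[OF crs, of u s b c x] g k meets_first(1,3) by (simp add: p)
  next
    case both
    have eq: "(idn u \<star> cap s \<star> idn v) \<bullet> (idn a \<star> arch p b \<star> idn c) = idn a \<star> (cap s \<bullet> cup s) \<star> idn c"
      using both by (simp add: arch_Nil whisker_left whisker_right)
    show ?thesis
      unfolding step[OF eq] using gen_circle[of a c x s] g both by simp
  next
    case (first_meets b')
    have "(idn u \<star> cap s \<star> idn v) \<bullet> (idn a \<star> arch p b \<star> idn c)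
      = idn u \<star> ((cap s \<star> idn (b' @ [opp s])) \<bullet> arch s (opp s # b')) \<star> idn c"
      using first_meets by (simp add: whisker_left whisker_right idn_collect)
    then have eq: "(idn u \<star> cap s \<star> idn v) \<bullet> (idn a \<star> arch p b \<star> idn c)
      = idn u \<star> over_pass (opp s) b' \<star> idn c"
      by (simp add: cap_arch_Cons)
    show ?thesis
      unfolding step[OF eq] using gen_over_pass[OF crs, of u "opp s" b' c x] g k first_meets by simp
  next
    case (inside w w')
    have eq: "(idn u \<star> cap s \<star> idn v) \<bullet> (idn a \<star> arch p b \<star> idn c)
      = (idn a \<star> arch p (w @ w') \<star> idn c) \<bullet> (idn (a @ w) \<star> cap s \<star> idn (w' @ c))"
      using slide_arch_inside[of "cap s" a p w w' c] inside by simp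
    have "gen (a @ (w @ w') @ c) ((idn (a @ w) \<star> cap s \<star> idn (w' @ c)) \<bullet> x)"
      using gen_cap[OF cap, of "a @ w" s "w' @ c"] g k inside by simp
    then show ?thesis
      unfolding step[OF eq] using gen_arch[of a "w @ w'" c _ p] inside by simp
  next
    case (meets_second w)
    have p: "p = s" using meets_second by (cases p; cases s) auto
    have "(idn u \<star> cap s \<star> idn v) \<bullet> (idn a \<star> arch p b \<star> idn c)
      = idn a \<star> ((idn (s # w) \<star> cap s) \<bullet> arch s (w @ [s])) \<star> idn c"
      using meets_second by (simp add: p whisker_left whisker_right idn_collect)
    then have eq: "(idn u \<star> cap s \<star> idn v) \<bullet> (idn a \<star> arch p b \<star> idn c)
      = idn a \<star> over_pass_left s w \<star> idn c"
      by (simp add: cap_arch_snoc)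
    show ?thesis
      unfolding step[OF eq] using gen_over_pass_left[OF crs, of a w s c x] g k meets_second by (simp add: p)
  next
    case second_meets
    have s: "s = opp p" using second_meets by simp
    have "(idn u \<star> cap s \<star> idn v) \<bullet> (idn a \<star> arch p b \<star> idn c)
      = idn a \<star> ((idn (p # b) \<star> cap (opp p)) \<bullet> (arch p b \<star> idn [p])) \<star> idn v"
      using second_meets by (simp add: s whisker_left whisker_right idn_collect)
    then have eq: "(idn u \<star> cap s \<star> idn v) \<bullet> (idn a \<star> arch p b \<star> idn c)
      = idn a \<star> over_pass_left p b \<star> idn v"
      by (simp add: cap_arch_right)
    show ?thesis
      unfolding step[OF eq] using gen_over_pass_left[OF crs, of a b p v x] g k second_meets by (simp add: s)
  next
    case (right w)
    have eq: "(idn u \<star> cap s \<star> idn v) \<bullet> (idn a \<star> arch p b \<star> idn c)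
      = (idn a \<star> arch p b \<star> idn (w @ v)) \<bullet> (idn (a @ b @ w) \<star> cap s \<star> idn v)"
      using slide_arch_left[of "cap s" a p b w v] right by simp
    have "gen (a @ b @ w @ v) ((idn (a @ b @ w) \<star> cap s \<star> idn v) \<bullet> x)"
      using gen_cap[OF cap, of "a @ b @ w" s v] g k right by simp
    then show ?thesis
      unfolding step[OF eq] using gen_arch[of a b "w @ v" _ p] right by simp
  qed
qed

text \<open>The two crossings differ by the smoothing, which is \<open>x\<close> itself for parallel
  strands and a cap followed by a cup for antiparallel ones. Hence one sign of the crossing
  suffices, provided that caps on \<open>k\<close> ends are settled.\<close>

lemma gen_crs_either:
  assumes cap: "cap_closed k" and k: "length (u @ v) + 2 = k" and x: "gen (u @ s # t # v) x"
    and d: "gen (u @ t # s # v) ((idn u \<star> crs d s t \<star> idn v) \<bullet> x)"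
  shows "gen (u @ t # s # v) ((idn u \<star> crs e s t \<star> idn v) \<bullet> x)"
proof (cases "e = d")
  case True
  with d show ?thesis by simp
next
  case False
  then have e: "d = other e" by (cases d; cases e) auto
  have hom: "ok x" "dom x = []" "cod x = u @ s # t # v" using gen_hom[OF x] by auto
  have "gen (u @ t # s # v) ((idn u \<star> smoothing s t \<star> idn v) \<bullet> x)"
  proof (cases "s = t")
    case True
    then show ?thesis using x hom by (simp add: smoothing_def idn_collect idn_cmp)
  next
    case False
    then have t: "t = opp s" by (simp add: neq_opp_iff)
    have "gen (u @ t # opp t # v) ((idn u \<star> cup t \<star> idn v) \<bullet> (idn u \<star> cap s \<star> idn v) \<bullet> x)"
      using gen_cup[OF gen_cap[OF cap _ k], of s x "opp s"] x t by simp
    then show ?thesis using False t by (simp add: smoothing_def whisker_left whisker_right)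
  qed
  then show ?thesis by (rule gen_skein[OF hom d[unfolded e]])
qed

text \<open>When the crossing involves one end of the last arc, the sign treated first is the one
  for which the arc runs on top. Crossing an outside strand then lengthens the arc
  (\<open>meets_first\<close>, \<open>second_meets\<close>), and crossing an enclosed strand cancels
  a crossing and shortens it (\<open>first_meets\<close>, \<open>meets_second\<close>). For the
  opposite sign \<open>gen_crs_either\<close> needs caps at the same number \<open>k + 2\<close> of
  ends.\<close>

lemma crs_closed_step:
  assumes crs: "crs_closed k" and cap: "cap_closed (k + 2)"
  shows "crs_closed (k + 2)"
  unfolding crs_closed_def
proof (intro allI impI)
  fix u s t v d X
  assume k: "length (u @ v) + 2 = k + 2" and X: "arcs (u @ s # t # v) X"
  from X obtain a b c p x where x: "arcs (a @ b @ c) x"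
    and split: "u @ s # t # v = a @ p # b @ opp p # c"
    and X_eq: "X = (idn a \<star> arch p b \<star> idn c) \<bullet> x"
    by (cases rule: arcs.cases) auto
  have g: "gen (a @ b @ c) x"
    by (rule gen_arcs[OF x])
  note either = gen_crs_either[OF cap k gen_arcs[OF X]]
  have step: "(idn u \<star> crs e s t \<star> idn v) \<bullet> X = z \<bullet> x"
    if "(idn u \<star> crs e s t \<star> idn v) \<bullet> (idn a \<star> arch p b \<star> idn c) = z" for z e
    using that by (simp add: X_eq flip: cmp_assoc)
  from split show "gen (u @ t # s # v) ((idn u \<star> crs d s t \<star> idn v) \<bullet> X)"
  proof (cases rule: adjacent_pair_cases)
    case (left w)
    have eq: "(idn u \<star> crs d s t \<star> idn v) \<bullet> (idn a \<star> arch p b \<star> idn c)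
      = (idn (u @ t # s # w) \<star> arch p b \<star> idn c) \<bullet> (idn u \<star> crs d s t \<star> idn (w @ b @ c))"
      using slide_arch_right[of "crs d s t" u w p b c] left by simp
    have "gen (u @ t # s # w @ b @ c) ((idn u \<star> crs d s t \<star> idn (w @ b @ c)) \<bullet> x)"
      using gen_crs[OF crs, of u s t "w @ b @ c"] g k left by simp
    then show ?thesis
      unfolding step[OF eq] using gen_arch[of "u @ t # s # w" b c _ p] left by simp
  next
    case meets_first
    have eq: "(idn u \<star> crs Backslash s t \<star> idn v) \<bullet> (idn a \<star> arch p b \<star> idn c)
      = idn u \<star> arch p (s # b) \<star> idn c"
      using meets_first by (simp add: arch_Cons whisker_left whisker_right idn_collect)
    show ?thesis
      by (rule either[of Backslash], unfold step[OF eq])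
        (use gen_arch[of u "s # b" c x p] g meets_first in simp)
  next
    case both
    have eq: "(idn u \<star> crs d s t \<star> idn v) \<bullet> (idn a \<star> arch p b \<star> idn c)
      = idn u \<star> (crs d s (opp s) \<bullet> cup s) \<star> idn v"
      using both by (simp add: arch_Nil whisker_left whisker_right)
    show ?thesis
      unfolding step[OF eq] using gen_cup[of u v x "opp s"] g both by (simp add: crs_cup)
  next
    case (first_meets b')
    have "(idn u \<star> crs Slash s t \<star> idn v) \<bullet> (idn a \<star> arch p b \<star> idn c)
      = idn u \<star> ((crs Slash p t \<star> idn (b' @ [opp p])) \<bullet> arch p (t # b')) \<star> idn c"
      using first_meets by (simp add: whisker_left whisker_right idn_collect)
    then have eq: "(idn u \<star> crs Slash s t \<star> idn v) \<bullet> (idn a \<star> arch p b \<star> idn c)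
      = idn (u @ [t]) \<star> arch p b' \<star> idn c"
      by (simp add: crs_arch_Cons idn_collect)
    show ?thesis
      by (rule either[of Slash], unfold step[OF eq])
        (use gen_arch[of "u @ [t]" b' c x p] g first_meets in simp)
  next
    case (inside w w')
    have eq: "(idn u \<star> crs d s t \<star> idn v) \<bullet> (idn a \<star> arch p b \<star> idn c)
      = (idn a \<star> arch p (w @ t # s # w') \<star> idn c) \<bullet> (idn (a @ w) \<star> crs d s t \<star> idn (w' @ c))"
      using slide_arch_inside[of "crs d s t" a p w w' c] inside by simp
    have "gen (a @ (w @ t # s # w') @ c) ((idn (a @ w) \<star> crs d s t \<star> idn (w' @ c)) \<bullet> x)"
      using gen_crs[OF crs, of "a @ w" s t "w' @ c"] g k inside by simp
    then show ?thesis
      unfolding step[OF eq] using gen_arch[of a "w @ t # s # w'" c _ p] inside by simp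
  next
    case (meets_second w)
    have "(idn u \<star> crs Backslash s t \<star> idn v) \<bullet> (idn a \<star> arch p b \<star> idn c)
      = idn a \<star> ((idn (p # w) \<star> crs Backslash s (opp p)) \<bullet> arch p (w @ [s])) \<star> idn c"
      using meets_second by (simp add: whisker_left whisker_right idn_collect)
    then have eq: "(idn u \<star> crs Backslash s t \<star> idn v) \<bullet> (idn a \<star> arch p b \<star> idn c)
      = idn a \<star> arch p w \<star> idn (s # c)"
      by (simp add: crs_arch_snoc idn_collect)
    show ?thesis
      by (rule either[of Backslash], unfold step[OF eq])
        (use gen_arch[of a w "s # c" x p] g meets_second in simp)
  next
    case second_meets
    have eq: "(idn u \<star> crs Slash s t \<star> idn v) \<bullet> (idn a \<star> arch p b \<star> idn c)
      = idn a \<star> arch p (b @ [t]) \<star> idn v"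
      using second_meets by (simp add: arch_snoc whisker_left whisker_right idn_collect)
    show ?thesis
      by (rule either[of Slash], unfold step[OF eq])
        (use gen_arch[of a "b @ [t]" v x p] g second_meets in simp)
  next
    case (right w)
    have eq: "(idn u \<star> crs d s t \<star> idn v) \<bullet> (idn a \<star> arch p b \<star> idn c)
      = (idn a \<star> arch p b \<star> idn (w @ t # s # v)) \<bullet> (idn (a @ b @ w) \<star> crs d s t \<star> idn v)"
      using slide_arch_left[of "crs d s t" a p b w v] right by simp
    have "gen (a @ b @ w @ t # s # v) ((idn (a @ b @ w) \<star> crs d s t \<star> idn v) \<bullet> x)"
      using gen_crs[OF crs, of "a @ b @ w" s t v] g k right by simp
    then show ?thesis
      unfolding step[OF eq] using gen_arch[of a b "w @ t # s # v" _ p] right by simp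
  qed
qed

lemma closed: "crs_closed k \<and> cap_closed k"
proof (induction k rule: less_induct)
  case (less k)
  show ?case
  proof (cases "k < 2")
    case True
    \<comment> \<open>A cap or crossing needs two ends, so both statements are vacuous here.\<close>
    then show ?thesis by (auto simp: crs_closed_def cap_closed_def)
  next
    case False
    then obtain m where m: "k = m + 2" by (metis add.commute le_Suc_ex not_less)
    with less.IH[of m] have "crs_closed m" "cap_closed m" by auto
    \<comment> \<open>Caps come first, because the step for crossings uses them at
      \<open>m + 2\<close>.\<close>
    then show ?thesis unfolding m using cap_closed_step crs_closed_step by blast
  qed
qed

text \<open>The spectators \<open>u\<close> and \<open>v\<close> let the induction pass through
  tensor products, where each factor acts beside the strands of the other.\<close>

lemma gen_diagram:
  assumes "ok f"
  shows "gen (u @ dom f @ v) x \<Longrightarrow> gen (u @ cod f @ v) ((idn u \<star> f \<star> idn v) \<bullet> x)"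
  using assms
proof (induction f arbitrary: u v x rule: ok_dgm_induct)
  case (idn a)
  then show ?case using gen_hom[OF idn] by (simp add: idn_collect idn_cmp)
next
  case (cap s)
  then show ?case using gen_cap[OF conjunct2[OF closed] _ HOL.refl, of u s v x] by simp
next
  case (cup s)
  then show ?case using gen_cup[of u v x s] by simp
next
  case (vert X)
  obtain d where "vert X = crs d Up Up" by (rule vert_crs)
  with vert show ?case using gen_crs[OF conjunct1[OF closed] _ HOL.refl, of u Up Up v x d] by (simp add: ends_crossing_def)
next
  case (cmp f g)
  then show ?case
    using cmp.IH(1)[of u v "(idn u \<star> g \<star> idn v) \<bullet> x"] cmp.IH(2)[of u v x]
    by (simp add: whisker_left whisker_right)
next
  case (tns f g)
  have eq: "idn u \<star> (f \<star> g) \<star> idn v = (idn u \<star> f \<star> idn (cod g @ v)) \<bullet> (idn (u @ dom f) \<star> g \<star> idn v)"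
  proof -
    have "f \<star> g = (f \<star> idn (cod g)) \<bullet> (idn (dom f) \<star> g)"
      using tns.hyps by (simp add: interchange idn_cmp cmp_idn)
    then show ?thesis
      using tns.hyps by (simp add: whisker_left whisker_right idn_collect)
  qed
  have "gen (u @ cod f @ cod g @ v)
    ((idn u \<star> f \<star> idn (cod g @ v)) \<bullet> ((idn (u @ dom f) \<star> g \<star> idn v) \<bullet> x))"
    using tns.IH(1)[of u "cod g @ v"] tns.IH(2)[of "u @ dom f" v x] tns.prems tns.hyps by simp
  then show ?case using tns.hyps unfolding eq by simp
qed

text \<open>Every arc contributes two ends, so the only layered system without ends is the empty
  diagram, which is in the class.\<close>

lemma N_link:
  assumes "ok L" "dom L = []" "cod L = []"
  shows "N L"
proof -
  have g: "gen [] L"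
    using gen_diagram[of L "[]" "[]" "idn []"] gen_arcs[OF arcs.nil] assms
    by (simp add: cmp_idn)
  have "N (idn [] \<bullet> y)" if "arcs [] y" for y
    using that N_empty by (cases rule: arcs.cases) (simp_all add: idn_cmp)
  then have "N (idn [] \<bullet> L)" by (intro gen_N[OF g, of "idn []"]) simp_all
  with assms show ?thesis by (simp add: idn_cmp)
qed

end

section \<open>Linear combinations of graphs\<close>

lemma lookup_scale [simp]: "Poly_Mapping.lookup (c *\<^sub>l f) D = c * Poly_Mapping.lookup f D"
  by (simp add: scale_def Poly_Mapping.map.rep_eq when_def)

lemma scale_simps [simp]:
  "c *\<^sub>l (f + g) = c *\<^sub>l f + c *\<^sub>l g" "c *\<^sub>l (f - g) = c *\<^sub>l f - c *\<^sub>l g"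
  "c *\<^sub>l (- f) = - (c *\<^sub>l f)" "c *\<^sub>l d *\<^sub>l f = (c * d) *\<^sub>l f" "1 *\<^sub>l f = f" "0 *\<^sub>l f = 0" "c *\<^sub>l 0 = 0"
  by (rule poly_mapping_eqI; simp add: lookup_add lookup_minus algebra_simps)+

lemma scale_left:
  "(c + d) *\<^sub>l f = c *\<^sub>l f + d *\<^sub>l f" "(c - d) *\<^sub>l f = c *\<^sub>l f - d *\<^sub>l f" "(- c) *\<^sub>l f = - (c *\<^sub>l f)"
  by (rule poly_mapping_eqI; simp add: lookup_add lookup_minus algebra_simps)+

text \<open>The common shape of \<open>lin_comp\<close> and \<open>lin_tens\<close>, so that their
  algebra is developed once.\<close>

definition bilinear :: "(graph \<Rightarrow> graph \<Rightarrow> graph) \<Rightarrow> lin \<Rightarrow> lin \<Rightarrow> lin" where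
  "bilinear h f g = (\<Sum>D\<in>Poly_Mapping.keys f. \<Sum>E\<in>Poly_Mapping.keys g.
     (Poly_Mapping.lookup f D * Poly_Mapping.lookup g E) *\<^sub>l gr (h D E))"

lemma lin_comp_bilinear: "lin_comp = bilinear Comp"
  by (intro ext) (simp add: lin_comp_def bilinear_def)

lemma lin_tens_bilinear: "lin_tens = bilinear Tens"
  by (intro ext) (simp add: lin_tens_def bilinear_def)

text \<open>The supports change under addition and scaling. Summing over a common larger set, where
  the extra terms vanish, makes the sums comparable.\<close>

lemma bilinear_superset:
  assumes "finite A" "Poly_Mapping.keys f \<subseteq> A" "finite B" "Poly_Mapping.keys g \<subseteq> B"
  shows "bilinear h f g = (\<Sum>D\<in>A. \<Sum>E\<in>B.
     (Poly_Mapping.lookup f D * Poly_Mapping.lookup g E) *\<^sub>l gr (h D E))"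
  unfolding bilinear_def using assms
  by (intro sum.mono_neutral_cong_left sum.mono_neutral_left ballI sum.neutral)
    (auto simp: in_keys_iff intro!: sum.neutral)

lemma bilinear_add_left: "bilinear h (f + f') g = bilinear h f g + bilinear h f' g"
proof -
  let ?A = "Poly_Mapping.keys f \<union> Poly_Mapping.keys f' \<union> Poly_Mapping.keys (f + f')"
  have *: "bilinear h k g = (\<Sum>D\<in>?A. \<Sum>E\<in>Poly_Mapping.keys g.
     (Poly_Mapping.lookup k D * Poly_Mapping.lookup g E) *\<^sub>l gr (h D E))"
    if "Poly_Mapping.keys k \<subseteq> ?A" for k
    using that by (intro bilinear_superset) auto
  have "Poly_Mapping.keys f \<subseteq> ?A" "Poly_Mapping.keys f' \<subseteq> ?A" "Poly_Mapping.keys (f + f') \<subseteq> ?A"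
    by auto
  then show ?thesis
    by (simp only: *) (simp add: lookup_add distrib_right scale_left sum.distrib)
qed

lemma bilinear_add_right: "bilinear h f (g + g') = bilinear h f g + bilinear h f g'"
proof -
  let ?B = "Poly_Mapping.keys g \<union> Poly_Mapping.keys g' \<union> Poly_Mapping.keys (g + g')"
  have *: "bilinear h f k = (\<Sum>D\<in>Poly_Mapping.keys f. \<Sum>E\<in>?B.
     (Poly_Mapping.lookup f D * Poly_Mapping.lookup k E) *\<^sub>l gr (h D E))"
    if "Poly_Mapping.keys k \<subseteq> ?B" for k
    using that by (intro bilinear_superset) auto
  have "Poly_Mapping.keys g \<subseteq> ?B" "Poly_Mapping.keys g' \<subseteq> ?B" "Poly_Mapping.keys (g + g') \<subseteq> ?B"
    by auto
  then show ?thesis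
    by (simp only: *) (simp add: lookup_add distrib_left scale_left sum.distrib)
qed

lemma scale_sum: "c *\<^sub>l (\<Sum>x\<in>A. f x) = (\<Sum>x\<in>A. c *\<^sub>l f x)"
  by (induction A rule: infinite_finite_induct) simp_all

lemma keys_scale: "Poly_Mapping.keys (c *\<^sub>l f) \<subseteq> Poly_Mapping.keys f"
  by (auto simp: in_keys_iff)

lemma bilinear_scale_left: "bilinear h (c *\<^sub>l f) g = c *\<^sub>l bilinear h f g"
proof -
  have "bilinear h (c *\<^sub>l f) g = (\<Sum>D\<in>Poly_Mapping.keys f. \<Sum>E\<in>Poly_Mapping.keys g.
     (Poly_Mapping.lookup (c *\<^sub>l f) D * Poly_Mapping.lookup g E) *\<^sub>l gr (h D E))"
    by (intro bilinear_superset keys_scale) auto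
  then show ?thesis by (simp add: bilinear_def scale_sum mult.assoc)
qed

lemma bilinear_scale_right: "bilinear h f (c *\<^sub>l g) = c *\<^sub>l bilinear h f g"
proof -
  have "bilinear h f (c *\<^sub>l g) = (\<Sum>D\<in>Poly_Mapping.keys f. \<Sum>E\<in>Poly_Mapping.keys g.
     (Poly_Mapping.lookup f D * Poly_Mapping.lookup (c *\<^sub>l g) E) *\<^sub>l gr (h D E))"
    by (intro bilinear_superset keys_scale) auto
  then show ?thesis by (simp add: bilinear_def scale_sum ac_simps)
qed

lemma bilinear_gr: "bilinear h (gr D) (gr E) = gr (h D E)"
  by (simp add: bilinear_def gr_def)

lemma bilinear_zero: "bilinear h 0 g = 0" "bilinear h f 0 = 0"
  by (simp_all add: bilinear_def)

lemma bilinear_diff: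
  "bilinear h (f - f') g = bilinear h f g - bilinear h f' g"
  "bilinear h f (g - g') = bilinear h f g - bilinear h f g'"
  using bilinear_add_left[of h "f - f'" f' g] bilinear_add_right[of h f "g - g'" g']
  by (simp_all add: eq_diff_eq)

lemmas lin_op_simps [simp] =
  bilinear_add_left[of Comp, folded lin_comp_bilinear]
  bilinear_add_right[of Comp, folded lin_comp_bilinear]
  bilinear_scale_left[of Comp, folded lin_comp_bilinear]
  bilinear_scale_right[of Comp, folded lin_comp_bilinear]
  bilinear_diff[of Comp, folded lin_comp_bilinear]
  bilinear_zero[of Comp, folded lin_comp_bilinear]
  bilinear_gr[of Comp, folded lin_comp_bilinear]
  bilinear_add_left[of Tens, folded lin_tens_bilinear]
  bilinear_add_right[of Tens, folded lin_tens_bilinear]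
  bilinear_scale_left[of Tens, folded lin_tens_bilinear]
  bilinear_scale_right[of Tens, folded lin_tens_bilinear]
  bilinear_diff[of Tens, folded lin_tens_bilinear]
  bilinear_zero[of Tens, folded lin_tens_bilinear]
  bilinear_gr[of Tens, folded lin_tens_bilinear]

text \<open>The type \<open>lin\<close> also contains combinations of ill-formed diagrams and of
  diagrams with different ends. This predicate singles out the morphisms, and its induction rule
  extends statements linearly from diagrams.\<close>

inductive lin_hom :: "orient list \<Rightarrow> orient list \<Rightarrow> lin \<Rightarrow> bool" for a b where
  zero: "lin_hom a b 0"
| gr: "in_hom D a b \<Longrightarrow> lin_hom a b (c *\<^sub>l gr D)"
| add: "lin_hom a b f \<Longrightarrow> lin_hom a b g \<Longrightarrow> lin_hom a b (f + g)"

lemma lin_hom_gr: "in_hom D a b \<Longrightarrow> lin_hom a b (gr D)"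
  using lin_hom.gr[of D a b 1] by simp

lemma lin_hom_scale: "lin_hom a b f \<Longrightarrow> lin_hom a b (c *\<^sub>l f)"
  by (induction rule: lin_hom.induct) (auto intro: lin_hom.intros)

lemma lin_hom_diff: "lin_hom a b f \<Longrightarrow> lin_hom a b g \<Longrightarrow> lin_hom a b (f - g)"
  using lin_hom.add[of a b f "(- 1) *\<^sub>l g"] lin_hom_scale[of a b g "- 1"] by (simp add: scale_left)

lemma lin_hom_comp: "lin_hom b c f \<Longrightarrow> lin_hom a b g \<Longrightarrow> lin_hom a c (f \<odot>\<^sub>l g)"
proof (induction rule: lin_hom.induct)
  case (gr D d)
  from gr(2) show ?case
    by (induction rule: lin_hom.induct) (use gr(1) in \<open>auto simp: in_hom_def intro: lin_hom.intros\<close>)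
qed (auto intro: lin_hom.intros)

lemma lin_hom_tens: "lin_hom a b f \<Longrightarrow> lin_hom c d g \<Longrightarrow> lin_hom (a @ c) (b @ d) (f \<otimes>\<^sub>l g)"
proof (induction rule: lin_hom.induct)
  case (gr D d)
  from gr(2) show ?case
    by (induction rule: lin_hom.induct) (use gr(1) in \<open>auto simp: in_hom_def intro: lin_hom.intros\<close>)
qed (auto intro: lin_hom.intros)

section \<open>Congruence and monoidal laws modulo the MOY ideal\<close>

lemma MOY_eq_refl: "MOY_eq n a b f f"
  by (simp add: MOY_eq_def MOY_ideal.zero)

lemma MOY_eq_scale: "MOY_eq n a b f g \<Longrightarrow> MOY_eq n a b (c *\<^sub>l f) (c *\<^sub>l g)"
  unfolding MOY_eq_def using MOY_ideal.scale[of n a b "f - g" c] by simp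

lemma MOY_eq_sym: "MOY_eq n a b f g \<Longrightarrow> MOY_eq n a b g f"
  unfolding MOY_eq_def using MOY_ideal.scale[of n a b "f - g" "- 1"] by (simp add: scale_left)

lemma MOY_eq_trans [trans]: "MOY_eq n a b f g \<Longrightarrow> MOY_eq n a b g h \<Longrightarrow> MOY_eq n a b f h"
  unfolding MOY_eq_def using MOY_ideal.add[of n a b "f - g" "g - h"] by simp

lemma MOY_eq_add: "MOY_eq n a b f f' \<Longrightarrow> MOY_eq n a b g g' \<Longrightarrow> MOY_eq n a b (f + g) (f' + g')"
  unfolding MOY_eq_def using MOY_ideal.add[of n a b "f - f'" "g - g'"] by (simp add: algebra_simps)

lemma MOY_eq_diff: "MOY_eq n a b f f' \<Longrightarrow> MOY_eq n a b g g' \<Longrightarrow> MOY_eq n a b (f - g) (f' - g')"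
  using MOY_eq_add[of n a b f f' "(- 1) *\<^sub>l g" "(- 1) *\<^sub>l g'"] MOY_eq_scale[of n a b g g' "- 1"]
  by (simp add: scale_left)

lemma MOY_eq_relation: "MOY_relation n a b f g \<Longrightarrow> MOY_eq n a b f g"
  by (simp add: MOY_eq_def MOY_ideal.relation)

lemma MOY_eq_comp_left: "lin_hom b c h \<Longrightarrow> MOY_eq n a b f g \<Longrightarrow> MOY_eq n a c (h \<odot>\<^sub>l f) (h \<odot>\<^sub>l g)"
proof (induction rule: lin_hom.induct)
  case (gr D d)
  then show ?case
    unfolding MOY_eq_def using MOY_ideal.scale[OF MOY_ideal.comp_left[of n a b "f - g" D c], of d] by simp
qed (auto intro: MOY_eq_refl MOY_eq_add)

lemma MOY_eq_comp_right: "lin_hom a b h \<Longrightarrow> MOY_eq n b c f g \<Longrightarrow> MOY_eq n a c (f \<odot>\<^sub>l h) (g \<odot>\<^sub>l h)"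
proof (induction rule: lin_hom.induct)
  case (gr D d)
  then show ?case
    unfolding MOY_eq_def using MOY_ideal.scale[OF MOY_ideal.comp_right[of n b c "f - g" D a], of d] by simp
qed (auto intro: MOY_eq_refl MOY_eq_add)

lemma MOY_eq_tens_left:
  "lin_hom c d h \<Longrightarrow> MOY_eq n a b f g \<Longrightarrow> MOY_eq n (c @ a) (d @ b) (h \<otimes>\<^sub>l f) (h \<otimes>\<^sub>l g)"
proof (induction rule: lin_hom.induct)
  case (gr D k)
  then show ?case
    unfolding MOY_eq_def using MOY_ideal.scale[OF MOY_ideal.tens_left[of n a b "f - g" D c d], of k] by simp
qed (auto intro: MOY_eq_refl MOY_eq_add)

lemma MOY_eq_tens_right:
  "lin_hom c d h \<Longrightarrow> MOY_eq n a b f g \<Longrightarrow> MOY_eq n (a @ c) (b @ d) (f \<otimes>\<^sub>l h) (g \<otimes>\<^sub>l h)"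
proof (induction rule: lin_hom.induct)
  case (gr D k)
  then show ?case
    unfolding MOY_eq_def using MOY_ideal.scale[OF MOY_ideal.tens_right[of n a b "f - g" D c d], of k] by simp
qed (auto intro: MOY_eq_refl MOY_eq_add)

text \<open>First \<open>f\<close> is replaced above \<open>g\<close>, then \<open>g\<close> below
  \<open>f'\<close>; these are the two factors that stay fixed and must be morphisms.\<close>

lemma MOY_eq_comp:
  assumes "MOY_eq n b c f f'" "MOY_eq n a b g g'" "lin_hom a b g" "lin_hom b c f'"
  shows "MOY_eq n a c (f \<odot>\<^sub>l g) (f' \<odot>\<^sub>l g')"
  using MOY_eq_comp_right[OF assms(3,1)] MOY_eq_comp_left[OF assms(4,2)] by (rule MOY_eq_trans)

lemma MOY_eq_tens:
  assumes "MOY_eq n a b f f'" "MOY_eq n c d g g'" "lin_hom c d g" "lin_hom a b f'"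
  shows "MOY_eq n (a @ c) (b @ d) (f \<otimes>\<^sub>l g) (f' \<otimes>\<^sub>l g')"
  using MOY_eq_tens_right[OF assms(3,1)] MOY_eq_tens_left[OF assms(4,2)] by (rule MOY_eq_trans)

instantiation web :: move_vertex
begin
definition moves_web :: "graph \<Rightarrow> graph \<Rightarrow> bool" where "moves_web = web_rotation"
instance ..
end

lemma diagram_eq_mono: "diagram_eq R D E \<Longrightarrow> (\<And>D E. R D E \<Longrightarrow> R' D E) \<Longrightarrow> diagram_eq R' D E"
  by (induction rule: diagram_eq.induct) (auto intro: diagram_eq.intros)

text \<open>The bridge from equations in the quotient \<open>dgm\<close> to equations in
  MOY.\<close>

lemma MOY_eq_isotopic:
  assumes "abs_dgm D = abs_dgm E" "in_hom D a b"
  shows "MOY_eq n a b (gr D) (gr E)"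
proof -
  have "diagram_eq wf_moves D E" "in_hom E a b"
    using assms by (auto simp: dgm.abs_eq_iff isotopic_iff in_hom_def)
  moreover from this(1) have "graph_isotopic D E"
    by (rule diagram_eq_mono) (simp add: wf_moves_def moves_web_def)
  ultimately show ?thesis
    using assms unfolding MOY_eq_def by (intro MOY_ideal.isotopy)
qed

text \<open>Two linear operations agree on morphisms if they agree on diagrams. The laws below apply
  this to one argument after the other.\<close>

lemma MOY_eq_linear:
  assumes f: "lin_hom a b f"
    and "\<And>f g. \<Phi> (f + g) = \<Phi> f + \<Phi> g" "\<And>c f. \<Phi> (c *\<^sub>l f) = c *\<^sub>l \<Phi> f"
    and "\<And>f g. \<Psi> (f + g) = \<Psi> f + \<Psi> g" "\<And>c f. \<Psi> (c *\<^sub>l f) = c *\<^sub>l \<Psi> f"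
    and "\<And>D. in_hom D a b \<Longrightarrow> MOY_eq n u v (\<Phi> (gr D)) (\<Psi> (gr D))"
  shows "MOY_eq n u v (\<Phi> f) (\<Psi> f)"
  using f
proof (induction rule: lin_hom.induct)
  case zero
  have "\<Phi> 0 = 0" "\<Psi> 0 = 0" using assms(3)[of 0 0] assms(5)[of 0 0] by simp_all
  then show ?case by (simp add: MOY_eq_refl)
qed (simp_all add: assms MOY_eq_scale MOY_eq_add)

lemma MOY_comp_assoc:
  assumes "lin_hom c d f" "lin_hom b c g" "lin_hom a b h"
  shows "MOY_eq n a d ((f \<odot>\<^sub>l g) \<odot>\<^sub>l h) (f \<odot>\<^sub>l g \<odot>\<^sub>l h)"
  using assms(1)
proof (rule MOY_eq_linear[where \<Phi> = "\<lambda>z. (z \<odot>\<^sub>l g) \<odot>\<^sub>l h" and \<Psi> = "\<lambda>z. z \<odot>\<^sub>l g \<odot>\<^sub>l h"], simp_all)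
  fix D :: graph assume D: "in_hom D c d"
  show "MOY_eq n a d ((gr D \<odot>\<^sub>l g) \<odot>\<^sub>l h) (gr D \<odot>\<^sub>l g \<odot>\<^sub>l h)"
    using assms(2)
  proof (rule MOY_eq_linear[where \<Phi> = "\<lambda>z. (gr D \<odot>\<^sub>l z) \<odot>\<^sub>l h" and \<Psi> = "\<lambda>z. gr D \<odot>\<^sub>l z \<odot>\<^sub>l h"], simp_all)
    fix E :: graph assume E: "in_hom E b c"
    show "MOY_eq n a d (gr (D \<odot> E) \<odot>\<^sub>l h) (gr D \<odot>\<^sub>l gr E \<odot>\<^sub>l h)"
      using assms(3)
    proof (rule MOY_eq_linear[where \<Phi> = "\<lambda>z. gr (D \<odot> E) \<odot>\<^sub>l z" and \<Psi> = "\<lambda>z. gr D \<odot>\<^sub>l gr E \<odot>\<^sub>l z"], simp_all)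
      fix F :: graph assume "in_hom F a b"
      with D E show "MOY_eq n a d (gr ((D \<odot> E) \<odot> F)) (gr (D \<odot> E \<odot> F))"
        by (intro MOY_eq_isotopic) (simp_all add: abs_dgm_simps in_hom_def)
    qed
  qed
qed

lemma MOY_tens_assoc:
  assumes "lin_hom a b f" "lin_hom c d g" "lin_hom u v h"
  shows "MOY_eq n (a @ c @ u) (b @ d @ v) ((f \<otimes>\<^sub>l g) \<otimes>\<^sub>l h) (f \<otimes>\<^sub>l g \<otimes>\<^sub>l h)"
  using assms(1)
proof (rule MOY_eq_linear[where \<Phi> = "\<lambda>z. (z \<otimes>\<^sub>l g) \<otimes>\<^sub>l h" and \<Psi> = "\<lambda>z. z \<otimes>\<^sub>l g \<otimes>\<^sub>l h"], simp_all)
  fix D :: graph assume D: "in_hom D a b"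
  show "MOY_eq n (a @ c @ u) (b @ d @ v) ((gr D \<otimes>\<^sub>l g) \<otimes>\<^sub>l h) (gr D \<otimes>\<^sub>l g \<otimes>\<^sub>l h)"
    using assms(2)
  proof (rule MOY_eq_linear[where \<Phi> = "\<lambda>z. (gr D \<otimes>\<^sub>l z) \<otimes>\<^sub>l h" and \<Psi> = "\<lambda>z. gr D \<otimes>\<^sub>l z \<otimes>\<^sub>l h"], simp_all)
    fix E :: graph assume E: "in_hom E c d"
    show "MOY_eq n (a @ c @ u) (b @ d @ v) (gr (D \<otimes> E) \<otimes>\<^sub>l h) (gr D \<otimes>\<^sub>l gr E \<otimes>\<^sub>l h)"
      using assms(3)
    proof (rule MOY_eq_linear[where \<Phi> = "\<lambda>z. gr (D \<otimes> E) \<otimes>\<^sub>l z" and \<Psi> = "\<lambda>z. gr D \<otimes>\<^sub>l gr E \<otimes>\<^sub>l z"], simp_all)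
      fix F :: graph assume "in_hom F u v"
      with D E show "MOY_eq n (a @ c @ u) (b @ d @ v) (gr ((D \<otimes> E) \<otimes> F)) (gr (D \<otimes> E \<otimes> F))"
        by (intro MOY_eq_isotopic) (simp_all add: abs_dgm_simps in_hom_def)
    qed
  qed
qed

lemma MOY_interchange:
  assumes "lin_hom b c f" "lin_hom b' c' f'" "lin_hom a b g" "lin_hom a' b' g'"
  shows "MOY_eq n (a @ a') (c @ c') ((f \<otimes>\<^sub>l f') \<odot>\<^sub>l (g \<otimes>\<^sub>l g')) ((f \<odot>\<^sub>l g) \<otimes>\<^sub>l (f' \<odot>\<^sub>l g'))"
  using assms(1)
proof (rule MOY_eq_linear[where \<Phi> = "\<lambda>z. (z \<otimes>\<^sub>l f') \<odot>\<^sub>l (g \<otimes>\<^sub>l g')" and \<Psi> = "\<lambda>z. (z \<odot>\<^sub>l g) \<otimes>\<^sub>l (f' \<odot>\<^sub>l g')"], simp_all)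
  fix D :: graph assume D: "in_hom D b c"
  show "MOY_eq n (a @ a') (c @ c') ((gr D \<otimes>\<^sub>l f') \<odot>\<^sub>l (g \<otimes>\<^sub>l g')) ((gr D \<odot>\<^sub>l g) \<otimes>\<^sub>l (f' \<odot>\<^sub>l g'))"
    using assms(2)
  proof (rule MOY_eq_linear[where \<Phi> = "\<lambda>z. (gr D \<otimes>\<^sub>l z) \<odot>\<^sub>l (g \<otimes>\<^sub>l g')" and \<Psi> = "\<lambda>z. (gr D \<odot>\<^sub>l g) \<otimes>\<^sub>l (z \<odot>\<^sub>l g')"], simp_all)
    fix D' :: graph assume D': "in_hom D' b' c'"
    show "MOY_eq n (a @ a') (c @ c') (gr (D \<otimes> D') \<odot>\<^sub>l (g \<otimes>\<^sub>l g')) ((gr D \<odot>\<^sub>l g) \<otimes>\<^sub>l (gr D' \<odot>\<^sub>l g'))"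
      using assms(3)
    proof (rule MOY_eq_linear[where \<Phi> = "\<lambda>z. gr (D \<otimes> D') \<odot>\<^sub>l (z \<otimes>\<^sub>l g')" and \<Psi> = "\<lambda>z. (gr D \<odot>\<^sub>l z) \<otimes>\<^sub>l (gr D' \<odot>\<^sub>l g')"], simp_all)
      fix E :: graph assume E: "in_hom E a b"
      show "MOY_eq n (a @ a') (c @ c') (gr (D \<otimes> D') \<odot>\<^sub>l (gr E \<otimes>\<^sub>l g')) (gr (D \<odot> E) \<otimes>\<^sub>l (gr D' \<odot>\<^sub>l g'))"
        using assms(4)
      proof (rule MOY_eq_linear[where \<Phi> = "\<lambda>z. gr (D \<otimes> D') \<odot>\<^sub>l (gr E \<otimes>\<^sub>l z)" and \<Psi> = "\<lambda>z. gr (D \<odot> E) \<otimes>\<^sub>l (gr D' \<odot>\<^sub>l z)"], simp_all)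
        fix E' :: graph assume "in_hom E' a' b'"
        with D D' E show "MOY_eq n (a @ a') (c @ c') (gr ((D \<otimes> D') \<odot> (E \<otimes> E'))) (gr ((D \<odot> E) \<otimes> (D' \<odot> E')))"
          by (intro MOY_eq_isotopic)
            (simp_all add: abs_dgm_simps in_hom_def interchange ok.abs_eq dom.abs_eq cod.abs_eq)
      qed
    qed
  qed
qed

lemma MOY_units:
  assumes "lin_hom a b f"
  shows "MOY_eq n a b (gr (Ident b) \<odot>\<^sub>l f) f" "MOY_eq n a b (f \<odot>\<^sub>l gr (Ident a)) f"
    "MOY_eq n a b (gr (Ident []) \<otimes>\<^sub>l f) f" "MOY_eq n a b (f \<otimes>\<^sub>l gr (Ident [])) f"
proof -
  note iso = MOY_eq_isotopic abs_dgm_simps in_hom_def idn_cmp cmp_idn ok.abs_eq dom.abs_eq cod.abs_eq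
  show "MOY_eq n a b (gr (Ident b) \<odot>\<^sub>l f) f"
    using assms by (rule MOY_eq_linear[where \<Psi> = "\<lambda>z. z"]) (simp_all add: iso)
  show "MOY_eq n a b (f \<odot>\<^sub>l gr (Ident a)) f"
    using assms
    by (rule MOY_eq_linear[where \<Phi> = "\<lambda>z. z \<odot>\<^sub>l gr (Ident a)" and \<Psi> = "\<lambda>z. z"]) (simp_all add: iso)
  show "MOY_eq n a b (gr (Ident []) \<otimes>\<^sub>l f) f"
    using assms by (rule MOY_eq_linear[where \<Psi> = "\<lambda>z. z"]) (simp_all add: iso)
  show "MOY_eq n a b (f \<otimes>\<^sub>l gr (Ident [])) f"
    using assms
    by (rule MOY_eq_linear[where \<Phi> = "\<lambda>z. z \<otimes>\<^sub>l gr (Ident [])" and \<Psi> = "\<lambda>z. z"]) (simp_all add: iso)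
qed

section \<open>The functor on tangles\<close>

lemma lin_hom_Z_crossing: "lin_hom [Up, Up] [Up, Up] (Z_crossing n X)"
  by (cases X) (auto intro!: lin_hom_diff lin_hom.gr simp: in_hom_def)

lemma lin_hom_Z_MOY: "wf_diagram D \<Longrightarrow> lin_hom (src D) (tgt D) (Z_MOY n D)"
  by (induction D)
    (auto simp: ends_crossing_def in_hom_def intro: lin_hom_gr lin_hom_Z_crossing lin_hom_comp lin_hom_tens)

lemma lin_hom_Z_MOY': "in_hom D a b \<Longrightarrow> lin_hom a b (Z_MOY n D)"
  using lin_hom_Z_MOY[of D n] by (auto simp: in_hom_def)

text \<open>Composition and tensor product in MOY satisfy the laws of a strict monoidal category,
  and cups and caps go to cups and caps. Invariance is thereby reduced to the relations
  \<open>R\<close>.\<close>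

lemma Z_MOY_diagram_eq:
  assumes "diagram_eq R D E"
    and R: "\<And>D E. R D E \<Longrightarrow> wf_diagram D \<and> in_hom E (src D) (tgt D)
      \<and> MOY_eq n (src D) (tgt D) (Z_MOY n D) (Z_MOY n E)"
  shows "MOY_eq n (src D) (tgt D) (Z_MOY n D) (Z_MOY n E)"
  using assms(1)
proof (induction rule: diagram_eq.induct)
  case (base D E)
  then show ?case by (simp add: R)
next
  case (refl D)
  then show ?case by (simp add: MOY_eq_refl)
next
  case (sym D E)
  have "in_hom E (src D) (tgt D)"
    using diagram_eq_in_hom[OF sym.hyps] R by blast
  with sym.IH show ?case by (auto simp: in_hom_def intro: MOY_eq_sym)
next
  case (trans D E F)
  have "in_hom E (src D) (tgt D)"
    using diagram_eq_in_hom[OF trans.hyps(1)] R by blast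
  with trans.IH show ?case by (auto simp: in_hom_def intro: MOY_eq_trans)
next
  case (comp D D' E E')
  have *: "wf_diagram D \<and> in_hom D' (src D) (tgt D)" "wf_diagram E \<and> in_hom E' (src E) (tgt E)"
    using diagram_eq_in_hom[OF comp.hyps(1)] diagram_eq_in_hom[OF comp.hyps(2)] R by blast+
  have "lin_hom (src E) (tgt E) (Z_MOY n E)" "lin_hom (src D) (tgt D) (Z_MOY n D')"
    using * by (auto intro: lin_hom_Z_MOY lin_hom_Z_MOY')
  then show ?case
    using comp.IH comp.hyps(3) by (auto intro: MOY_eq_comp)
next
  case (tens D D' E E')
  have *: "wf_diagram D \<and> in_hom D' (src D) (tgt D)" "wf_diagram E \<and> in_hom E' (src E) (tgt E)"
    using diagram_eq_in_hom[OF tens.hyps(1)] diagram_eq_in_hom[OF tens.hyps(2)] R by blast+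
  have "lin_hom (src E) (tgt E) (Z_MOY n E)" "lin_hom (src D) (tgt D) (Z_MOY n D')"
    using * by (auto intro: lin_hom_Z_MOY lin_hom_Z_MOY')
  then show ?case
    using tens.IH by (auto intro: MOY_eq_tens)
next
  case (comp_assoc D E F)
  then show ?case
    using MOY_comp_assoc[of "tgt E" "tgt D" "Z_MOY n D" "tgt F" "Z_MOY n E" "src F" "Z_MOY n F" n]
      lin_hom_Z_MOY[of D n] lin_hom_Z_MOY[of E n] lin_hom_Z_MOY[of F n] by simp
next
  case (tens_assoc D E F)
  then show ?case
    using MOY_tens_assoc lin_hom_Z_MOY by simp
next
  case (interchange D E D' E')
  then show ?case
    using MOY_interchange[of "tgt E" "tgt D" "Z_MOY n D" "tgt E'" "tgt D'" "Z_MOY n D'"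
        "src E" "Z_MOY n E" "src E'" "Z_MOY n E'" n]
      lin_hom_Z_MOY[of D n] lin_hom_Z_MOY[of E n] lin_hom_Z_MOY[of D' n] lin_hom_Z_MOY[of E' n] by simp
next
  case (zigzag_left s)
  show ?case
    by (auto intro!: MOY_eq_isotopic simp: abs_dgm_simps in_hom_def zigzags)
next
  case (zigzag_right s)
  show ?case
    by (auto intro!: MOY_eq_isotopic simp: abs_dgm_simps in_hom_def zigzags)
next
  case (ident_tens a b)
  show ?case
    by (auto intro!: MOY_eq_isotopic simp: abs_dgm_simps in_hom_def idn_collect)
qed (simp_all add: MOY_units lin_hom_Z_MOY)

section \<open>Powers of q and the coefficients of a crossing\<close>

lemma q_power_diff: "q_power (int i - int j) = q ^ i * q_inv ^ j"
proof (cases "j \<le> i")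
  case True
  have "q ^ i * q_inv ^ j = q ^ (i - j) * (q * q_inv) ^ j"
    using True by (simp add: power_mult_distrib flip: power_add mult.assoc)
  then show ?thesis using True by (simp add: q_power_def q_q_inv flip: of_nat_diff)
next
  case False
  have "q ^ i * q_inv ^ j = (q * q_inv) ^ i * q_inv ^ (j - i)"
    using False by (simp add: power_mult_distrib mult.assoc flip: power_add)
  then show ?thesis using False by (simp add: q_power_def q_q_inv flip: of_nat_diff)
qed

lemma q_power_add: "q_power (k + l) = q_power k * q_power l"
proof -
  \<comment> \<open>Exponents written as differences of natural numbers make additivity independent
    of signs.\<close>
  obtain i j i' j' where kl: "k = int i - int j" "l = int i' - int j'"
    by (meson int_diff_cases)
  then have "k + l = int (i + i') - int (j + j')" by simp
  then show ?thesis unfolding kl by (simp only: q_power_diff power_add) (simp add: ac_simps)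
qed

lemma q_power_simps [simp]: "q_power 0 = 1" "q_power 1 = q" "q_power (- 1) = q_inv"
  by (simp_all add: q_power_def)

definition Z_id_coeff :: "nat \<Rightarrow> over \<Rightarrow> qring"
  where "Z_id_coeff n d = (case d of Slash \<Rightarrow> q_power (int n - 1) | Backslash \<Rightarrow> q_power (1 - int n))"

definition Z_web_coeff :: "nat \<Rightarrow> over \<Rightarrow> qring"
  where "Z_web_coeff n d = (case d of Slash \<Rightarrow> q_power (int n) | Backslash \<Rightarrow> q_power (- int n))"

lemma Z_MOY_up_crossing: "Z_MOY n (up_crossing d)
    = Z_id_coeff n d *\<^sub>l gr (Ident [Up, Up]) - Z_web_coeff n d *\<^sub>l gr (Vertex (Web Up))"
  by (cases d) (simp_all add: Z_id_coeff_def Z_web_coeff_def)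

text \<open>What the moves demand: the first three identities give the second Reidemeister move for
  parallel strands and, with the fifth, for antiparallel ones; the fourth gives the curl and the
  sixth the triangle. In terms of p = q^n and p' = q^(-n) all of them follow from the equations
  saying that \<open>q_inv\<close>, \<open>q_diff_inv\<close> and p' are inverses.\<close>

lemma Z_coeffs:
  "Z_id_coeff n d * Z_id_coeff n (other d) = 1"
  "Z_web_coeff n d * Z_web_coeff n (other d) = 1"
  "Z_id_coeff n (other d) * Z_web_coeff n d + Z_web_coeff n (other d) * Z_id_coeff n d = q + q_inv"
  "Z_id_coeff n d * q_int (int n) - Z_web_coeff n d * q_int (int n - 1) = 1"
  "q_int (int n) - (q + q_inv) * q_int (int n - 1) + q_int (int n - 2) = 0"
  "Z_id_coeff n d * Z_id_coeff n d - (q + q_inv) * (Z_id_coeff n d * Z_web_coeff n d)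
    + Z_web_coeff n d * Z_web_coeff n d = 0"
proof -
  define p where "p = q_power (int n)"
  define p' where "p' = q_power (- int n)"
  have pp': "p * p' = 1" by (simp add: p_def p'_def flip: q_power_add)
  have p1: "q_power (int n - 1) = p * q_inv" "q_power (1 - int n) = p' * q"
    using q_power_add[of "int n" "- 1"] q_power_add[of "- int n" 1] by (simp_all add: p_def p'_def)
  have p2: "q_power (int n - 2) = p * q_inv * q_inv" "q_power (2 - int n) = p' * q * q"
    using q_power_add[of "int n - 1" "- 1"] q_power_add[of "1 - int n" 1] by (simp_all add: p1)
  have q_ints: "q_int (int n) = (p - p') * q_diff_inv"
    "q_int (int n - 1) = (p * q_inv - p' * q) * q_diff_inv"
    "q_int (int n - 2) = (p * q_inv * q_inv - p' * q * q) * q_diff_inv"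
    by (simp_all add: q_int_def p1 p2 p_def p'_def)
  note coeffs = Z_id_coeff_def Z_web_coeff_def p1 p_def[symmetric] p'_def[symmetric] q_ints
  show "Z_id_coeff n d * Z_id_coeff n (other d) = 1"
    using pp' q_q_inv by (cases d; hypsubst_thin; simp add: coeffs; algebra)
  show "Z_web_coeff n d * Z_web_coeff n (other d) = 1"
    using pp' q_q_inv by (cases d; hypsubst_thin; simp add: coeffs; algebra)
  show "Z_id_coeff n (other d) * Z_web_coeff n d + Z_web_coeff n (other d) * Z_id_coeff n d = q + q_inv"
    using pp' q_q_inv by (cases d; hypsubst_thin; simp add: coeffs; algebra)
  show "Z_id_coeff n d * q_int (int n) - Z_web_coeff n d * q_int (int n - 1) = 1"
    using pp' q_q_inv q_diff_q_diff_inv by (cases d; hypsubst_thin; simp add: coeffs; algebra)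
  show "q_int (int n) - (q + q_inv) * q_int (int n - 1) + q_int (int n - 2) = 0"
    using pp' q_q_inv unfolding coeffs by algebra
  show "Z_id_coeff n d * Z_id_coeff n d - (q + q_inv) * (Z_id_coeff n d * Z_web_coeff n d)
    + Z_web_coeff n d * Z_web_coeff n d = 0"
    using q_q_inv by (cases d; hypsubst_thin; simp add: coeffs; algebra)
qed

section \<open>Webs turned by a right angle\<close>

lemma cap_turn_cw:
  fixes f :: "'v::move_vertex dgm"
  assumes "endo2 s f"
  shows "cap (opp s) \<bullet> turn_cw s f
    = cap s \<bullet> (((cap (opp s) \<star> idn [s]) \<bullet> (idn [opp s] \<star> f) \<bullet> (cup (opp s) \<star> idn [s])) \<star> idn [opp s])"
proof -
  let ?t = "opp s"
  have f: "ok f" "dom f = [s, s]" "cod f = [s, s]" using assms by (auto simp: endo2_def)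
  have "cap ?t \<bullet> turn_cw s f
    = (cap ?t \<bullet> (idn [?t, s] \<star> cap s)) \<bullet> (idn [?t] \<star> f \<star> idn [?t]) \<bullet> (cup ?t \<star> idn [s, ?t])"
    by (simp add: turn_cw_def)
  \<comment> \<open>Exchanging the heights of the two caps puts \<open>cap ?t\<close> directly on
    \<open>f\<close>, which it closes up on the left to a curl.\<close>
  also have "cap ?t \<bullet> (idn [?t, s] \<star> cap s) = cap s \<bullet> (cap ?t \<star> idn [s, ?t] :: 'v dgm)"
    using slide_cap(1)[of "cap ?t :: 'v dgm" "cap s" "[?t, s]" "[s, ?t]" "[]"] by simp
  finally show ?thesis using f by (simp add: whisker_right idn_collect)
qed

lemma turn_ccw_cup:
  fixes f :: "'v::move_vertex dgm"
  assumes "endo2 s f"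
  shows "turn_ccw s f \<bullet> cup (opp s)
    = (((cap (opp s) \<star> idn [s]) \<bullet> (idn [opp s] \<star> f) \<bullet> (cup (opp s) \<star> idn [s])) \<star> idn [opp s]) \<bullet> cup s"
proof -
  let ?t = "opp s"
  have f: "ok f" "dom f = [s, s]" "cod f = [s, s]" using assms by (auto simp: endo2_def)
  have "turn_ccw s f \<bullet> cup ?t
    = (cap ?t \<star> idn [s, ?t]) \<bullet> (idn [?t] \<star> f \<star> idn [?t]) \<bullet> ((idn [?t, s] \<star> cup s) \<bullet> cup ?t)"
    by (simp add: turn_ccw_def)
  also have "(idn [?t, s] \<star> cup s) \<bullet> cup ?t = (cup ?t \<star> idn [s, ?t]) \<bullet> (cup s :: 'v dgm)"
    using slide_cup(1)[of "cup ?t :: 'v dgm" "cup s" "[?t, s]" "[]" "[s, ?t]"] by simp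
  finally show ?thesis using f by (simp add: whisker_right idn_collect)
qed

abbreviation (input) web :: "orient \<Rightarrow> graph" where "web s \<equiv> Vertex (Web s)"

lemma endo2_web: "endo2 s (vert (Web s))"
  by (simp add: endo2_def)

lemma half_web:
  "half_cw s (vert (Web s)) = vert (Web (opp s))" "half_ccw s (vert (Web s)) = vert (Web (opp s))"
proof -
  have *: "abs_dgm D = abs_dgm E" if "web_rotation D E" "wf_diagram D" "in_hom E (src D) (tgt D)" for D E
    using that by (auto simp: dgm.abs_eq_iff isotopic_def wf_moves_def moves_web_def intro: diagram_eq.base)
  have "abs_dgm (right_mate s (web s)) = abs_dgm (web (opp s))"
    by (rule *[OF web_rotation.right]) (auto simp: right_mate_def Let_def in_hom_def)
  then show "half_cw s (vert (Web s)) = vert (Web (opp s))"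
    by (simp add: half_cw_def right_mate_def Let_def abs_dgm_simps)
  have "abs_dgm (left_mate s (web s)) = abs_dgm (web (opp s))"
    by (rule *[OF web_rotation.left]) (auto simp: left_mate_def Let_def in_hom_def)
  then show "half_ccw s (vert (Web s)) = vert (Web (opp s))"
    by (simp add: half_ccw_def left_mate_def Let_def abs_dgm_simps)
qed

text \<open>A half turn carries the web of one orientation to that of the other, so the two kinds of
  quarter turn agree up to reversal. The crossing of a descending and an ascending strand is defined
  by the other kind of turn.\<close>

lemma turn_web: "turn_cw s (vert (Web s)) = turn_ccw (opp s) (vert (Web (opp s)))"
  using turn_ccw_half_cw[OF endo2_web[of s]] by (simp add: half_web)

definition turned_web :: "orient \<Rightarrow> graph"
  where "turned_web s = (Ident [opp s, s] \<otimes> Cap s) \<odot> (Ident [opp s] \<otimes> web s \<otimes> Ident [opp s])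
    \<odot> (Cup (opp s) \<otimes> Ident [s, opp s])"

lemma abs_turned_web: "abs_dgm (turned_web s) = turn_cw s (vert (Web s))"
  by (simp add: turned_web_def turn_cw_def abs_dgm_simps)

lemma in_hom_turned_web: "in_hom (turned_web s) [s, opp s] [opp s, s]"
  by (simp add: turned_web_def in_hom_def)

definition web_curl :: "orient \<Rightarrow> graph"
  where "web_curl s = (Cap (opp s) \<otimes> Ident [s]) \<odot> (Ident [opp s] \<otimes> web s) \<odot> (Cup (opp s) \<otimes> Ident [s])"

lemma MOY_curl: "MOY_eq n [s] [s] (gr (web_curl s)) (q_int (int n - 1) *\<^sub>l gr (Ident [s]))"
  unfolding web_curl_def by (rule MOY_eq_relation[OF MOY_relation.curl])

lemma MOY_curl_beside:
  "MOY_eq n [s, opp s] [s, opp s] (gr (web_curl s \<otimes> Ident [opp s]))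
    (q_int (int n - 1) *\<^sub>l gr (Ident [s] \<otimes> Ident [opp s]))"
  using MOY_eq_tens_right[OF lin_hom_gr MOY_curl[of n s], of "Ident [opp s]" "[opp s]" "[opp s]"]
  by (simp add: in_hom_def)

lemma cap_turned_web:
  "MOY_eq n [s, opp s] [] (gr (Cap (opp s) \<odot> turned_web s)) (q_int (int n - 1) *\<^sub>l gr (Cap s))"
proof -
  have "MOY_eq n [s, opp s] [] (gr (Cap (opp s) \<odot> turned_web s)) (gr (Cap s \<odot> (web_curl s \<otimes> Ident [opp s])))"
    using in_hom_turned_web[of s] cap_turn_cw[OF endo2_web[of s]]
    by (intro MOY_eq_isotopic) (simp_all add: web_curl_def abs_turned_web abs_dgm_simps in_hom_def)
  also have "MOY_eq n [s, opp s] [] (gr (Cap s \<odot> (web_curl s \<otimes> Ident [opp s])))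
    (q_int (int n - 1) *\<^sub>l gr (Cap s \<odot> (Ident [s] \<otimes> Ident [opp s])))"
    using MOY_eq_comp_left[OF lin_hom_gr MOY_curl_beside[of n s], of "Cap s" "[]"] by (simp add: in_hom_def)
  also have "MOY_eq n [s, opp s] [] \<dots> (q_int (int n - 1) *\<^sub>l gr (Cap s))"
    by (intro MOY_eq_scale MOY_eq_isotopic) (simp_all add: abs_dgm_simps in_hom_def idn_collect cmp_idn)
  finally show ?thesis .
qed

lemma turned_web_cup:
  "MOY_eq n [] [s, opp s] (gr (turned_web (opp s) \<odot> Cup (opp s))) (q_int (int n - 1) *\<^sub>l gr (Cup s))"
proof -
  have "MOY_eq n [] [s, opp s] (gr (turned_web (opp s) \<odot> Cup (opp s))) (gr ((web_curl s \<otimes> Ident [opp s]) \<odot> Cup s))"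
    using in_hom_turned_web[of "opp s"] turn_ccw_cup[OF endo2_web[of s]]
    by (intro MOY_eq_isotopic)
      (simp_all add: web_curl_def abs_turned_web turn_web abs_dgm_simps in_hom_def)
  also have "MOY_eq n [] [s, opp s] (gr ((web_curl s \<otimes> Ident [opp s]) \<odot> Cup s))
    (q_int (int n - 1) *\<^sub>l gr ((Ident [s] \<otimes> Ident [opp s]) \<odot> Cup s))"
    using MOY_eq_comp_right[OF lin_hom_gr MOY_curl_beside[of n s], of "Cup s" "[]"] by (simp add: in_hom_def)
  also have "MOY_eq n [] [s, opp s] \<dots> (q_int (int n - 1) *\<^sub>l gr (Cup s))"
    by (intro MOY_eq_scale MOY_eq_isotopic) (simp_all add: abs_dgm_simps in_hom_def idn_collect idn_cmp)
  finally show ?thesis .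
qed

text \<open>The square relation turned by a right angle. The turn \<open>R\<close> makes two webs
  standing side by side into a stack and interchanges the two terms on the right: cup over cap
  becomes parallel strands and conversely.\<close>

lemma turned_web_turned_web:
  "MOY_eq n [s, opp s] [s, opp s] (gr (turned_web (opp s) \<odot> turned_web s))
    (gr (Ident [s, opp s]) + q_int (int n - 2) *\<^sub>l gr (Cup s \<odot> Cap s))"
proof -
  let ?t = "opp s"
  define R :: "graph \<Rightarrow> graph" where
    "R D = (Ident [s, ?t] \<otimes> Cap s) \<odot> (Ident [s] \<otimes> D \<otimes> Ident [?t]) \<odot> (Cup s \<otimes> Ident [s, ?t])" for D
  define Sq :: graph where "Sq = (Ident [?t] \<otimes> Cap ?t \<otimes> Ident [s]) \<odot> (web ?t \<otimes> web s)
    \<odot> (Ident [?t] \<otimes> Cup ?t \<otimes> Ident [s])"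
  have "MOY_eq n [s, ?t] [s, ?t] (gr (turned_web ?t \<odot> turned_web s)) (gr (R Sq))"
    using in_hom_turned_web[of s] in_hom_turned_web[of "opp s"]
      turn_cw_turn_cw[OF endo2_web[of s] endo2_web[of "opp s"]]
    by (intro MOY_eq_isotopic) (simp_all add: R_def Sq_def abs_turned_web abs_dgm_simps in_hom_def)
  also have "MOY_eq n [s, ?t] [s, ?t] (gr (R Sq))
    (gr (R (Cup ?t \<odot> Cap ?t)) + q_int (int n - 2) *\<^sub>l gr (R (Ident [?t] \<otimes> Ident [s])))"
  proof -
    let ?f = "gr (Cup ?t \<odot> Cap ?t) + q_int (int n - 2) *\<^sub>l gr (Ident [?t] \<otimes> Ident [s])"
    have "MOY_eq n [?t, s] [?t, s] (gr Sq) ?f"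
      using MOY_eq_relation[OF MOY_relation.square[of n ?t]] by (simp add: Sq_def)
    then have "MOY_eq n [s, ?t, s, ?t] [s, ?t, s, ?t]
      (gr (Ident [s]) \<otimes>\<^sub>l gr Sq \<otimes>\<^sub>l gr (Ident [?t])) (gr (Ident [s]) \<otimes>\<^sub>l ?f \<otimes>\<^sub>l gr (Ident [?t]))"
      using MOY_eq_tens_left[of "[s]" "[s]" "gr (Ident [s])" n "[?t, s, ?t]" "[?t, s, ?t]"]
        MOY_eq_tens_right[of "[?t]" "[?t]" "gr (Ident [?t])" n "[?t, s]" "[?t, s]"]
      by (simp add: lin_hom_gr in_hom_def del: lin_op_simps)
    then have "MOY_eq n [s, ?t] [s, ?t]
      (gr (Ident [s, ?t] \<otimes> Cap s) \<odot>\<^sub>l (gr (Ident [s]) \<otimes>\<^sub>l gr Sq \<otimes>\<^sub>l gr (Ident [?t])) \<odot>\<^sub>l gr (Cup s \<otimes> Ident [s, ?t]))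
      (gr (Ident [s, ?t] \<otimes> Cap s) \<odot>\<^sub>l (gr (Ident [s]) \<otimes>\<^sub>l ?f \<otimes>\<^sub>l gr (Ident [?t])) \<odot>\<^sub>l gr (Cup s \<otimes> Ident [s, ?t]))"
      by (intro MOY_eq_comp_left[where b = "[s, ?t, s, ?t]"] MOY_eq_comp_right[where b = "[s, ?t, s, ?t]"])
        (simp_all add: lin_hom_gr in_hom_def)
    then show ?thesis by (simp add: R_def)
  qed
  also have "MOY_eq n [s, ?t] [s, ?t] \<dots> (gr (Ident [s, ?t]) + q_int (int n - 2) *\<^sub>l gr (Cup s \<odot> Cap s))"
  proof (intro MOY_eq_add MOY_eq_scale MOY_eq_isotopic)
    have "(idn [s, ?t] \<star> cap s) \<bullet> (idn [s] \<star> (cup ?t \<bullet> cap ?t) \<star> idn [?t]) \<bullet> (cup s \<star> idn [s, ?t])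
      = (idn [s] \<star> ((idn [?t] \<star> cap s) \<bullet> (cup ?t \<star> idn [?t]))) \<bullet>
        (((idn [s] \<star> cap ?t) \<bullet> (cup s \<star> idn [s])) \<star> idn [?t] :: web dgm)"
      by (simp add: whisker_left whisker_right idn_collect)
    then show "abs_dgm (R (Cup ?t \<odot> Cap ?t)) = abs_dgm (Ident [s, ?t])"
      by (simp add: R_def abs_dgm_simps zigzags idn_collect idn_cmp)
    show "abs_dgm (R (Ident [?t] \<otimes> Ident [s])) = abs_dgm (Cup s \<odot> Cap s)"
      using slide_cup(1)[of "cup s :: web dgm" "cap s" "[s, ?t]" "[s, ?t]" "[]"]
      by (simp add: R_def abs_dgm_simps idn_collect idn_cmp)
  qed (simp_all add: R_def in_hom_def)
  finally show ?thesis .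
qed

section \<open>Values on crossings of all orientations, and invariance under the basic moves\<close>

lemma Z_cross_same:
  "MOY_eq n [s, s] [s, s] (Z_MOY n (cross d s s))
    (Z_id_coeff n d *\<^sub>l gr (Ident [s, s]) - Z_web_coeff n d *\<^sub>l gr (web s))"
proof (cases s)
  case Up
  then show ?thesis by (simp add: Z_MOY_up_crossing MOY_eq_refl)
next
  case Down
  have "Z_MOY n (left_mate Up (up_crossing d)) = Z_id_coeff n d *\<^sub>l gr (left_mate Up (Ident [Up, Up]))
      - Z_web_coeff n d *\<^sub>l gr (left_mate Up (web Up))"
    by (simp add: left_mate_def Let_def Z_MOY_up_crossing)
  moreover have "MOY_eq n [Down, Down] [Down, Down] \<dots>
    (Z_id_coeff n d *\<^sub>l gr (Ident [Down, Down]) - Z_web_coeff n d *\<^sub>l gr (web Down))"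
  proof (intro MOY_eq_diff MOY_eq_scale MOY_eq_isotopic)
    show "abs_dgm (left_mate Up (Ident [Up, Up])) = abs_dgm (Ident [Down, Down] :: graph)"
      using half_ccw_idn[of Up, where 'v = web]
      by (simp add: half_ccw_def left_mate_def Let_def abs_dgm_simps)
    show "abs_dgm (left_mate Up (web Up)) = abs_dgm (web Down)"
      using half_web(2)[of Up]
      by (simp add: half_ccw_def left_mate_def Let_def abs_dgm_simps)
  qed (simp_all add: left_mate_def Let_def in_hom_def)
  ultimately show ?thesis using Down by simp
qed

text \<open>Such a crossing is a quarter turn of an upward crossing with the over-strand in the
  other position, and the turn makes cup over cap of the identity summand.\<close>

lemma Z_cross_opposite:
  "MOY_eq n [s, opp s] [opp s, s] (Z_MOY n (cross d s (opp s)))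
    (Z_id_coeff n (other d) *\<^sub>l gr (Cup (opp s) \<odot> Cap s) - Z_web_coeff n (other d) *\<^sub>l gr (turned_web s))"
proof (cases s)
  case Up
  let ?R = "\<lambda>D :: graph. (Ident [Down, Up] \<otimes> Cap Up) \<odot> (Ident [Down] \<otimes> D \<otimes> Ident [Down]) \<odot> (Cup Down \<otimes> Ident [Up, Down])"
  have "Z_MOY n (cross d Up Down) = Z_id_coeff n (other d) *\<^sub>l gr (?R (Ident [Up, Up]))
      - Z_web_coeff n (other d) *\<^sub>l gr (?R (web Up))"
    by (simp add: Z_MOY_up_crossing)
  moreover have "MOY_eq n [Up, Down] [Down, Up] \<dots>
    (Z_id_coeff n (other d) *\<^sub>l gr (Cup Down \<odot> Cap Up) - Z_web_coeff n (other d) *\<^sub>l gr (turned_web Up))"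
  proof (intro MOY_eq_diff MOY_eq_scale MOY_eq_isotopic)
    show "abs_dgm (?R (Ident [Up, Up])) = abs_dgm (Cup Down \<odot> Cap Up)"
      using turn_cw_idn[of Up, where 'v = web] by (simp add: turn_cw_def abs_dgm_simps)
    show "abs_dgm (?R (web Up)) = abs_dgm (turned_web Up)"
      by (simp add: abs_turned_web turn_cw_def abs_dgm_simps)
  qed (simp_all add: in_hom_def)
  ultimately show ?thesis using Up by simp
next
  case Down
  let ?R = "\<lambda>D :: graph. (Cap Down \<otimes> Ident [Up, Down]) \<odot> (Ident [Down] \<otimes> D \<otimes> Ident [Down]) \<odot> (Ident [Down, Up] \<otimes> Cup Up)"
  have "Z_MOY n (cross d Down Up) = Z_id_coeff n (other d) *\<^sub>l gr (?R (Ident [Up, Up]))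
      - Z_web_coeff n (other d) *\<^sub>l gr (?R (web Up))"
    by (simp add: Z_MOY_up_crossing)
  moreover have "MOY_eq n [Down, Up] [Up, Down] \<dots>
    (Z_id_coeff n (other d) *\<^sub>l gr (Cup Up \<odot> Cap Down) - Z_web_coeff n (other d) *\<^sub>l gr (turned_web Down))"
  proof (intro MOY_eq_diff MOY_eq_scale MOY_eq_isotopic)
    show "abs_dgm (?R (Ident [Up, Up])) = abs_dgm (Cup Up \<odot> Cap Down)"
      using turn_ccw_idn[of Up, where 'v = web] by (simp add: turn_ccw_def abs_dgm_simps)
    show "abs_dgm (?R (web Up)) = abs_dgm (turned_web Down)"
      using turn_web[of Down] by (simp add: abs_turned_web turn_ccw_def abs_dgm_simps)
  qed (simp_all add: in_hom_def)
  ultimately show ?thesis using Down by simp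
qed

lemma lin_hom_Z_cross: "lin_hom [s, t] [t, s] (Z_MOY n (cross d s t))"
  by (intro lin_hom_Z_MOY' cross_in_hom)

text \<open>The digon relation reduces the product of two webs, and the web then has the coefficient
  b' b (q + q^(-1)) - (a' b + b' a), which vanishes.\<close>

lemma Z_cancel_same:
  "MOY_eq n [s, s] [s, s] (Z_MOY n (cross (other d) s s \<odot> cross d s s)) (gr (Ident [s, s]))"
proof -
  define a b a' b' I W where defs: "a = Z_id_coeff n d" "b = Z_web_coeff n d"
    "a' = Z_id_coeff n (other d)" "b' = Z_web_coeff n (other d)"
    "I = (Ident [s, s] :: graph)" "W = web s"
  have "MOY_eq n [s, s] [s, s] (Z_MOY n (cross (other d) s s \<odot> cross d s s))
    ((a' *\<^sub>l gr I - b' *\<^sub>l gr W) \<odot>\<^sub>l (a *\<^sub>l gr I - b *\<^sub>l gr W))"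
    unfolding defs Z_MOY.simps
    by (intro MOY_eq_comp[OF Z_cross_same Z_cross_same lin_hom_Z_cross] lin_hom_diff lin_hom.gr)
      (simp_all add: in_hom_def)
  also have "(a' *\<^sub>l gr I - b' *\<^sub>l gr W) \<odot>\<^sub>l (a *\<^sub>l gr I - b *\<^sub>l gr W)
    = (a' * a) *\<^sub>l gr (I \<odot> I) - (a' * b) *\<^sub>l gr (I \<odot> W)
      - ((b' * a) *\<^sub>l gr (W \<odot> I) - (b' * b) *\<^sub>l gr (W \<odot> W))"
    by (simp add: algebra_simps)
  also have "MOY_eq n [s, s] [s, s] \<dots>
    ((a' * a) *\<^sub>l gr I - (a' * b) *\<^sub>l gr W - ((b' * a) *\<^sub>l gr W - (b' * b) *\<^sub>l (q + q_inv) *\<^sub>l gr W))"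
  proof (intro MOY_eq_diff MOY_eq_scale)
    show "MOY_eq n [s, s] [s, s] (gr (W \<odot> W)) ((q + q_inv) *\<^sub>l gr W)"
      unfolding defs by (intro MOY_eq_relation MOY_relation.digon)
  qed (intro MOY_eq_isotopic; simp add: defs in_hom_def abs_dgm_simps idn_cmp cmp_idn)+
  also have "(a' * a) *\<^sub>l gr I - (a' * b) *\<^sub>l gr W - ((b' * a) *\<^sub>l gr W - (b' * b) *\<^sub>l (q + q_inv) *\<^sub>l gr W) = gr I"
  proof (rule poly_mapping_eqI)
    fix D
    have "a * a' = 1" "b * b' = 1" "a' * b + b' * a = q + q_inv"
      unfolding defs by (rule Z_coeffs)+
    then have "(a' * a) * x - (a' * b) * y - ((b' * a) * y - (b' * b) * ((q + q_inv) * y)) = x" for x y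
      by algebra
    then show "Poly_Mapping.lookup ((a' * a) *\<^sub>l gr I - (a' * b) *\<^sub>l gr W
        - ((b' * a) *\<^sub>l gr W - (b' * b) *\<^sub>l (q + q_inv) *\<^sub>l gr W)) D = Poly_Mapping.lookup (gr I) D"
      by (simp only: lookup_minus lookup_scale)
  qed
  finally show ?thesis by (simp add: defs)
qed

text \<open>The circle, the curl on either side and the turned square evaluate the four products.
  The coefficient of cup over cap is [n] - (q + q^(-1)) [n-1] + [n-2] = 0, and the parallel strands
  come from the square alone.\<close>

lemma Z_cancel_opposite:
  assumes "t = opp s"
  shows "MOY_eq n [s, t] [s, t] (Z_MOY n (cross (other d) t s \<odot> cross d s t)) (gr (Ident [s, t]))"
proof -
  have st: "opp t = s" "opp s = t" using assms by simp_all
  define a b a' b' K where defs: "a = Z_id_coeff n d" "b = Z_web_coeff n d"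
    "a' = Z_id_coeff n (other d)" "b' = Z_web_coeff n (other d)"
    "K = (Cup s \<odot> Cap s :: graph)"
  have turn: "in_hom (turned_web s) [s, t] [t, s]" "in_hom (turned_web t) [t, s] [s, t]"
    using in_hom_turned_web[of s] in_hom_turned_web[of t] by (simp_all add: st)
  have "MOY_eq n [s, t] [s, t] (Z_MOY n (cross (other d) t s \<odot> cross d s t))
    ((a *\<^sub>l gr (Cup s \<odot> Cap t) - b *\<^sub>l gr (turned_web t))
      \<odot>\<^sub>l (a' *\<^sub>l gr (Cup t \<odot> Cap s) - b' *\<^sub>l gr (turned_web s)))"
    using Z_cross_opposite[of n t "other d"] Z_cross_opposite[of n s d] turn
    unfolding defs st Z_MOY.simps other_other
    by (elim MOY_eq_comp) (auto intro!: lin_hom_Z_cross lin_hom_diff lin_hom.gr simp: in_hom_def st)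
  also have "(a *\<^sub>l gr (Cup s \<odot> Cap t) - b *\<^sub>l gr (turned_web t))
      \<odot>\<^sub>l (a' *\<^sub>l gr (Cup t \<odot> Cap s) - b' *\<^sub>l gr (turned_web s))
    = (a * a') *\<^sub>l gr ((Cup s \<odot> Cap t) \<odot> Cup t \<odot> Cap s)
      - (a * b') *\<^sub>l gr ((Cup s \<odot> Cap t) \<odot> turned_web s)
      - ((b * a') *\<^sub>l gr (turned_web t \<odot> Cup t \<odot> Cap s)
        - (b * b') *\<^sub>l gr (turned_web t \<odot> turned_web s))"
    by (simp add: algebra_simps)
  also have "MOY_eq n [s, t] [s, t] \<dots>
    ((a * a') *\<^sub>l q_int (int n) *\<^sub>l gr K - (a * b') *\<^sub>l q_int (int n - 1) *\<^sub>l gr K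
      - ((b * a') *\<^sub>l q_int (int n - 1) *\<^sub>l gr K
        - (b * b') *\<^sub>l (gr (Ident [s, t]) + q_int (int n - 2) *\<^sub>l gr K)))"
  proof (intro MOY_eq_diff MOY_eq_scale)
    have "MOY_eq n [s, t] [s, t] (gr ((Cup s \<odot> Cap t) \<odot> Cup t \<odot> Cap s))
      (gr (Cup s) \<odot>\<^sub>l gr (Cap t \<odot> Cup t) \<odot>\<^sub>l gr (Cap s))"
      by (auto intro!: MOY_eq_isotopic simp: in_hom_def abs_dgm_simps st)
    also have "MOY_eq n [s, t] [s, t] \<dots> (gr (Cup s) \<odot>\<^sub>l (q_int (int n) *\<^sub>l gr (Ident [])) \<odot>\<^sub>l gr (Cap s))"
      by (rule MOY_eq_comp_left[where b = "[]"], (rule lin_hom_gr, simp add: in_hom_def st),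
          rule MOY_eq_comp_right[where b = "[]"], (rule lin_hom_gr, simp add: in_hom_def st),
          rule MOY_eq_relation, rule MOY_relation.circle)
    also have "gr (Cup s) \<odot>\<^sub>l (q_int (int n) *\<^sub>l gr (Ident [])) \<odot>\<^sub>l gr (Cap s)
      = q_int (int n) *\<^sub>l gr (Cup s \<odot> Ident [] \<odot> Cap s)" by simp
    also have "MOY_eq n [s, t] [s, t] \<dots> (q_int (int n) *\<^sub>l gr K)"
      by (intro MOY_eq_scale MOY_eq_isotopic) (simp_all add: defs in_hom_def abs_dgm_simps idn_cmp st)
    finally show "MOY_eq n [s, t] [s, t] (gr ((Cup s \<odot> Cap t) \<odot> Cup t \<odot> Cap s)) (q_int (int n) *\<^sub>l gr K)" .
    have "MOY_eq n [s, t] [s, t] (gr ((Cup s \<odot> Cap t) \<odot> turned_web s)) (gr (Cup s) \<odot>\<^sub>l gr (Cap t \<odot> turned_web s))"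
      using turn by (auto intro!: MOY_eq_isotopic simp: in_hom_def abs_dgm_simps st)
    also have "MOY_eq n [s, t] [s, t] \<dots> (gr (Cup s) \<odot>\<^sub>l (q_int (int n - 1) *\<^sub>l gr (Cap s)))"
      using cap_turned_web[of n s] by (intro MOY_eq_comp_left lin_hom_gr) (simp_all add: in_hom_def st)
    finally show "MOY_eq n [s, t] [s, t] (gr ((Cup s \<odot> Cap t) \<odot> turned_web s)) (q_int (int n - 1) *\<^sub>l gr K)"
      by (simp add: defs)
    have "MOY_eq n [s, t] [s, t] (gr (turned_web t \<odot> Cup t \<odot> Cap s)) (gr (turned_web t \<odot> Cup t) \<odot>\<^sub>l gr (Cap s))"
      using turn by (auto intro!: MOY_eq_isotopic simp: in_hom_def abs_dgm_simps st)
    also have "MOY_eq n [s, t] [s, t] \<dots> ((q_int (int n - 1) *\<^sub>l gr (Cup s)) \<odot>\<^sub>l gr (Cap s))"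
      using turned_web_cup[of n s] by (intro MOY_eq_comp_right lin_hom_gr) (simp_all add: in_hom_def st)
    finally show "MOY_eq n [s, t] [s, t] (gr (turned_web t \<odot> Cup t \<odot> Cap s)) (q_int (int n - 1) *\<^sub>l gr K)"
      by (simp add: defs)
    show "MOY_eq n [s, t] [s, t] (gr (turned_web t \<odot> turned_web s))
      (gr (Ident [s, t]) + q_int (int n - 2) *\<^sub>l gr K)"
      using turned_web_turned_web[of n s] by (simp add: defs st)
  qed
  also have "(a * a') *\<^sub>l q_int (int n) *\<^sub>l gr K - (a * b') *\<^sub>l q_int (int n - 1) *\<^sub>l gr K
      - ((b * a') *\<^sub>l q_int (int n - 1) *\<^sub>l gr K
        - (b * b') *\<^sub>l (gr (Ident [s, t]) + q_int (int n - 2) *\<^sub>l gr K)) = gr (Ident [s, t])"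
    (is "?L = _")
  proof (rule poly_mapping_eqI)
    fix D
    have "a * a' = 1" "b * b' = 1" "a' * b + b' * a = q + q_inv"
      "q_int (int n) - (q + q_inv) * q_int (int n - 1) + q_int (int n - 2) = 0"
      unfolding defs by (rule Z_coeffs)+
    then have "(a * a') * (q_int (int n) * x) - (a * b') * (q_int (int n - 1) * x)
      - ((b * a') * (q_int (int n - 1) * x) - (b * b') * (y + q_int (int n - 2) * x)) = y" for x y
      by algebra
    then show "Poly_Mapping.lookup ?L D = Poly_Mapping.lookup (gr (Ident [s, t])) D"
      by (simp only: lookup_minus lookup_add lookup_scale)
  qed
  finally show ?thesis .
qed

text \<open>The identity summand closes up to a circle beside the strand and the web summand to the
  curl, so the factor is a [n] - b [n-1] = 1.\<close>

lemma Z_curl: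
  "MOY_eq n [s] [s]
    (Z_MOY n ((Cap (opp s) \<otimes> Ident [s]) \<odot> (Ident [opp s] \<otimes> cross d s s) \<odot> (Cup (opp s) \<otimes> Ident [s])))
    (gr (Ident [s]))"
proof -
  let ?t = "opp s"
  define a b where defs: "a = Z_id_coeff n d" "b = Z_web_coeff n d"
  have "MOY_eq n (?t # [s, s]) (?t # [s, s]) (gr (Ident [?t]) \<otimes>\<^sub>l Z_MOY n (cross d s s))
    (gr (Ident [?t]) \<otimes>\<^sub>l (a *\<^sub>l gr (Ident [s, s]) - b *\<^sub>l gr (web s)))"
    using MOY_eq_tens_left[OF lin_hom_gr Z_cross_same[of n s d], of "Ident [?t]" "[?t]" "[?t]"]
    by (simp add: in_hom_def defs)
  then have "MOY_eq n [s] [s]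
    (gr (Cap ?t \<otimes> Ident [s]) \<odot>\<^sub>l (gr (Ident [?t]) \<otimes>\<^sub>l Z_MOY n (cross d s s)) \<odot>\<^sub>l gr (Cup ?t \<otimes> Ident [s]))
    (gr (Cap ?t \<otimes> Ident [s]) \<odot>\<^sub>l (gr (Ident [?t]) \<otimes>\<^sub>l (a *\<^sub>l gr (Ident [s, s]) - b *\<^sub>l gr (web s)))
      \<odot>\<^sub>l gr (Cup ?t \<otimes> Ident [s]))"
    by (intro MOY_eq_comp_left[where b = "[?t, s, s]"] MOY_eq_comp_right[where b = "[?t, s, s]"])
      (simp_all add: lin_hom_gr in_hom_def)
  then have "MOY_eq n [s] [s]
    (Z_MOY n ((Cap ?t \<otimes> Ident [s]) \<odot> (Ident [?t] \<otimes> cross d s s) \<odot> (Cup ?t \<otimes> Ident [s])))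
    (a *\<^sub>l gr ((Cap ?t \<otimes> Ident [s]) \<odot> (Ident [?t] \<otimes> Ident [s, s]) \<odot> (Cup ?t \<otimes> Ident [s]))
      - b *\<^sub>l gr (web_curl s))"
    by (simp add: web_curl_def)
  also have "MOY_eq n [s] [s] \<dots> (a *\<^sub>l q_int (int n) *\<^sub>l gr (Ident [s]) - b *\<^sub>l q_int (int n - 1) *\<^sub>l gr (Ident [s]))"
  proof (intro MOY_eq_diff MOY_eq_scale MOY_curl)
    have "MOY_eq n [s] [s] (gr ((Cap ?t \<otimes> Ident [s]) \<odot> (Ident [?t] \<otimes> Ident [s, s]) \<odot> (Cup ?t \<otimes> Ident [s])))
      (gr (Cap ?t \<odot> Cup ?t) \<otimes>\<^sub>l gr (Ident [s]))"
      by (auto intro!: MOY_eq_isotopic simp: in_hom_def abs_dgm_simps idn_collect idn_cmp whisker_right)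
    also have "MOY_eq n [s] [s] \<dots> ((q_int (int n) *\<^sub>l gr (Ident [])) \<otimes>\<^sub>l gr (Ident [s]))"
      using MOY_eq_tens_right[OF lin_hom_gr MOY_eq_relation[OF MOY_relation.circle[of n ?t]],
          of "Ident [s]" "[s]" "[s]"]
      by (simp add: in_hom_def)
    also have "\<dots> = q_int (int n) *\<^sub>l gr (Ident [] \<otimes> Ident [s])" by simp
    also have "MOY_eq n [s] [s] \<dots> (q_int (int n) *\<^sub>l gr (Ident [s]))"
      by (intro MOY_eq_scale MOY_eq_isotopic) (simp_all add: in_hom_def abs_dgm_simps)
    finally show "MOY_eq n [s] [s] (gr ((Cap ?t \<otimes> Ident [s]) \<odot> (Ident [?t] \<otimes> Ident [s, s]) \<odot> (Cup ?t \<otimes> Ident [s])))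
      (q_int (int n) *\<^sub>l gr (Ident [s]))" .
  qed
  also have "a *\<^sub>l q_int (int n) *\<^sub>l gr (Ident [s]) - b *\<^sub>l q_int (int n - 1) *\<^sub>l gr (Ident [s]) = gr (Ident [s])"
    using Z_coeffs(4)[of n d] by (simp add: defs flip: scale_left)
  finally show ?thesis .
qed

text \<open>Both sides are expanded into words in the two webs, and the hexagon relation replaces A
  B A by B A B + A - B. The words of length at least two and the identity then match; for A and B
  the difference is a multiple of a^2 - (q + q^(-1)) a b + b^2 = 0. The coefficients
  \<open>c\<close> and \<open>e\<close> of the crossing \<open>d\<close> stay arbitrary.\<close>

lemma Z_triangle:
  "MOY_eq n [Up, Up, Up] [Up, Up, Up]
    (Z_MOY n ((cross d Up Up \<otimes> Ident [Up]) \<odot> (Ident [Up] \<otimes> cross Slash Up Up)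
      \<odot> (cross Slash Up Up \<otimes> Ident [Up])))
    (Z_MOY n ((Ident [Up] \<otimes> cross Slash Up Up) \<odot> (cross Slash Up Up \<otimes> Ident [Up])
      \<odot> (Ident [Up] \<otimes> cross d Up Up)))"
proof -
  let ?a = "[Up, Up, Up]"
  define a b c e where coeffs: "a = Z_id_coeff n Slash" "b = Z_web_coeff n Slash"
    "c = Z_id_coeff n d" "e = Z_web_coeff n d"
  \<comment> \<open>\<open>J\<close> and \<open>J'\<close> are two ways of writing three parallel
    strands; in \<open>lin\<close> they are different terms, identified only modulo isotopy.\<close>
  define A B J J' I where graphs: "A = web Up \<otimes> Ident [Up]" "B = Ident [Up] \<otimes> web Up"
    "J = (Ident [Up, Up] \<otimes> Ident [Up] :: graph)" "J' = (Ident [Up] \<otimes> Ident [Up, Up] :: graph)"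
    "I = (Ident ?a :: graph)"
  have Z_cross: "Z_MOY n (cross k Up Up) = Z_id_coeff n k *\<^sub>l gr (Ident [Up, Up]) - Z_web_coeff n k *\<^sub>l gr (web Up)" for k
    by (simp add: Z_MOY_up_crossing)
  have iso: "MOY_eq n ?a ?a (gr D) (gr E)" if "abs_dgm D = abs_dgm E" "in_hom D ?a ?a" for D E
    using that by (rule MOY_eq_isotopic)
  have AA: "MOY_eq n ?a ?a (gr (A \<odot> J' \<odot> A)) ((q + q_inv) *\<^sub>l gr A)"
  proof -
    have "MOY_eq n ?a ?a (gr (A \<odot> J' \<odot> A)) (gr (web Up \<odot> web Up) \<otimes>\<^sub>l gr (Ident [Up]))"
      by (auto intro!: iso simp: graphs in_hom_def abs_dgm_simps idn_collect idn_cmp whisker_right)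
    also have "MOY_eq n ?a ?a \<dots> (((q + q_inv) *\<^sub>l gr (web Up)) \<otimes>\<^sub>l gr (Ident [Up]))"
      using MOY_eq_tens_right[OF lin_hom_gr MOY_eq_relation[OF MOY_relation.digon[of n Up]],
          of "Ident [Up]" "[Up]" "[Up]"]
      by (simp add: in_hom_def)
    finally show ?thesis by (simp add: graphs)
  qed
  have BB: "MOY_eq n ?a ?a (gr (B \<odot> J \<odot> B)) ((q + q_inv) *\<^sub>l gr B)"
  proof -
    have "MOY_eq n ?a ?a (gr (B \<odot> J \<odot> B)) (gr (Ident [Up]) \<otimes>\<^sub>l gr (web Up \<odot> web Up))"
      by (auto intro!: iso simp: graphs in_hom_def abs_dgm_simps idn_collect idn_cmp whisker_left)
    also have "MOY_eq n ?a ?a \<dots> (gr (Ident [Up]) \<otimes>\<^sub>l ((q + q_inv) *\<^sub>l gr (web Up)))"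
      using MOY_eq_tens_left[OF lin_hom_gr MOY_eq_relation[OF MOY_relation.digon[of n Up]],
          of "Ident [Up]" "[Up]" "[Up]"]
      by (simp add: in_hom_def)
    finally show ?thesis by (simp add: graphs)
  qed
  have ABA: "MOY_eq n ?a ?a (gr (A \<odot> B \<odot> A)) (gr (B \<odot> A \<odot> B) + gr A - gr B)"
    using MOY_eq_diff[OF MOY_eq_relation[OF MOY_relation.hexagon[of n Up]] MOY_eq_refl[of n ?a ?a "gr B"]]
    by (simp add: graphs)
  have words: "MOY_eq n ?a ?a (gr (J \<odot> J' \<odot> J)) (gr I)" "MOY_eq n ?a ?a (gr (J' \<odot> J \<odot> J')) (gr I)"
    "MOY_eq n ?a ?a (gr (J \<odot> J' \<odot> A)) (gr A)" "MOY_eq n ?a ?a (gr (J \<odot> B \<odot> J)) (gr B)"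
    "MOY_eq n ?a ?a (gr (A \<odot> J' \<odot> J)) (gr A)" "MOY_eq n ?a ?a (gr (J \<odot> B \<odot> A)) (gr (B \<odot> A))"
    "MOY_eq n ?a ?a (gr (A \<odot> B \<odot> J)) (gr (A \<odot> B))"
    "MOY_eq n ?a ?a (gr (J' \<odot> J \<odot> B)) (gr B)" "MOY_eq n ?a ?a (gr (J' \<odot> A \<odot> J')) (gr A)"
    "MOY_eq n ?a ?a (gr (B \<odot> J \<odot> J')) (gr B)" "MOY_eq n ?a ?a (gr (J' \<odot> A \<odot> B)) (gr (A \<odot> B))"
    "MOY_eq n ?a ?a (gr (B \<odot> A \<odot> J')) (gr (B \<odot> A))"
    by (auto intro!: iso simp: graphs in_hom_def abs_dgm_simps idn_collect idn_cmp cmp_idn)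
  have "Z_MOY n ((cross d Up Up \<otimes> Ident [Up]) \<odot> (Ident [Up] \<otimes> cross Slash Up Up)
      \<odot> (cross Slash Up Up \<otimes> Ident [Up]))
    = (c * (a * a)) *\<^sub>l gr (J \<odot> J' \<odot> J) - (c * (a * b)) *\<^sub>l gr (J \<odot> J' \<odot> A)
      - ((c * (b * a)) *\<^sub>l gr (J \<odot> B \<odot> J) - (c * (b * b)) *\<^sub>l gr (J \<odot> B \<odot> A))
      - ((e * (a * a)) *\<^sub>l gr (A \<odot> J' \<odot> J) - (e * (a * b)) *\<^sub>l gr (A \<odot> J' \<odot> A)
        - ((e * (b * a)) *\<^sub>l gr (A \<odot> B \<odot> J) - (e * (b * b)) *\<^sub>l gr (A \<odot> B \<odot> A)))"
    by (simp add: Z_cross coeffs graphs algebra_simps del: cross.simps)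
  also have "MOY_eq n ?a ?a \<dots>
    ((c * (a * a)) *\<^sub>l gr I - (c * (a * b)) *\<^sub>l gr A
      - ((c * (b * a)) *\<^sub>l gr B - (c * (b * b)) *\<^sub>l gr (B \<odot> A))
      - ((e * (a * a)) *\<^sub>l gr A - (e * (a * b)) *\<^sub>l (q + q_inv) *\<^sub>l gr A
        - ((e * (b * a)) *\<^sub>l gr (A \<odot> B) - (e * (b * b)) *\<^sub>l (gr (B \<odot> A \<odot> B) + gr A - gr B))))"
    (is "MOY_eq _ _ _ _ ?L")
    by (intro MOY_eq_diff MOY_eq_scale words AA ABA)
  finally have L: "MOY_eq n ?a ?a (Z_MOY n ((cross d Up Up \<otimes> Ident [Up]) \<odot> (Ident [Up] \<otimes> cross Slash Up Up)
      \<odot> (cross Slash Up Up \<otimes> Ident [Up]))) ?L" .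
  have "Z_MOY n ((Ident [Up] \<otimes> cross Slash Up Up) \<odot> (cross Slash Up Up \<otimes> Ident [Up])
      \<odot> (Ident [Up] \<otimes> cross d Up Up))
    = (a * (a * c)) *\<^sub>l gr (J' \<odot> J \<odot> J') - (a * (a * e)) *\<^sub>l gr (J' \<odot> J \<odot> B)
      - ((a * (b * c)) *\<^sub>l gr (J' \<odot> A \<odot> J') - (a * (b * e)) *\<^sub>l gr (J' \<odot> A \<odot> B))
      - ((b * (a * c)) *\<^sub>l gr (B \<odot> J \<odot> J') - (b * (a * e)) *\<^sub>l gr (B \<odot> J \<odot> B)
        - ((b * (b * c)) *\<^sub>l gr (B \<odot> A \<odot> J') - (b * (b * e)) *\<^sub>l gr (B \<odot> A \<odot> B)))"
    by (simp add: Z_cross coeffs graphs algebra_simps del: cross.simps)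
  also have "MOY_eq n ?a ?a \<dots>
    ((a * (a * c)) *\<^sub>l gr I - (a * (a * e)) *\<^sub>l gr B
      - ((a * (b * c)) *\<^sub>l gr A - (a * (b * e)) *\<^sub>l gr (A \<odot> B))
      - ((b * (a * c)) *\<^sub>l gr B - (b * (a * e)) *\<^sub>l (q + q_inv) *\<^sub>l gr B
        - ((b * (b * c)) *\<^sub>l gr (B \<odot> A) - (b * (b * e)) *\<^sub>l gr (B \<odot> A \<odot> B))))"
    (is "MOY_eq _ _ _ _ ?R")
    by (intro MOY_eq_diff MOY_eq_scale words BB MOY_eq_refl)
  finally have R: "MOY_eq n ?a ?a (Z_MOY n ((Ident [Up] \<otimes> cross Slash Up Up) \<odot> (cross Slash Up Up \<otimes> Ident [Up])
      \<odot> (Ident [Up] \<otimes> cross d Up Up))) ?R" .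
  have "?L = ?R"
  proof (rule poly_mapping_eqI)
    fix D
    have "a * a - (q + q_inv) * (a * b) + b * b = 0"
      unfolding coeffs by (rule Z_coeffs)
    then have "(c * (a * a)) * i - (c * (a * b)) * x - ((c * (b * a)) * y - (c * (b * b)) * yx)
        - ((e * (a * a)) * x - (e * (a * b)) * ((q + q_inv) * x)
          - ((e * (b * a)) * xy - (e * (b * b)) * (yxy + x - y)))
      = (a * (a * c)) * i - (a * (a * e)) * y - ((a * (b * c)) * x - (a * (b * e)) * xy)
        - ((b * (a * c)) * y - (b * (a * e)) * ((q + q_inv) * y)
          - ((b * (b * c)) * yx - (b * (b * e)) * yxy))" for i x y xy yx yxy
      by algebra
    then show "Poly_Mapping.lookup ?L D = Poly_Mapping.lookup ?R D"
      by (simp only: lookup_minus lookup_add lookup_scale)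
  qed
  with R have R': "MOY_eq n ?a ?a (Z_MOY n ((Ident [Up] \<otimes> cross Slash Up Up) \<odot> (cross Slash Up Up \<otimes> Ident [Up])
      \<odot> (Ident [Up] \<otimes> cross d Up Up))) ?L" by (simp only:)
  show ?thesis by (rule MOY_eq_trans[OF L MOY_eq_sym[OF R']])
qed

lemma Z_rotate:
  "MOY_eq n [Down, Down] [Down, Down] (Z_MOY n (left_mate Up (Vertex X))) (Z_MOY n (right_mate Up (Vertex X)))"
proof -
  obtain d where X: "Vertex X = up_crossing d"
    by (cases X) (metis up_crossing.simps)+
  have left: "Z_MOY n (left_mate Up (up_crossing d)) = Z_id_coeff n d *\<^sub>l gr (left_mate Up (Ident [Up, Up]))
      - Z_web_coeff n d *\<^sub>l gr (left_mate Up (web Up))"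
    by (simp add: left_mate_def Let_def Z_MOY_up_crossing)
  have right: "Z_MOY n (right_mate Up (up_crossing d)) = Z_id_coeff n d *\<^sub>l gr (right_mate Up (Ident [Up, Up]))
      - Z_web_coeff n d *\<^sub>l gr (right_mate Up (web Up))"
    by (simp add: right_mate_def Let_def Z_MOY_up_crossing)
  have mates: "abs_dgm (left_mate Up D) = half_ccw Up (abs_dgm D)"
    "abs_dgm (right_mate Up D) = half_cw Up (abs_dgm D)" for D :: graph
    by (simp_all add: half_ccw_def left_mate_def half_cw_def right_mate_def Let_def abs_dgm_simps)
  have "abs_dgm (left_mate Up (Ident [Up, Up] :: graph)) = abs_dgm (right_mate Up (Ident [Up, Up]))"
    using half_cw_idn[of Up, where 'v = web] half_ccw_idn[of Up, where 'v = web]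
    by (simp add: mates abs_dgm_simps)
  moreover have "abs_dgm (left_mate Up (web Up)) = abs_dgm (right_mate Up (web Up))"
    using half_web[of Up] by (simp add: mates abs_dgm_simps)
  ultimately show ?thesis unfolding X left right
    by (intro MOY_eq_diff MOY_eq_scale MOY_eq_isotopic) (simp_all add: left_mate_def Let_def in_hom_def)
qed

lemma Z_basic_move:
  assumes "basic_move D E"
  shows "MOY_eq n (src D) (tgt D) (Z_MOY n D) (Z_MOY n E)"
  using assms
proof cases
  case (rotate X)
  then show ?thesis using Z_rotate[of n X] by (simp add: left_mate_def Let_def)
next
  case (curl s d)
  then show ?thesis using Z_curl[of n s d] by simp
next
  case (cancel d t s)
  then show ?thesis
    using Z_cancel_same[of n s d] Z_cancel_opposite[of t s n d] by (cases "s = t") (auto simp: neq_opp_iff)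
next
  case (triangle d)
  then show ?thesis using Z_triangle[of n d] in_hom_up_crossing[of Slash] in_hom_up_crossing[of d]
    by (simp add: in_hom_def)
qed

lemma Z_MOY_abs_dgm:
  assumes "abs_dgm D = abs_dgm E" "wf_diagram D"
  shows "MOY_eq n (src D) (tgt D) (Z_MOY n D) (Z_MOY n E)"
  using assms
  by (intro Z_MOY_diagram_eq[where R = wf_moves])
    (auto simp: dgm.abs_eq_iff isotopic_def wf_moves_def moves_crossing_def intro: Z_basic_move)

lemma tangle_eq_abs_dgm:
  assumes "abs_dgm D = abs_dgm E" "wf_diagram D"
  shows "tangle_eq D E"
proof -
  have "diagram_eq wf_moves D E"
    using assms by (auto simp: dgm.abs_eq_iff isotopic_def)
  then show ?thesis
    by (rule diagram_eq_mono) (simp add: wf_moves_def moves_crossing_def basic_move_tangle_move)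
qed

section \<open>Comparison with the Jones polynomial\<close>

theorem corollary3p2p1:
  fixes n :: nat and Jones :: "tangle \<Rightarrow> qring" and \<Gamma> :: tangle
  assumes "n \<ge> 2"
    and "is_Jones n Jones"
    and "oriented_link \<Gamma>"
  shows "MOY_eq n [] [] (Z_MOY n \<Gamma>) (Jones \<Gamma> *\<^sub>l gr (Ident []))"
proof -
  have J_eq: "Jones L = Jones L'" if "oriented_link L" "oriented_link L'" "tangle_eq L L'" for L L'
    using assms(2) that by (auto simp: is_Jones_def)
  have J_tens: "Jones (L \<otimes> L') = Jones L * Jones L'" if "oriented_link L" "oriented_link L'" for L L'
    using assms(2) that by (simp add: is_Jones_def)
  have J_empty: "Jones (Ident []) = 1" and J_circle: "Jones (Cap s \<odot> Cup s) = q_int (int n)" for s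
    using assms(2) by (simp_all add: is_Jones_def)
  define P where "P L \<longleftrightarrow> MOY_eq n [] [] (Z_MOY n L) (Jones L *\<^sub>l gr (Ident []))" for L
  \<comment> \<open>A property of the link up to the basic moves; \<open>P_abs\<close> makes it
    independent of the chosen term.\<close>
  define N where "N x \<longleftrightarrow> (\<exists>L. x = abs_dgm L \<and> oriented_link L \<and> P L)" for x
  have P_abs: "P L" if "abs_dgm L = abs_dgm L'" "oriented_link L" "oriented_link L'" "P L'" for L L'
    using that Z_MOY_abs_dgm[of L L' n] tangle_eq_abs_dgm[of L L'] J_eq[of L L']
    by (auto simp: P_def oriented_link_def in_hom_def intro: MOY_eq_trans)
  have N_abs: "N (abs_dgm L) \<longleftrightarrow> P L" if "oriented_link L" for L
    using that P_abs unfolding N_def by metis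
  \<comment> \<open>One form for both signs of the crossing. The factor (q^(-1) - q), or its
    negative, is expressed by the coefficients of \<open>Z_MOY\<close>, since q^(-n) q^(n-1) =
    q^(-1) and q^n q^(1-n) = q.\<close>
  have J_skein: "Z_web_coeff n (other d) * Jones (A \<odot> (Ident u \<otimes> up_crossing d \<otimes> Ident v) \<odot> B)
      = Z_web_coeff n d * Jones (A \<odot> (Ident u \<otimes> up_crossing (other d) \<otimes> Ident v) \<odot> B)
        + (Z_web_coeff n (other d) * Z_id_coeff n d - Z_web_coeff n d * Z_id_coeff n (other d))
          * Jones (A \<odot> (Ident u \<otimes> Ident [Up, Up] \<otimes> Ident v) \<odot> B)"
    if "in_hom A (u @ [Up, Up] @ v) []" "in_hom B [] (u @ [Up, Up] @ v)" for A B u v d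
  proof -
    have "q_power (- int n) * Jones (A \<odot> (Ident u \<otimes> Vertex XPos \<otimes> Ident v) \<odot> B)
        - q_power (int n) * Jones (A \<odot> (Ident u \<otimes> Vertex XNeg \<otimes> Ident v) \<odot> B)
        = (q_inv - q) * Jones (A \<odot> (Ident u \<otimes> Ident [Up, Up] \<otimes> Ident v) \<odot> B)"
      using assms(2) that by (simp add: is_Jones_def)
    moreover have "q_power (- int n) * q_power (int n - 1) = q_inv" "q_power (int n) * q_power (1 - int n) = q"
      by (simp_all flip: q_power_add)
    ultimately show ?thesis
      by (cases d) (simp_all add: Z_id_coeff_def Z_web_coeff_def algebra_simps)
  qed
  interpret skein_class N
  proof
    show "N (idn [])"
      using N_abs[of "Ident []"] by (simp add: P_def J_empty MOY_eq_refl oriented_link_def in_hom_def abs_dgm_simps)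
  next
    fix L :: "crossing dgm" and s
    assume "ok L" "dom L = []" "cod L = []" "N L"
    then obtain D where D: "L = abs_dgm D" "oriented_link D" "P D" by (auto simp: N_def)
    have circle: "oriented_link (Cap s \<odot> Cup s)" by (simp add: oriented_link_def in_hom_def)
    have "MOY_eq n ([] @ []) ([] @ []) (gr (Cap s \<odot> Cup s) \<otimes>\<^sub>l Z_MOY n D)
      ((q_int (int n) *\<^sub>l gr (Ident [])) \<otimes>\<^sub>l (Jones D *\<^sub>l gr (Ident [])))"
      using D(2,3)
      by (intro MOY_eq_tens[OF MOY_eq_relation[OF MOY_relation.circle]] lin_hom_Z_MOY' lin_hom.gr)
        (simp_all add: P_def oriented_link_def in_hom_def)
    then have "MOY_eq n [] [] (Z_MOY n ((Cap s \<odot> Cup s) \<otimes> D))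
      ((q_int (int n) * Jones D) *\<^sub>l gr (Ident [] \<otimes> Ident []))"
      by (simp add: mult.commute)
    also have "MOY_eq n [] [] \<dots> ((q_int (int n) * Jones D) *\<^sub>l gr (Ident []))"
      by (intro MOY_eq_scale MOY_eq_isotopic) (simp_all add: abs_dgm_simps in_hom_def)
    finally have "P ((Cap s \<odot> Cup s) \<otimes> D)"
      using J_tens[OF circle D(2)] by (simp add: P_def J_circle)
    then show "N ((cap s \<bullet> cup s) \<star> L)"
      using D circle N_abs[of "(Cap s \<odot> Cup s) \<otimes> D"]
      by (simp add: oriented_link_def in_hom_def abs_dgm_simps)
  next
    fix A B u v d
    assume A: "ok A" "dom A = u @ [Up, Up] @ v" "cod A = []"
      and B: "ok B" "dom B = []" "cod B = u @ [Up, Up] @ v"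
      and N0: "N (A \<bullet> B)" and N1: "N (A \<bullet> (idn u \<star> crs (other d) Up Up \<star> idn v) \<bullet> B)"
    obtain A' B' where AB': "A = abs_dgm A'" "B = abs_dgm B'" by (meson dgm_cases)
    have A': "in_hom A' (u @ [Up, Up] @ v) []" and B': "in_hom B' [] (u @ [Up, Up] @ v)"
      using A B by (auto simp: AB' in_hom_def ok.abs_eq dom.abs_eq cod.abs_eq split: if_splits)
    define L where "L X = A' \<odot> (Ident u \<otimes> X \<otimes> Ident v) \<odot> B'" for X
    have link: "oriented_link (L X)" if "in_hom X [Up, Up] [Up, Up]" for X
      using that A' B' by (auto simp: oriented_link_def L_def in_hom_def)
    have links: "oriented_link (L (up_crossing e))" "oriented_link (L (Ident [Up, Up]))" for e
      using link[OF in_hom_up_crossing] link[of "Ident [Up, Up]"] by (simp_all add: in_hom_def)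
    have abs_L: "abs_dgm (L (up_crossing e)) = A \<bullet> (idn u \<star> crs e Up Up \<star> idn v) \<bullet> B" for e
      by (simp add: L_def AB' abs_dgm_simps crs_def)
    have abs_L0: "abs_dgm (L (Ident [Up, Up])) = A \<bullet> B"
      using B by (simp add: L_def AB'[symmetric] abs_dgm_simps idn_collect idn_cmp)
    have P: "P (L (Ident [Up, Up]))" "P (L (up_crossing (other d)))"
      using N0 N1 N_abs links by (simp_all flip: abs_L abs_L0)
    define a b a' b' where coeffs: "a = Z_id_coeff n d" "b = Z_web_coeff n d"
      "a' = Z_id_coeff n (other d)" "b' = Z_web_coeff n (other d)"
    have aabb: "a * a' = 1" "b * b' = 1" unfolding coeffs by (rule Z_coeffs)+
    have J: "b' * Jones (L (up_crossing d))
        = b * Jones (L (up_crossing (other d))) + (b' * a - b * a') * Jones (L (Ident [Up, Up]))"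
      using J_skein[OF A' B', of d] by (simp only: coeffs L_def)
    \<comment> \<open>The same relation for \<open>Z_MOY\<close>, solved for the crossing
      \<open>d\<close> by multiplying with \<open>b\<close>, the inverse of \<open>b'\<close>. The
      web summands on the two sides agree because b b b' = b.\<close>
    have "Z_MOY n (L (up_crossing d)) = b *\<^sub>l (b *\<^sub>l Z_MOY n (L (up_crossing (other d)))
        + (b' * a - b * a') *\<^sub>l Z_MOY n (L (Ident [Up, Up])))"
    proof (rule poly_mapping_eqI)
      fix D
      let ?Z0 = "Z_MOY n (L (Ident [Up, Up]))"
      let ?W = "Z_MOY n A' \<odot>\<^sub>l (gr (Ident u) \<otimes>\<^sub>l gr (web Up) \<otimes>\<^sub>l gr (Ident v)) \<odot>\<^sub>l Z_MOY n B'"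
      have Z: "Z_MOY n (L (up_crossing e)) = Z_id_coeff n e *\<^sub>l ?Z0 - Z_web_coeff n e *\<^sub>l ?W" for e
        by (simp add: L_def Z_MOY_up_crossing)
      have "a * x - b * y = b * (b * (a' * x - b' * y) + (b' * a - b * a') * x)" for x y
        using aabb by algebra
      then show "Poly_Mapping.lookup (Z_MOY n (L (up_crossing d))) D
        = Poly_Mapping.lookup (b *\<^sub>l (b *\<^sub>l Z_MOY n (L (up_crossing (other d)))
          + (b' * a - b * a') *\<^sub>l ?Z0)) D"
        by (simp only: Z lookup_minus lookup_add lookup_scale flip: coeffs)
    qed
    also have "MOY_eq n [] [] \<dots> (b *\<^sub>l (b *\<^sub>l Jones (L (up_crossing (other d))) *\<^sub>l gr (Ident [])
        + (b' * a - b * a') *\<^sub>l Jones (L (Ident [Up, Up])) *\<^sub>l gr (Ident [])))"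
      using P unfolding P_def by (intro MOY_eq_scale MOY_eq_add)
    also have "\<dots> = (b * (b' * Jones (L (up_crossing d)))) *\<^sub>l gr (Ident [])"
      unfolding J by (simp add: distrib_left scale_left mult.assoc)
    also have "b * (b' * Jones (L (up_crossing d))) = Jones (L (up_crossing d))"
      using aabb by (simp flip: mult.assoc)
    finally have "P (L (up_crossing d))" by (simp add: P_def)
    then show "N (A \<bullet> (idn u \<star> crs d Up Up \<star> idn v) \<bullet> B)"
      using N_abs[OF links(1)] by (simp add: abs_L)
  qed
  have "N (abs_dgm \<Gamma>)"
    using assms(3) by (intro N_link) (auto simp: oriented_link_def in_hom_def ok.abs_eq dom.abs_eq cod.abs_eq)
  then show ?thesis using N_abs[OF assms(3)] by (simp add: P_def)
qed

end
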